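(* Let $\Phi$ be a root system of type $E_6$, and let $\omega\in W_{A_\circ}=\{1,\omega_1,\omega_6\}$. Then for every $q\in\mathbb{Z}_{>0}$: - if $\omega=1$ and $\gcd\{6,q\}=1$: $\chi_{\Phi,q}(\omega) = (q-1)(q-4)(q-5)(q-7)(q-8)(q-11)$; - if $\omega=1$ and $\gcd\{6,q\}=2$: $\chi_{\Phi,q}(\omega) = (q-2)(q-4)(q-8)(q-10)(q^2-12q+26)$; - if $\omega=1$ and $\gcd\{6,q\}=3$: $\chi_{\Phi,q}(\omega) = (q-3)(q-9)(q^4-24q^3+195q^2-612q+480)$; - if $\omega=1$ and $\gcd\{6,q\}=6$: $\chi_{\Phi,q}(\omega) = (q-6)^2(q^4-24q^3+186q^2-504q+480)$; - if $\omega\in\{\omega_1,\omega_6\}$ and $\gcd\{6,q\}\in\{1,2\}$: $\chi_{\Phi,q}(\omega)=0$; - if $\omega\in\{\omega_1,\omega_6\}$ and $\gcd\{6,q\}=3$: $\chi_{\Phi,q}(\omega) = 2(q-3)(q-9)$; - if $\omega\in\{\omega_1,\omega_6\}$ and $\gcd\{6,q\}=6$: $\chi_{\Phi,q}(\omega) = 2(q-6)^2$.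
   Context: Let $\Phi$ be the root system of type $E_6$ in a Euclidean space $E$ of dimension $6$ with inner product $(\cdot,\cdot)$, Weyl group $W$, and simple roots in Bourbaki numbering, e.g. $\alpha_1=\frac12(e_1-e_2-e_3-e_4-e_5-e_6-e_7+e_8)$, $\alpha_2=e_1+e_2$, $\alpha_3=e_2-e_1$, $\alpha_4=e_3-e_2$, $\alpha_5=e_4-e_3$, $\alpha_6=e_5-e_4$ in $E=\{x\in\mathbb{R}^8: x_6=x_7=-x_8\}$. The coweight lattice is $Z := \{x\in E : (\alpha,x)\in\mathbb{Z}\ \forall\alpha\in\Phi\}$. For $q\in\mathbb{Z}_{>0}$, $M(\Phi;q) := \{x+qZ\in Z/qZ : (\beta,x)\not\equiv0\pmod q\ \forall\beta\in\Phi\}$; $W$ acts on it via $w(x+qZ)=w(x)+qZ$, and $\chi_{\Phi,q}(w) := \#\{t\in M(\Phi;q) : w(t)=t\}$. Let $\tilde\alpha=\sum_{i=1}^6 n_i\alpha_i$ be the highest root, $n_0:=1$, $J:=\{i\in\{0,\dots,6\}: n_i=1\}$ (here $J=\{0,1,6\}$). Let $w_0$ be the longest element of $W$; for $j\in J\setminus\{0\}$ let $w_j$ be the longest element of the subgroup generated by the simple reflections $s_{\alpha_i}$, $i\ne j$; put $\omega_j := w_jw_0$ and $\omega_0:=1$. Let $A_\circ=\{x\in E : (\alpha_i,x)>0\ \forall i,\ (\tilde\alpha,x)<1\}$; $W_{A_\circ}$ is the subgroup of $w\in W$ mapping the image of $A_\circ$ in $E/Z$ to itself, and $W_{A_\circ}=\{\omega_j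 : j\in J\}$. *)

theory Defs
  imports "HOL-Analysis.Analysis"
begin

text \<open>
  Root systems live in a subspace \<open>E\<close> of an arbitrary Euclidean space. This covers both an intrinsic
  six-dimensional \<open>E\<close> and the usual realisation of type \<open>E\<^sub>6\<close> inside the eight-dimensional space.
  Reflections, and hence Weyl group elements, are maps of the ambient space; they fix the
  orthogonal complement of \<open>E\<close> pointwise, so they are determined by their restriction to \<open>E\<close>.
\<close>

definition reflect :: "'a::euclidean_space \<Rightarrow> 'a \<Rightarrow> 'a" where
  "reflect \<beta> x = x - (2 * (\<beta> \<bullet> x) / (\<beta> \<bullet> \<beta>)) *\<^sub>R \<beta>"

definition root_system :: "'a::euclidean_space set \<Rightarrow> 'a set \<Rightarrow> bool" where
  "root_system E \<Phi> \<longleftrightarrow>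
     finite \<Phi> \<and> 0 \<notin> \<Phi> \<and> span \<Phi> = E \<and>
     (\<forall>\<beta>\<in>\<Phi>. \<forall>c. c *\<^sub>R \<beta> \<in> \<Phi> \<longrightarrow> c = 1 \<or> c = -1) \<and>
     (\<forall>\<beta>\<in>\<Phi>. reflect \<beta> ` \<Phi> = \<Phi>) \<and>
     (\<forall>\<beta>\<in>\<Phi>. \<forall>\<gamma>\<in>\<Phi>. 2 * (\<beta> \<bullet> \<gamma>) / (\<beta> \<bullet> \<beta>) \<in> \<int>)"

definition root_base :: "'a::euclidean_space set \<Rightarrow> 'a set \<Rightarrow> 'a set \<Rightarrow> bool" where
  "root_base E \<Phi> \<Delta> \<longleftrightarrow>
     \<Delta> \<subseteq> \<Phi> \<and> independent \<Delta> \<and> span \<Delta> = E \<and>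
     (\<forall>\<beta>\<in>\<Phi>. \<exists>c :: 'a \<Rightarrow> int.
        \<beta> = (\<Sum>\<delta>\<in>\<Delta>. of_int (c \<delta>) *\<^sub>R \<delta>) \<and>
        ((\<forall>\<delta>\<in>\<Delta>. c \<delta> \<ge> 0) \<or> (\<forall>\<delta>\<in>\<Delta>. c \<delta> \<le> 0)))"

text \<open>The Dynkin diagram in Bourbaki numbering: the chain 1-3-4-5-6, with 2 attached to 4.\<close>

definition E6_edge :: "nat \<Rightarrow> nat \<Rightarrow> bool" where
  "E6_edge i j \<longleftrightarrow> {i, j} \<in> {{1, 3}, {3, 4}, {4, 5}, {5, 6}, {2, 4}}"

definition E6_cartan :: "nat \<Rightarrow> nat \<Rightarrow> int" where
  "E6_cartan i j = (if i = j then 2 else if E6_edge i j then -1 else 0)"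

definition E6_root_system :: "'a::euclidean_space set \<Rightarrow> 'a set \<Rightarrow> (nat \<Rightarrow> 'a) \<Rightarrow> bool" where
  "E6_root_system E \<Phi> \<alpha> \<longleftrightarrow>
     root_system E \<Phi> \<and> inj_on \<alpha> {1..6} \<and> root_base E \<Phi> (\<alpha> ` {1..6}) \<and>
     (\<forall>i\<in>{1..6}. \<forall>j\<in>{1..6}. 2 * (\<alpha> i \<bullet> \<alpha> j) / (\<alpha> j \<bullet> \<alpha> j) = of_int (E6_cartan i j))"

text \<open>
  Since reflections in nonzero vectors are involutions, the products of finite sequences of
  reflections in vectors from \<open>S\<close> form the group generated by these reflections.
\<close>

definition refl_word :: "'a::euclidean_space list \<Rightarrow> 'a \<Rightarrow> 'a" where
  "refl_word bs = foldr (\<circ>) (map reflect bs) id"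

definition refl_group :: "'a::euclidean_space set \<Rightarrow> ('a \<Rightarrow> 'a) set" where
  "refl_group S = {refl_word bs | bs. set bs \<subseteq> S}"

abbreviation weyl_group :: "'a::euclidean_space set \<Rightarrow> ('a \<Rightarrow> 'a) set" where
  "weyl_group \<Phi> \<equiv> refl_group \<Phi>"

definition refl_length :: "'a::euclidean_space set \<Rightarrow> ('a \<Rightarrow> 'a) \<Rightarrow> nat" where
  "refl_length S w = (LEAST n. \<exists>bs. set bs \<subseteq> S \<and> length bs = n \<and> refl_word bs = w)"

definition longest_element :: "'a::euclidean_space set \<Rightarrow> 'a \<Rightarrow> 'a" where
  "longest_element S =
     (THE w. w \<in> refl_group S \<and> (\<forall>v\<in>refl_group S. refl_length S v \<le> refl_length S w))"

definition omega :: "(nat \<Rightarrow> 'a::euclidean_space) \<Rightarrow> nat \<Rightarrow> 'a \<Rightarrow> 'a" where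
  "omega \<alpha> j =
     (if j = 0 then id
      else longest_element (\<alpha> ` ({1..6} - {j})) \<circ> longest_element (\<alpha> ` {1..6}))"

definition highest_root :: "'a::euclidean_space set \<Rightarrow> (nat \<Rightarrow> 'a) \<Rightarrow> 'a" where
  "highest_root \<Phi> \<alpha> =
     (THE \<theta>. \<theta> \<in> \<Phi> \<and> (\<forall>\<beta>\<in>\<Phi>. \<exists>c :: nat \<Rightarrow> nat. \<theta> - \<beta> = (\<Sum>i=1..6. of_nat (c i) *\<^sub>R \<alpha> i)))"

definition fundamental_alcove ::
    "'a::euclidean_space set \<Rightarrow> 'a set \<Rightarrow> (nat \<Rightarrow> 'a) \<Rightarrow> 'a set" where
  "fundamental_alcove E \<Phi> \<alpha> =
     {x \<in> E. (\<forall>i\<in>{1..6}. \<alpha> i \<bullet> x > 0) \<and> highest_root \<Phi> \<alpha> \<bullet> x < 1}"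

definition coweight_lattice :: "'a::euclidean_space set \<Rightarrow> 'a set \<Rightarrow> 'a set" where
  "coweight_lattice E \<Phi> = {x \<in> E. \<forall>\<beta>\<in>\<Phi>. \<beta> \<bullet> x \<in> \<int>}"

definition coset :: "'a::euclidean_space \<Rightarrow> 'a set \<Rightarrow> 'a set" where
  "coset x L = (\<lambda>z. x + z) ` L"

text \<open>
  Elements of the quotients by \<open>Z\<close> and \<open>qZ\<close> (where \<open>Z\<close> is the coweight lattice) are cosets, i.e. sets
  of vectors. Weyl group elements are linear and preserve \<open>Z\<close>, so the induced action
  \<open>w (x + qZ) = w x + qZ\<close> is the image of the coset under \<open>w\<close>.
\<close>

definition stabilizer_alcove ::
    "'a::euclidean_space set \<Rightarrow> 'a set \<Rightarrow> (nat \<Rightarrow> 'a) \<Rightarrow> ('a \<Rightarrow> 'a) set" where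
  "stabilizer_alcove E \<Phi> \<alpha> =
     (let A = (\<lambda>x. coset x (coweight_lattice E \<Phi>)) ` fundamental_alcove E \<Phi> \<alpha>
      in {w \<in> weyl_group \<Phi>. (\<lambda>t. w ` t) ` A = A})"

definition scaled_lattice :: "'a::euclidean_space set \<Rightarrow> 'a set \<Rightarrow> nat \<Rightarrow> 'a set" where
  "scaled_lattice E \<Phi> q = (\<lambda>z. of_nat q *\<^sub>R z) ` coweight_lattice E \<Phi>"

definition arrangement_complement ::
    "'a::euclidean_space set \<Rightarrow> 'a set \<Rightarrow> nat \<Rightarrow> 'a set set" where
  "arrangement_complement E \<Phi> q =
     {coset x (scaled_lattice E \<Phi> q) | x.
        x \<in> coweight_lattice E \<Phi> \<and> (\<forall>\<beta>\<in>\<Phi>. \<not> (\<exists>k::int. \<beta> \<bullet> x = of_int k * of_nat q))}"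

definition chi :: "'a::euclidean_space set \<Rightarrow> 'a set \<Rightarrow> nat \<Rightarrow> ('a \<Rightarrow> 'a) \<Rightarrow> nat" where
  "chi E \<Phi> q w = card {t \<in> arrangement_complement E \<Phi> q. w ` t = t}"

end

theory Submission
  imports Defs
begin

text \<open>
  Write \<open>Z\<close> for the coweight lattice and \<open>\<theta>\<close> for the highest root. The points of \<open>E\<close> at which no root takes
  a value divisible by \<open>q\<close> form open alcoves, which the group generated by the Weyl group \<open>W\<close> and the
  translations by \<open>q Z\<close> permutes. Two facts about the dilated fundamental alcove \<open>q A\<close> carry the proof.
  Every regular lattice point can be moved into \<open>q A\<close>: among its images take one nearest to a fixed
  interior point of \<open>q A\<close>, since a separating wall could be used to reflect it closer
  (\<open>exists_alcove_representative\<close>). And if \<open>w \<in> W\<close> maps some point of \<open>q A\<close> to another one modulo \<open>q Z\<close>,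
  then \<open>w \<in> {1, \<omega>\<^sub>1, \<omega>\<^sub>6}\<close> (\<open>alcove_meets_imp_Omega\<close>): such a \<open>w\<close> respects decompositions of affine roots
  that are positive on the alcove, hence permutes the indecomposable ones, whose gradients are
  \<open>-\<theta>, \<alpha>\<^sub>1, \<dots>, \<alpha>\<^sub>6\<close>; after composition with one of \<open>1, \<omega>\<^sub>1, \<omega>\<^sub>6\<close> it fixes \<open>-\<theta>\<close>, preserves the simple roots,
  and so is the identity.

  The second fact with \<open>q = 1\<close> determines the stabiliser. Together they show that
  \<open>(w, d) \<mapsto> w d + q Z\<close>, with \<open>d\<close> ranging over the lattice points of \<open>q A\<close>, is three-to-one onto \<open>M(\<Phi>; q)\<close>,
  so that \<open>3 \<bar>M(\<Phi>; q)\<bar> = \<bar>W\<bar> \<bar>Z \<inter> q A\<bar>\<close>. The lattice points of \<open>q A\<close> are the positive integer solutions of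
  \<open>c\<^sub>0 + c\<^sub>1 + 2 c\<^sub>2 + 2 c\<^sub>3 + 3 c\<^sub>4 + 2 c\<^sub>5 + c\<^sub>6 = q\<close>; adding one variable at a time yields their number as
  a quasi-polynomial with period 6. The order of \<open>W\<close> comes out by comparing leading terms: \<open>M(\<Phi>; q)\<close> is
  the complement of 36 hyperplanes with \<open>q\<^sup>5\<close> elements each in a set with \<open>q\<^sup>6\<close> elements, and one large
  value of \<open>q\<close> leaves 51840 as the only possibility (\<open>card_W\<close>).

  The elements \<open>\<omega>\<^sub>1\<close> and \<open>\<omega>\<^sub>6\<close> rotate the extended Dynkin diagram. A coset is therefore fixed if and only if
  modulo \<open>q\<close> the roots \<open>-\<theta>, \<alpha>\<^sub>1, \<alpha>\<^sub>6\<close> take one common value \<open>a\<close> and \<open>\<alpha>\<^sub>2, \<alpha>\<^sub>3, \<alpha>\<^sub>5\<close> another one \<open>b\<close>; with \<open>c\<close> the value of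
  \<open>\<alpha>\<^sub>4\<close> this means \<open>3 (a + 2 b + c) \<equiv> 0\<close>. Since \<open>a + 2 b + c\<close> is the value of the root
  \<open>\<alpha>\<^sub>1 + \<alpha>\<^sub>2 + \<alpha>\<^sub>3 + \<alpha>\<^sub>4\<close>, it is nonzero modulo \<open>q\<close>, which is impossible unless \<open>3\<close> divides \<open>q\<close>. For \<open>q = 3 m\<close> two
  classes \<open>m\<close> and \<open>2 m\<close> remain, and on each of them the roots restrict to an arrangement of type \<open>G\<^sub>2\<close> in
  \<open>b\<close> and \<open>c\<close>, which is counted directly.

  That \<open>\<Phi>\<close> consists of 36 tabulated positive roots and their negatives follows from the axioms by
  induction on the height. Lengths of Weyl group elements are counted by inversions, which
  identifies longest elements with explicit words and makes \<open>\<omega>\<^sub>1\<close> and \<open>\<omega>\<^sub>6\<close> computable.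
\<close>

section \<open>Reflections and words of reflections\<close>

lemma refl_word_Nil [simp]: "refl_word [] = id"
  by (simp add: refl_word_def)

lemma refl_word_Cons: "refl_word (b # bs) = reflect b \<circ> refl_word bs"
  by (simp add: refl_word_def)

lemma refl_word_append: "refl_word (as @ bs) = refl_word as \<circ> refl_word bs"
  by (induction as) (auto simp: refl_word_Cons comp_assoc)

lemma reflect_reflect [simp]: "reflect b (reflect b x) = x"
  by (cases "b = 0") (simp_all add: reflect_def inner_diff_right)

lemma reflect_comp_self [simp]: "reflect b \<circ> reflect b = id"
  by (simp add: fun_eq_iff)

lemma reflect_self: "reflect b b = - b"
  by (cases "b = 0") (simp_all add: reflect_def scaleR_2)

lemma orthogonal_reflect: "orthogonal_transformation (reflect b)"
proof -
  have "linear (reflect b)"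
    by (rule linearI) (simp_all add: reflect_def inner_add_right algebra_simps add_divide_distrib)
  moreover have "reflect b x \<bullet> reflect b y = x \<bullet> y" for x y
  proof (cases "b = 0")
    case False
    then show ?thesis
      by (simp add: reflect_def inner_diff_left inner_diff_right inner_commute)
  qed (simp add: reflect_def)
  ultimately show ?thesis
    by (simp add: orthogonal_transformation_def)
qed

lemma orthogonal_refl_word: "orthogonal_transformation (refl_word bs)"
proof (induction bs)
  case Nil
  then show ?case
    by (simp add: orthogonal_transformation_id id_def)
next
  case (Cons b bs)
  then show ?case
    using orthogonal_transformation_compose[OF orthogonal_reflect Cons]
    by (simp add: refl_word_Cons o_def)
qed

lemma refl_word_rev: "refl_word (rev bs) \<circ> refl_word bs = id" "refl_word bs \<circ> refl_word (rev bs) = id"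
proof -
  show *: "refl_word (rev bs) \<circ> refl_word bs = id" for bs :: "'a::euclidean_space list"
  proof (induction bs)
    case (Cons b bs)
    have "refl_word (rev (b # bs)) \<circ> refl_word (b # bs)
        = refl_word (rev bs) \<circ> (reflect b \<circ> reflect b) \<circ> refl_word bs"
      by (simp add: refl_word_append refl_word_Cons fun_eq_iff)
    then show ?case
      using Cons by simp
  qed simp
  from *[of "rev bs"] show "refl_word bs \<circ> refl_word (rev bs) = id"
    by simp
qed

lemma reflect_image:
  assumes "orthogonal_transformation u"
  shows "reflect (u b) (u x) = u (reflect b x)"
proof -
  interpret linear u
    using assms by (simp add: orthogonal_transformation_def)
  show ?thesis
    using assms by (simp add: reflect_def orthogonal_transformation_def diff scale)
qed

lemma refl_group_id: "id \<in> refl_group S"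
  unfolding refl_group_def by (intro CollectI exI[of _ "[]"]) simp

lemma refl_group_reflect: "b \<in> S \<Longrightarrow> reflect b \<in> refl_group S"
  unfolding refl_group_def by (intro CollectI exI[of _ "[b]"]) (simp add: refl_word_Cons)

lemma refl_group_comp: "u \<in> refl_group S \<Longrightarrow> v \<in> refl_group S \<Longrightarrow> u \<circ> v \<in> refl_group S"
  unfolding refl_group_def by (clarify, rename_tac as bs, rule_tac x = "as @ bs" in exI)
    (simp add: refl_word_append)

lemma refl_group_inverse:
  assumes "u \<in> refl_group S"
  obtains v where "v \<in> refl_group S" "v \<circ> u = id" "u \<circ> v = id"
proof -
  obtain bs where bs: "set bs \<subseteq> S" "u = refl_word bs"
    using assms by (auto simp: refl_group_def)
  then have "refl_word (rev bs) \<in> refl_group S"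
    unfolding refl_group_def by (intro CollectI exI[of _ "rev bs"]) simp
  then show thesis
    using bs refl_word_rev[of bs] that by blast
qed

lemma orthogonal_refl_group: "u \<in> refl_group S \<Longrightarrow> orthogonal_transformation u"
  by (auto simp: refl_group_def orthogonal_refl_word)


section \<open>The positive roots in coordinates\<close>

text \<open>
  The Cartan matrix as a table, so that simple reflections of coefficient lists evaluate by rewriting.
\<close>

definition cartan_rows :: "int list list" where
  "cartan_rows =
   [[2, 0, -1, 0, 0, 0], [0, 2, 0, -1, 0, 0], [-1, 0, 2, -1, 0, 0],
    [0, -1, -1, 2, -1, 0], [0, 0, 0, -1, 2, -1], [0, 0, 0, 0, -1, 2]]"

definition dot :: "int list \<Rightarrow> int list \<Rightarrow> int" where
  "dot k c = sum_list (map2 (*) k c)"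

text \<open>
  The simple reflection on coefficients with respect to the simple roots. Lists are indexed from 0
  but simple roots from 1, whence the shift by one here and below.
\<close>

definition refl_coord :: "nat \<Rightarrow> int list \<Rightarrow> int list" where
  "refl_coord i k = k[i - 1 := k ! (i - 1) - dot (cartan_rows ! (i - 1)) k]"

definition unit_coord :: "nat \<Rightarrow> int list" where
  "unit_coord i = (replicate 6 0)[i - 1 := 1]"

text \<open>
  Coefficients of the positive roots, sorted by height. The table is complete by
  \<open>positive_root_in_table\<close> and contains only roots by \<open>P_in_\<Phi>\<close>.
\<close>

definition pos_coords :: "int list list" where
  "pos_coords =
   [[0,0,0,0,0,1], [0,0,0,0,1,0], [0,0,0,1,0,0], [0,0,1,0,0,0],
    [0,1,0,0,0,0], [1,0,0,0,0,0], [0,0,0,0,1,1], [0,0,0,1,1,0],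
    [0,0,1,1,0,0], [0,1,0,1,0,0], [1,0,1,0,0,0], [0,0,0,1,1,1],
    [0,0,1,1,1,0], [0,1,0,1,1,0], [0,1,1,1,0,0], [1,0,1,1,0,0],
    [0,0,1,1,1,1], [0,1,0,1,1,1], [0,1,1,1,1,0], [1,0,1,1,1,0],
    [1,1,1,1,0,0], [0,1,1,1,1,1], [0,1,1,2,1,0], [1,0,1,1,1,1],
    [1,1,1,1,1,0], [0,1,1,2,1,1], [1,1,1,1,1,1], [1,1,1,2,1,0],
    [0,1,1,2,2,1], [1,1,1,2,1,1], [1,1,2,2,1,0], [1,1,1,2,2,1],
    [1,1,2,2,1,1], [1,1,2,2,2,1], [1,1,2,3,2,1], [1,2,2,3,2,1]]"

definition theta_coord :: "int list" where
  "theta_coord = [1, 2, 2, 3, 2, 1]"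

lemma index_cases:
  assumes "i \<in> {1..6::nat}"
  obtains "i = 1" | "i = 2" | "i = 3" | "i = 4" | "i = 5" | "i = 6"
  using assms by force

lemma index_set: "{1..6::nat} = set [1, 2, 3, 4, 5, 6]"
  by auto

lemma sum_index: "(\<Sum>i=1..6. f i) = f 1 + f 2 + f 3 + f 4 + f 5 + (f (6::nat) :: 'b::comm_monoid_add)"
  by (simp only: index_set) (simp add: add.assoc)

lemma cartan_rows_nth:
  assumes "i \<in> {1..6}" "j \<in> {1..6}"
  shows "cartan_rows ! (i - 1) ! (j - 1) = E6_cartan i j"
  using assms
  by (elim index_cases; simp add: E6_cartan_def E6_edge_def cartan_rows_def doubleton_eq_iff)

lemma E6_cartan_sym: "E6_cartan i j = E6_cartan j i"
  by (simp add: E6_cartan_def E6_edge_def insert_commute)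

lemma length_6_cases:
  assumes "length k = 6"
  obtains a b c d e f where "k = [a, b, c, d, e, f]"
  using assms by (auto simp: numeral_eq_Suc length_Suc_conv)

lemma dot_sum:
  assumes "length k = 6" "length c = 6"
  shows "dot k c = (\<Sum>i=1..6. k ! (i - 1) * c ! (i - 1))"
  using assms by (elim length_6_cases, unfold sum_index) (simp add: dot_def)

lemma length_refl_coord [simp]: "length (refl_coord i k) = length k"
  by (simp add: refl_coord_def)

lemma length_unit_coord [simp]: "length (unit_coord i) = 6"
  by (simp add: unit_coord_def)

lemma unit_coord_nth:
  "i \<in> {1..6} \<Longrightarrow> j \<in> {1..6} \<Longrightarrow> unit_coord i ! (j - 1) = (if i = j then 1 else 0)"
  by (elim index_cases) (simp_all add: unit_coord_def)

lemma pos_coords_basic: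
  assumes "k \<in> set pos_coords"
  shows "length k = 6" "\<And>i. i \<in> {1..6} \<Longrightarrow> 0 \<le> k ! (i - 1)"
    "\<And>i. i \<in> {1..6} \<Longrightarrow> k ! (i - 1) \<le> theta_coord ! (i - 1)"
    "0 < sum_list k" "sum_list k \<le> 11"
    "\<exists>i\<in>{1..6}. k ! (i - 1) = 1"
proof -
  have *: "\<forall>k\<in>set pos_coords. length k = 6 \<and>
      (\<forall>i\<in>set [1,2,3,4,5,6]. 0 \<le> k ! (i - 1) \<and> k ! (i - 1) \<le> theta_coord ! (i - 1)) \<and>
      0 < sum_list k \<and> sum_list k \<le> 11 \<and> (\<exists>i\<in>set [1,2,3,4,5,6]. k ! (i - 1) = 1)"
    by code_simp
  show "length k = 6" "\<And>i. i \<in> {1..6} \<Longrightarrow> 0 \<le> k ! (i - 1)"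
    "\<And>i. i \<in> {1..6} \<Longrightarrow> k ! (i - 1) \<le> theta_coord ! (i - 1)"
    "0 < sum_list k" "sum_list k \<le> 11"
    "\<exists>i\<in>{1..6}. k ! (i - 1) = 1"
    using *[folded index_set] assms by blast+
qed

lemma unit_coord_pos: "i \<in> {1..6} \<Longrightarrow> unit_coord i \<in> set pos_coords"
proof -
  have "\<forall>i\<in>set [1,2,3,4,5,6]. unit_coord i \<in> set pos_coords"
    by code_simp
  then show "i \<in> {1..6} \<Longrightarrow> unit_coord i \<in> set pos_coords"
    unfolding index_set by blast
qed

lemma theta_coord_pos: "theta_coord \<in> set pos_coords"
  by code_simp

lemma refl_coord_pos:
  assumes "k \<in> set pos_coords" "i \<in> {1..6}" "k \<noteq> unit_coord i"
  shows "refl_coord i k \<in> set pos_coords"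
proof -
  have "\<forall>k\<in>set pos_coords. \<forall>i\<in>set [1,2,3,4,5,6].
      k = unit_coord i \<or> refl_coord i k \<in> set pos_coords"
    by code_simp
  then show ?thesis
    using assms unfolding index_set by blast
qed

text \<open>
  The descent that exhibits every positive root as a Weyl conjugate of a simple root.
\<close>

lemma pos_coords_lower:
  assumes "k \<in> set pos_coords" "\<And>i. i \<in> {1..6} \<Longrightarrow> k \<noteq> unit_coord i"
  obtains i where "i \<in> {1..6}" "refl_coord i k \<in> set pos_coords" "sum_list (refl_coord i k) < sum_list k"
proof -
  have "\<forall>k\<in>set pos_coords. (\<exists>i\<in>set [1,2,3,4,5,6]. k = unit_coord i) \<or>
     (\<exists>i\<in>set [1,2,3,4,5,6]. refl_coord i k \<in> set pos_coords \<and> sum_list (refl_coord i k) < sum_list k)"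
    by code_simp
  then show ?thesis
    using assms that unfolding index_set by blast
qed

text \<open>
  This lemma and the next one provide the decompositions of all roots other than the simple roots
  and the negative of the highest root.
\<close>

lemma pos_coords_subtract_unit:
  assumes "k \<in> set pos_coords" "\<And>i. i \<in> {1..6} \<Longrightarrow> k \<noteq> unit_coord i"
  obtains i where "i \<in> {1..6}" "map2 (-) k (unit_coord i) \<in> set pos_coords"
proof -
  have "\<forall>k\<in>set pos_coords. (\<exists>i\<in>set [1,2,3,4,5,6]. k = unit_coord i) \<or>
     (\<exists>i\<in>set [1,2,3,4,5,6]. map2 (-) k (unit_coord i) \<in> set pos_coords)"
    by code_simp
  then show ?thesis
    using assms that unfolding index_set by blast
qed

lemma pos_coords_add_unit:
  assumes "k \<in> set pos_coords" "k \<noteq> theta_coord"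
  obtains i where "i \<in> {1..6}" "map2 (+) k (unit_coord i) \<in> set pos_coords"
proof -
  have "\<forall>k\<in>set pos_coords. k = theta_coord \<or>
     (\<exists>i\<in>set [1,2,3,4,5,6]. map2 (+) k (unit_coord i) \<in> set pos_coords)"
    by code_simp
  then show ?thesis
    using assms that unfolding index_set by blast
qed

lemma refl_coord_explicit:
  "refl_coord 1 [a, b, c, d, e, f] = [c - a, b, c, d, e, f]"
  "refl_coord 2 [a, b, c, d, e, f] = [a, d - b, c, d, e, f]"
  "refl_coord 3 [a, b, c, d, e, f] = [a, b, a + d - c, d, e, f]"
  "refl_coord 4 [a, b, c, d, e, f] = [a, b, c, b + c + e - d, e, f]"
  "refl_coord 5 [a, b, c, d, e, f] = [a, b, c, d, d + f - e, f]"
  "refl_coord 6 [a, b, c, d, e, f] = [a, b, c, d, e, e - f]"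
  by (simp_all add: refl_coord_def cartan_rows_def dot_def)

lemma unit_coord_explicit:
  "unit_coord 1 = [1, 0, 0, 0, 0, 0]" "unit_coord 2 = [0, 1, 0, 0, 0, 0]"
  "unit_coord 3 = [0, 0, 1, 0, 0, 0]" "unit_coord 4 = [0, 0, 0, 1, 0, 0]"
  "unit_coord 5 = [0, 0, 0, 0, 1, 0]" "unit_coord 6 = [0, 0, 0, 0, 0, 1]"
  by (simp_all add: unit_coord_def numeral_eq_Suc)

lemma refl_coord_refl_coord:
  assumes "length k = 6" "i \<in> {1..6}"
  shows "refl_coord i (refl_coord i k) = k"
  using assms(2,1) by (elim index_cases length_6_cases; simp add: refl_coord_def cartan_rows_def dot_def)

section \<open>A root system of type \<open>E\<^sub>6\<close> and its coordinates\<close>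

locale e6 =
  fixes E \<Phi> :: "'a::euclidean_space set" and \<alpha> :: "nat \<Rightarrow> 'a"
  assumes E6: "E6_root_system E \<Phi> \<alpha>"
begin

definition rvec :: "int list \<Rightarrow> 'a" where
  "rvec k = (\<Sum>i=1..6. of_int (k ! (i - 1)) *\<^sub>R \<alpha> i)"

text \<open>
  The positive roots. Defining them by the table makes their combinatorics computable; that they and
  their negatives exhaust \<open>\<Phi>\<close> is \<open>\<Phi>_eq\<close>.
\<close>

definition P :: "'a set" where
  "P = rvec ` set pos_coords"

definition \<theta> :: 'a where
  "\<theta> = rvec theta_coord"

lemma root_system: "root_system E \<Phi>"
  using E6 by (simp add: E6_root_system_def)

lemma simple_in_\<Phi>: "i \<in> {1..6} \<Longrightarrow> \<alpha> i \<in> \<Phi>"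
  using E6 by (auto simp: E6_root_system_def root_base_def)

lemma subspace_E: "subspace E"
  using root_system by (auto simp: root_system_def)

lemma \<Phi>_in_E: "\<beta> \<in> \<Phi> \<Longrightarrow> \<beta> \<in> E"
  using root_system span_superset by (auto simp: root_system_def)

lemma span_simple: "span (\<alpha> ` {1..6}) = E"
  using E6 by (auto simp: E6_root_system_def root_base_def)

lemma simple_inj: "inj_on \<alpha> {1..6}"
  using E6 by (auto simp: E6_root_system_def)

lemma cartan: "i \<in> {1..6} \<Longrightarrow> j \<in> {1..6} \<Longrightarrow> 2 * (\<alpha> i \<bullet> \<alpha> j) / (\<alpha> j \<bullet> \<alpha> j) = of_int (E6_cartan i j)"
  using E6 by (auto simp: E6_root_system_def)

lemma simple_nonzero: "i \<in> {1..6} \<Longrightarrow> \<alpha> i \<noteq> 0"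
  using simple_in_\<Phi>[of i] root_system unfolding root_system_def by metis

lemma \<Phi>_reflect: "\<beta> \<in> \<Phi> \<Longrightarrow> \<gamma> \<in> \<Phi> \<Longrightarrow> reflect \<beta> \<gamma> \<in> \<Phi>"
  using root_system unfolding root_system_def by blast

lemma \<Phi>_neg: "\<beta> \<in> \<Phi> \<Longrightarrow> - \<beta> \<in> \<Phi>"
  using \<Phi>_reflect[of \<beta> \<beta>] by (simp add: reflect_self)

text \<open>
  The fundamental coweights: the basis of \<open>E\<close> dual to the simple roots. Inner products with them read
  off coefficients.
\<close>

definition cw :: "nat \<Rightarrow> 'a" where
  "cw i = (SOME x. x \<in> E \<and> (\<forall>j\<in>{1..6}. \<alpha> j \<bullet> x = (if j = i then 1 else 0)))"

text \<open>
  A functional with the required values exists because the simple roots are independent. The vector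
  representing it may leave \<open>E\<close>, but its orthogonal projection to \<open>E\<close> has the same inner products with
  the simple roots.
\<close>

lemma cw:
  assumes "i \<in> {1..6}"
  shows cw_in_E: "cw i \<in> E"
    and simple_inner_cw: "\<And>j. j \<in> {1..6} \<Longrightarrow> \<alpha> j \<bullet> cw i = (if j = i then 1 else 0)"
proof -
  have "independent (\<alpha> ` {1..6})"
    using E6 by (auto simp: E6_root_system_def root_base_def)
  from linear_independent_extend[OF this, of "\<lambda>b. if b = \<alpha> i then 1 else 0 :: real"]
  obtain f :: "'a \<Rightarrow> real" where f: "linear f" "\<forall>b\<in>\<alpha> ` {1..6}. f b = (if b = \<alpha> i then 1 else 0)"
    by blast
  obtain y z where yz: "y \<in> span (\<alpha> ` {1..6})" "\<And>w. w \<in> span (\<alpha> ` {1..6}) \<Longrightarrow> orthogonal z w"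
      "adjoint f 1 = y + z"
    using orthogonal_subspace_decomp_exists by metis
  have "\<alpha> j \<bullet> y = (if j = i then 1 else 0)" if j: "j \<in> {1..6}" for j
  proof -
    have "\<alpha> j \<bullet> adjoint f 1 = f (\<alpha> j)"
      using adjoint_works[OF f(1), of "\<alpha> j" 1] by simp
    moreover have "\<alpha> j \<bullet> z = 0"
      using yz(2)[of "\<alpha> j"] j by (simp add: span_base orthogonal_def inner_commute)
    ultimately show ?thesis
      using f(2) j inj_onD[OF simple_inj _ j assms] by (auto simp: yz(3) inner_add_right)
  qed
  then have "\<exists>x. x \<in> E \<and> (\<forall>j\<in>{1..6}. \<alpha> j \<bullet> x = (if j = i then 1 else 0))"
    using yz(1) span_simple by blast
  from someI_ex[OF this] show "cw i \<in> E" "\<And>j. j \<in> {1..6} \<Longrightarrow> \<alpha> j \<bullet> cw i = (if j = i then 1 else 0)"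
    by (simp_all add: cw_def)
qed

lemma E_eqI:
  assumes "x \<in> E" "y \<in> E" "\<And>i. i \<in> {1..6} \<Longrightarrow> \<alpha> i \<bullet> x = \<alpha> i \<bullet> y"
  shows "x = y"
proof -
  have "(x - y) \<bullet> v = 0" if "v \<in> span (\<alpha> ` {1..6})" for v
    using that
  proof (induction rule: span_induct_alt)
    case (step c b v)
    then obtain i where "i \<in> {1..6}" "b = \<alpha> i"
      by auto
    then have "(x - y) \<bullet> b = 0"
      using assms(3)[of i] by (simp add: inner_diff_left inner_diff_right inner_commute)
    then show ?case
      using step by (simp add: inner_add_right)
  qed simp
  moreover have "x - y \<in> span (\<alpha> ` {1..6})"
    unfolding span_simple using assms(1,2) subspace_diff[OF subspace_E] by simp
  ultimately have "(x - y) \<bullet> (x - y) = 0"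
    by blast
  then show ?thesis
    by simp
qed

lemma rvec_inner: "rvec k \<bullet> x = (\<Sum>i=1..6. of_int (k ! (i - 1)) * (\<alpha> i \<bullet> x))"
  by (simp add: rvec_def inner_sum_left)

lemma rvec_inner_cw: "i \<in> {1..6} \<Longrightarrow> rvec k \<bullet> cw i = of_int (k ! (i - 1))"
  by (simp add: rvec_inner simple_inner_cw if_distrib[of "(*) _"] cong: if_cong)

definition from_coords :: "(nat \<Rightarrow> real) \<Rightarrow> 'a" where
  "from_coords c = (\<Sum>i=1..6. c i *\<^sub>R cw i)"

lemma from_coords_in_E: "from_coords c \<in> E"
  unfolding from_coords_def by (intro subspace_sum subspace_E subspace_scale cw_in_E) auto

lemma simple_inner_from_coords: "i \<in> {1..6} \<Longrightarrow> \<alpha> i \<bullet> from_coords c = c i"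
  by (simp add: from_coords_def inner_sum_right simple_inner_cw if_distrib[of "(*) _"] cong: if_cong)

lemma rvec_coords_eq:
  assumes "length k = 6" "length l = 6" "rvec k = rvec l"
  shows "k = l"
proof (rule nth_equalityI)
  fix i assume "i < length k"
  then have "rvec k \<bullet> cw (Suc i) = of_int (k ! i)" "rvec l \<bullet> cw (Suc i) = of_int (l ! i)"
    using assms(1) rvec_inner_cw[of "Suc i"] by auto
  then show "k ! i = l ! i"
    using assms(3) by simp
qed (use assms in simp)

text \<open>
  The inner product of a root with the sum of the fundamental coweights is its height.
\<close>

definition rho :: 'a where
  "rho = from_coords (\<lambda>_. 1)"

lemma rvec_inner_rho: "length k = 6 \<Longrightarrow> rvec k \<bullet> rho = of_int (sum_list k)"
  unfolding rvec_inner rho_def sum_index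
  by (elim length_6_cases) (simp add: simple_inner_from_coords)

lemma rvec_add:
  assumes "length k = 6" "length l = 6"
  shows "rvec (map2 (+) k l) = rvec k + rvec l" "rvec (map2 (-) k l) = rvec k - rvec l"
  using assms unfolding rvec_def sum_index
  by (elim length_6_cases, simp add: algebra_simps)+

lemma rvec_unit: "i \<in> {1..6} \<Longrightarrow> rvec (unit_coord i) = \<alpha> i"
  unfolding rvec_def
  by (subst sum.cong[OF refl, of _ _ "\<lambda>j. if i = j then \<alpha> j else 0"])
    (simp_all add: unit_coord_nth[unfolded One_nat_def])

lemma reflect_simple_inner:
  assumes "i \<in> {1..6}" "length k = 6"
  shows "2 * (\<alpha> i \<bullet> rvec k) / (\<alpha> i \<bullet> \<alpha> i) = of_int (dot (cartan_rows ! (i - 1)) k)"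
proof -
  have "2 * (\<alpha> i \<bullet> rvec k) / (\<alpha> i \<bullet> \<alpha> i)
     = (\<Sum>j=1..6. of_int (k ! (j - 1)) * (2 * (\<alpha> j \<bullet> \<alpha> i) / (\<alpha> i \<bullet> \<alpha> i)))"
    by (subst inner_commute) (simp add: rvec_inner sum_distrib_left sum_divide_distrib mult_ac)
  also have "\<dots> = (\<Sum>j=1..6. of_int (k ! (j - 1)) * of_int (E6_cartan i j))"
    using assms(1) by (intro sum.cong refl) (simp only: cartan E6_cartan_sym[of i])
  also have "\<dots> = of_int (dot (cartan_rows ! (i - 1)) k)"
  proof -
    have "length (cartan_rows ! (i - 1)) = 6"
      using assms(1) by (elim index_cases) (simp_all add: cartan_rows_def)
    then show ?thesis
      using assms by (simp add: dot_sum cartan_rows_nth[unfolded One_nat_def] mult.commute)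
  qed
  finally show ?thesis .
qed

lemma reflect_rvec:
  assumes "i \<in> {1..6}" "length k = 6"
  shows "reflect (\<alpha> i) (rvec k) = rvec (refl_coord i k)"
proof -
  define m where "m = dot (cartan_rows ! (i - 1)) k"
  have "rvec (refl_coord i k) = rvec k - of_int m *\<^sub>R \<alpha> i"
    using assms unfolding rvec_def refl_coord_def m_def[symmetric] sum_index
    by (elim index_cases length_6_cases) (simp_all add: scaleR_left.diff)
  then show ?thesis
    by (simp add: reflect_def reflect_simple_inner[OF assms] m_def)
qed

lemma rvec_neg: "length k = 6 \<Longrightarrow> rvec (map uminus k) = - rvec k"
  unfolding rvec_def sum_index by (elim length_6_cases) simp

text \<open>
  Follows the descent \<open>pos_coords_lower\<close> by induction on the height.
\<close>

lemma P_reflect_induct [consumes 1, case_names simple reflect]: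
  assumes "\<beta> \<in> P"
    and "\<And>i. i \<in> {1..6} \<Longrightarrow> Q (\<alpha> i)"
    and "\<And>\<beta> i. \<beta> \<in> P \<Longrightarrow> i \<in> {1..6} \<Longrightarrow> Q \<beta> \<Longrightarrow> Q (reflect (\<alpha> i) \<beta>)"
  shows "Q \<beta>"
proof -
  have "Q (rvec k)" if "k \<in> set pos_coords" for k
    using that
  proof (induction "nat (sum_list k)" arbitrary: k rule: less_induct)
    case less
    show ?case
    proof (cases "\<exists>i\<in>{1..6}. k = unit_coord i")
      case True
      then show ?thesis
        using rvec_unit assms(2) by auto
    next
      case False
      then obtain i where i: "i \<in> {1..6}" "refl_coord i k \<in> set pos_coords"
          "sum_list (refl_coord i k) < sum_list k"
        using pos_coords_lower[OF less.prems] by blast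
      have "Q (rvec (refl_coord i k))"
        using i pos_coords_basic(4)[OF less.prems] by (intro less.hyps) auto
      then have "Q (reflect (\<alpha> i) (reflect (\<alpha> i) (rvec k)))"
        using i assms(3)[OF _ i(1), of "rvec (refl_coord i k)"] pos_coords_basic(1)[OF less.prems]
        by (simp add: P_def reflect_rvec)
      then show ?thesis
        by simp
    qed
  qed
  then show ?thesis
    using assms(1) by (auto simp: P_def)
qed

lemma P_in_\<Phi>: "\<beta> \<in> P \<Longrightarrow> \<beta> \<in> \<Phi>"
  by (induction rule: P_reflect_induct) (blast intro: simple_in_\<Phi> \<Phi>_reflect)+

lemma root_coords:
  assumes "\<beta> \<in> \<Phi>"
  obtains k where "length k = 6" "\<beta> = rvec k" "(\<forall>x\<in>set k. x \<ge> 0) \<or> (\<forall>x\<in>set k. x \<le> 0)"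
proof -
  obtain c :: "'a \<Rightarrow> int" where c: "\<beta> = (\<Sum>\<delta>\<in>\<alpha> ` {1..6}. of_int (c \<delta>) *\<^sub>R \<delta>)"
      "(\<forall>\<delta>\<in>\<alpha> ` {1..6}. c \<delta> \<ge> 0) \<or> (\<forall>\<delta>\<in>\<alpha> ` {1..6}. c \<delta> \<le> 0)"
    using E6 assms unfolding E6_root_system_def root_base_def by blast
  let ?k = "map (\<lambda>i. c (\<alpha> i)) [1,2,3,4,5,6]"
  have "\<beta> = rvec ?k"
    unfolding c(1) sum.reindex[OF simple_inj] rvec_def sum_index by simp
  moreover have "(\<forall>x\<in>set ?k. x \<ge> 0) \<or> (\<forall>x\<in>set ?k. x \<le> 0)"
    using c(2) by auto
  ultimately show ?thesis
    using that[of ?k] by simp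
qed

text \<open>
  Induction on the height. From \<open>(\<beta>, \<beta>) > 0\<close> some simple root \<open>\<alpha>\<^sub>i\<close> has positive inner product with
  \<open>\<beta>\<close>, so the root \<open>s\<^sub>i \<beta>\<close> has smaller height. It differs from \<open>\<beta>\<close> only in the coefficient of \<open>\<alpha>\<^sub>i\<close>, hence is
  positive too, unless \<open>\<beta>\<close> is a multiple of \<open>\<alpha>\<^sub>i\<close> and therefore equal to it, the root system being reduced.
\<close>

lemma positive_root_in_table:
  assumes "length k = 6" "\<forall>x\<in>set k. x \<ge> 0" "rvec k \<in> \<Phi>"
  shows "k \<in> set pos_coords"
  using assms
proof (induction "nat (sum_list k)" arbitrary: k rule: less_induct)
  case less
  have nonneg: "k ! (i - 1) \<ge> 0" if "i \<in> {1..6}" for i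
    using less.prems that by (auto simp: all_set_conv_all_nth)
  have "rvec k \<noteq> 0"
    using less.prems(3) root_system by (auto simp: root_system_def)
  then have "0 < rvec k \<bullet> rvec k"
    by simp
  then have "\<exists>i\<in>{1..6}. 0 < of_int (k ! (i - 1)) * (\<alpha> i \<bullet> rvec k)"
    unfolding rvec_inner[of k "rvec k"] by (meson not_less sum_nonpos)
  then obtain i where i: "i \<in> {1..6}" "0 < \<alpha> i \<bullet> rvec k"
    using nonneg by (fastforce simp: zero_less_mult_iff)
  define m where "m = dot (cartan_rows ! (i - 1)) k"
  have m: "2 * (\<alpha> i \<bullet> rvec k) / (\<alpha> i \<bullet> \<alpha> i) = of_int m"
    using reflect_simple_inner[OF i(1) less.prems(1)] m_def by simp
  have "0 < 2 * (\<alpha> i \<bullet> rvec k) / (\<alpha> i \<bullet> \<alpha> i)"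
    using i(2) simple_nonzero[OF i(1)] by simp
  then have mpos: "m > 0"
    unfolding m by simp
  define k' where "k' = refl_coord i k"
  have k': "k' = k[i - 1 := k ! (i - 1) - m]" "length k' = 6"
    using less.prems(1) by (simp_all add: k'_def refl_coord_def m_def)
  have k'_root: "rvec k' \<in> \<Phi>"
    using less.prems i(1) \<Phi>_reflect simple_in_\<Phi> unfolding k'_def by (metis reflect_rvec)
  have sum_k': "sum_list k' = sum_list k - m"
    using i(1) less.prems(1) unfolding k'(1) by (elim index_cases length_6_cases) simp_all
  from root_coords[OF k'_root] obtain l where "length l = 6" "rvec k' = rvec l"
      "(\<forall>x\<in>set l. x \<ge> 0) \<or> (\<forall>x\<in>set l. x \<le> 0)" .
  then have "(\<forall>x\<in>set k'. x \<ge> 0) \<or> (\<forall>x\<in>set k'. x \<le> 0)"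
    using rvec_coords_eq k'(2) by metis
  then show ?case
  proof
    assume k'_nonneg: "\<forall>x\<in>set k'. x \<ge> 0"
    have "sum_list k \<ge> m"
      using sum_k' k'_nonneg sum_list_nonneg[of k'] by auto
    then have "k' \<in> set pos_coords"
      using less.hyps[of k'] k'_nonneg k'(2) k'_root sum_k' mpos by simp
    moreover have "k' \<noteq> unit_coord i"
    proof
      assume "k' = unit_coord i"
      then have "k ! (i - 1) = (refl_coord i (unit_coord i)) ! (i - 1)"
        unfolding k'_def using refl_coord_refl_coord less.prems(1) i(1) by metis
      also have "\<dots> = - 1"
        using i(1) by (elim index_cases) (simp_all add: refl_coord_def unit_coord_def cartan_rows_def dot_def eval_nat_numeral)
      finally show False
        using nonneg[OF i(1)] by simp
    qed
    ultimately have "refl_coord i k' \<in> set pos_coords"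
      by (intro refl_coord_pos i(1))
    then show ?thesis
      using refl_coord_refl_coord less.prems(1) i(1) by (simp add: k'_def)
  next
    assume k'_nonpos: "\<forall>x\<in>set k'. x \<le> 0"
    have "k ! (j - 1) = 0" if j: "j \<in> {1..6}" "j \<noteq> i" for j
    proof -
      have "k' ! (j - 1) = k ! (j - 1)"
        using j i(1) unfolding k'(1) by (intro nth_list_update_neq) auto
      moreover have "k' ! (j - 1) \<in> set k'"
        using j k'(2) by (intro nth_mem) auto
      ultimately show ?thesis
        using k'_nonpos nonneg[OF j(1)] by fastforce
    qed
    then have "rvec k = (\<Sum>j=1..6. if i = j then of_int (k ! (i - 1)) *\<^sub>R \<alpha> j else 0)"
      unfolding rvec_def by (intro sum.cong) auto
    then have eq: "rvec k = of_int (k ! (i - 1)) *\<^sub>R \<alpha> i"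
      using i(1) by simp
    then have "of_int (k ! (i - 1)) *\<^sub>R \<alpha> i \<in> \<Phi>"
      using less.prems(3) by simp
    then have "of_int (k ! (i - 1)) = (1::real) \<or> of_int (k ! (i - 1)) = (-1::real)"
      using root_system simple_in_\<Phi>[OF i(1)] unfolding root_system_def by blast
    then have "k ! (i - 1) = 1"
      using nonneg[OF i(1)] by linarith
    then have "rvec k = rvec (unit_coord i)"
      using eq rvec_unit[OF i(1)] by simp
    then have "k = unit_coord i"
      by (intro rvec_coords_eq) (use less.prems(1) in simp_all)
    then show ?thesis
      using unit_coord_pos[OF i(1)] by simp
  qed
qed

lemma \<Phi>_eq: "\<Phi> = P \<union> uminus ` P"
proof (intro equalityI subsetI)
  fix \<beta> assume "\<beta> \<in> \<Phi>"
  then obtain k where k: "length k = 6" "\<beta> = rvec k" "(\<forall>x\<in>set k. x \<ge> 0) \<or> (\<forall>x\<in>set k. x \<le> 0)"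
    by (rule root_coords)
  from k(3) show "\<beta> \<in> P \<union> uminus ` P"
  proof
    assume "\<forall>x\<in>set k. x \<ge> 0"
    then have "k \<in> set pos_coords"
      using k \<open>\<beta> \<in> \<Phi>\<close> by (intro positive_root_in_table) auto
    then show ?thesis
      using k by (auto simp: P_def)
  next
    assume *: "\<forall>x\<in>set k. x \<le> 0"
    have eq: "rvec (map uminus k) = - \<beta>"
      using k by (simp add: rvec_neg)
    then have "map uminus k \<in> set pos_coords"
      using k * \<Phi>_neg[OF \<open>\<beta> \<in> \<Phi>\<close>] by (intro positive_root_in_table) auto
    then have "- \<beta> \<in> P"
      using eq unfolding P_def by (metis imageI)
    then show ?thesis
      by (metis UnI2 imageI minus_minus)
  qed
next
  fix \<beta> assume "\<beta> \<in> P \<union> uminus ` P"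
  then show "\<beta> \<in> \<Phi>"
    using P_in_\<Phi> \<Phi>_neg by auto
qed

lemma P_cases:
  assumes "\<beta> \<in> \<Phi>"
  obtains "\<beta> \<in> P" | "- \<beta> \<in> P"
  using assms \<Phi>_eq by force

lemma finite_P: "finite P"
  by (simp add: P_def)

lemma simple_in_P: "i \<in> {1..6} \<Longrightarrow> \<alpha> i \<in> P"
  unfolding P_def by (metis imageI rvec_unit unit_coord_pos)

lemma \<theta>_in_P: "\<theta> \<in> P"
  by (simp add: P_def \<theta>_def theta_coord_pos)

lemma P_inner_rho: assumes "\<beta> \<in> P" shows "1 \<le> \<beta> \<bullet> rho" "\<beta> \<bullet> rho \<le> 11"
  using assms pos_coords_basic(1,4,5) by (force simp: P_def rvec_inner_rho)+

lemma \<theta>_inner_rho: "\<theta> \<bullet> rho = 11"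
  by (simp add: \<theta>_def rvec_inner_rho theta_coord_def)

lemma not_P_both: "\<beta> \<in> P \<Longrightarrow> - \<beta> \<notin> P"
  using P_inner_rho(1)[of \<beta>] P_inner_rho(1)[of "- \<beta>"] by auto

lemma P_inner_cw_nonneg: "\<beta> \<in> P \<Longrightarrow> i \<in> {1..6} \<Longrightarrow> 0 \<le> \<beta> \<bullet> cw i"
  using pos_coords_basic(2) by (auto simp: P_def rvec_inner_cw)

lemma \<Phi>_inner_cw_Ints:
  assumes "\<beta> \<in> \<Phi>" "i \<in> {1..6}" shows "\<beta> \<bullet> cw i \<in> \<int>"
proof (rule P_cases[OF assms(1)])
  assume "\<beta> \<in> P"
  then show ?thesis using assms(2) by (auto simp: P_def rvec_inner_cw)
next
  assume "- \<beta> \<in> P"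
  then obtain k where "- \<beta> = rvec k" by (auto simp: P_def)
  then have "- (\<beta> \<bullet> cw i) = of_int (k ! (i - 1))"
    using rvec_inner_cw[OF assms(2), of k] by (simp flip: \<open>- \<beta> = rvec k\<close>)
  then have "\<beta> \<bullet> cw i = of_int (- (k ! (i - 1)))"
    by simp
  then show ?thesis by simp
qed

lemma P_I:
  assumes "\<beta> \<in> \<Phi>" "i \<in> {1..6}" "0 < \<beta> \<bullet> cw i"
  shows "\<beta> \<in> P"
  using assms(1)
  by (rule P_cases) (use P_inner_cw_nonneg[of "- \<beta>" i] assms in auto)

lemma inner_expand:
  assumes "v \<in> E"
  shows "v \<bullet> x = (\<Sum>i=1..6. (v \<bullet> cw i) * (\<alpha> i \<bullet> x))"
proof -
  have "v \<in> span (\<alpha> ` {1..6})"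
    using assms span_simple by simp
  then show ?thesis
  proof (induction rule: span_induct_alt)
    case (step c b v)
    then obtain j where j: "j \<in> {1..6}" "b = \<alpha> j"
      by auto
    have "(\<Sum>i=1..6. (\<alpha> j \<bullet> cw i) * (\<alpha> i \<bullet> x)) = (\<Sum>i=1..6. if j = i then \<alpha> i \<bullet> x else 0)"
      using j by (intro sum.cong) (auto simp: simple_inner_cw)
    then have "(\<Sum>i=1..6. (b \<bullet> cw i) * (\<alpha> i \<bullet> x)) = b \<bullet> x"
      using j by simp
    then show ?case
      by (simp add: step.IH inner_add_left algebra_simps sum.distrib flip: sum_distrib_left)
  qed simp
qed

lemma P_reflect:
  assumes "\<beta> \<in> P" "i \<in> {1..6}" "\<beta> \<noteq> \<alpha> i"
  shows "reflect (\<alpha> i) \<beta> \<in> P"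
proof -
  obtain k where k: "k \<in> set pos_coords" "\<beta> = rvec k"
    using assms(1) by (auto simp: P_def)
  moreover have "k \<noteq> unit_coord i"
    using assms rvec_unit k(2) by auto
  ultimately show ?thesis
    using assms(2) refl_coord_pos by (simp add: reflect_rvec pos_coords_basic(1) P_def)
qed

lemma P_subtract_simple:
  assumes "\<beta> \<in> P" "\<beta> \<notin> \<alpha> ` {1..6}"
  obtains i where "i \<in> {1..6}" "\<beta> - \<alpha> i \<in> P"
proof -
  obtain k where k: "k \<in> set pos_coords" "\<beta> = rvec k"
    using assms(1) by (auto simp: P_def)
  moreover have "k \<noteq> unit_coord i" if "i \<in> {1..6}" for i
    using assms(2) rvec_unit[OF that] k(2) that by auto
  ultimately obtain i where i: "i \<in> {1..6}" "map2 (-) k (unit_coord i) \<in> set pos_coords"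
    using pos_coords_subtract_unit by blast
  then have "rvec (map2 (-) k (unit_coord i)) \<in> P"
    by (auto simp: P_def)
  then show ?thesis
    using that[of i] i k by (simp add: rvec_add pos_coords_basic(1) rvec_unit)
qed

lemma P_add_simple:
  assumes "\<beta> \<in> P" "\<beta> \<noteq> \<theta>"
  obtains i where "i \<in> {1..6}" "\<beta> + \<alpha> i \<in> P"
proof -
  obtain k where k: "k \<in> set pos_coords" "\<beta> = rvec k"
    using assms(1) by (auto simp: P_def)
  moreover have "k \<noteq> theta_coord"
    using assms(2) k(2) by (auto simp: \<theta>_def)
  ultimately obtain i where i: "i \<in> {1..6}" "map2 (+) k (unit_coord i) \<in> set pos_coords"
    using pos_coords_add_unit by blast
  then have "rvec (map2 (+) k (unit_coord i)) \<in> P"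
    by (auto simp: P_def)
  then show ?thesis
    using that[of i] i k by (simp add: rvec_add pos_coords_basic(1) rvec_unit)
qed

lemma P_induct [consumes 1, case_names simple sum]:
  assumes "\<beta> \<in> P"
    and "\<And>i. i \<in> {1..6} \<Longrightarrow> Q (\<alpha> i)"
    and "\<And>\<beta> i. \<beta> \<in> P \<Longrightarrow> i \<in> {1..6} \<Longrightarrow> \<beta> + \<alpha> i \<in> P \<Longrightarrow> Q \<beta> \<Longrightarrow> Q (\<beta> + \<alpha> i)"
  shows "Q \<beta>"
  using assms(1)
proof (induction "nat \<lfloor>\<beta> \<bullet> rho\<rfloor>" arbitrary: \<beta> rule: less_induct)
  case less
  show ?case
  proof (cases "\<beta> \<in> \<alpha> ` {1..6}")
    case False
    then obtain i where i: "i \<in> {1..6}" "\<beta> - \<alpha> i \<in> P"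
      using P_subtract_simple less.prems by blast
    have "(\<beta> - \<alpha> i) \<bullet> rho = \<beta> \<bullet> rho - 1"
      using i(1) by (simp add: inner_diff_left rho_def simple_inner_from_coords)
    then have "nat \<lfloor>(\<beta> - \<alpha> i) \<bullet> rho\<rfloor> < nat \<lfloor>\<beta> \<bullet> rho\<rfloor>"
      using P_inner_rho(1)[OF less.prems] by simp
    from less.hyps[OF this i(2)] show ?thesis
      using assms(3)[OF i(2,1)] less.prems by simp
  qed (use assms(2) in auto)
qed

lemma P_inner_pos:
  assumes "\<beta> \<in> P" "\<And>i. i \<in> {1..6} \<Longrightarrow> 0 < \<alpha> i \<bullet> x"
  shows "0 < \<beta> \<bullet> x"
  using assms(1) by (induction rule: P_induct) (auto simp: assms(2) inner_add_left add_pos_pos)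

lemma \<theta>_inner_cw: "i \<in> {1..6} \<Longrightarrow> \<theta> \<bullet> cw i = of_int (theta_coord ! (i - 1))"
  by (simp add: \<theta>_def rvec_inner_cw)

lemma P_inner_cw_le:
  assumes "\<beta> \<in> P" "i \<in> {1..6}"
  shows "\<beta> \<bullet> cw i \<le> \<theta> \<bullet> cw i"
  using assms pos_coords_basic(3) by (auto simp: \<theta>_inner_cw P_def rvec_inner_cw)

lemma P_inner_le_\<theta>:
  assumes "\<beta> \<in> P" "\<And>i. i \<in> {1..6} \<Longrightarrow> 0 \<le> \<alpha> i \<bullet> x"
  shows "\<beta> \<bullet> x \<le> \<theta> \<bullet> x"
proof -
  have "(\<Sum>i=1..6. (\<beta> \<bullet> cw i) * (\<alpha> i \<bullet> x)) \<le> (\<Sum>i=1..6. (\<theta> \<bullet> cw i) * (\<alpha> i \<bullet> x))"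
    using assms P_inner_cw_le by (intro sum_mono mult_right_mono) auto
  then show ?thesis
    using inner_expand[OF \<Phi>_in_E[OF P_in_\<Phi>[OF assms(1)]], of x]
      inner_expand[OF \<Phi>_in_E[OF P_in_\<Phi>[OF \<theta>_in_P]], of x] by linarith
qed

lemma \<theta>_inner:
  "\<theta> \<bullet> x = \<alpha> 1 \<bullet> x + 2 * (\<alpha> 2 \<bullet> x) + 2 * (\<alpha> 3 \<bullet> x) + 3 * (\<alpha> 4 \<bullet> x) + 2 * (\<alpha> 5 \<bullet> x) + \<alpha> 6 \<bullet> x"
  unfolding \<theta>_def rvec_inner sum_index theta_coord_def by simp

text \<open>
  Existence is coefficientwise dominance in the table; uniqueness holds because two vectors whose
  differences both ways are nonnegative combinations of the simple roots coincide.
\<close>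

lemma highest_root: "highest_root \<Phi> \<alpha> = \<theta>"
  unfolding highest_root_def
proof (rule the_equality)
  have *: "\<exists>c :: nat \<Rightarrow> nat. \<theta> - \<beta> = (\<Sum>i=1..6. of_nat (c i) *\<^sub>R \<alpha> i)" if "\<beta> \<in> \<Phi>" for \<beta>
  proof -
    have nn: "0 \<le> (\<theta> - \<beta>) \<bullet> cw i \<and> (\<theta> - \<beta>) \<bullet> cw i \<in> \<int>" if i: "i \<in> {1..6}" for i
      using \<open>\<beta> \<in> \<Phi>\<close>
    proof (cases rule: P_cases)
      case 1
      then show ?thesis
        using P_inner_cw_le[OF _ i] \<Phi>_inner_cw_Ints[OF _ i] \<theta>_in_P P_in_\<Phi>
        by (simp add: inner_diff_left)
    next
      case 2
      then show ?thesis
        using P_inner_cw_nonneg[OF 2 i] P_inner_cw_nonneg[OF \<theta>_in_P i]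
          \<Phi>_inner_cw_Ints[OF \<open>\<beta> \<in> \<Phi>\<close> i] \<Phi>_inner_cw_Ints[OF P_in_\<Phi>[OF \<theta>_in_P] i]
        by (simp add: inner_diff_left)
    qed
    define c where "c i = nat \<lfloor>(\<theta> - \<beta>) \<bullet> cw i\<rfloor>" for i
    have c: "of_nat (c i) = (\<theta> - \<beta>) \<bullet> cw i" if "i \<in> {1..6}" for i
      using nn[OF that] by (auto simp: c_def elim!: Ints_cases)
    have "\<theta> - \<beta> = (\<Sum>i=1..6. of_nat (c i) *\<^sub>R \<alpha> i)"
    proof (rule vector_eq_ldot[THEN iffD1], rule allI)
      fix x
      have "\<theta> - \<beta> \<in> E"
        using that \<theta>_in_P P_in_\<Phi> \<Phi>_in_E subspace_diff[OF subspace_E] by blast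
      from inner_expand[OF this, of x]
      show "x \<bullet> (\<theta> - \<beta>) = x \<bullet> (\<Sum>i=1..6. of_nat (c i) *\<^sub>R \<alpha> i)"
        by (simp add: inner_sum_right inner_commute[of x] c)
    qed
    then show ?thesis
      by (rule exI[of _ c])
  qed
  then show "\<theta> \<in> \<Phi> \<and> (\<forall>\<beta>\<in>\<Phi>. \<exists>c :: nat \<Rightarrow> nat. \<theta> - \<beta> = (\<Sum>i=1..6. of_nat (c i) *\<^sub>R \<alpha> i))"
    using \<theta>_in_P P_in_\<Phi> by blast
  fix \<eta> assume \<eta>: "\<eta> \<in> \<Phi> \<and> (\<forall>\<beta>\<in>\<Phi>. \<exists>c :: nat \<Rightarrow> nat. \<eta> - \<beta> = (\<Sum>i=1..6. of_nat (c i) *\<^sub>R \<alpha> i))"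
  obtain c :: "nat \<Rightarrow> nat" where c: "\<eta> - \<theta> = (\<Sum>i=1..6. of_nat (c i) *\<^sub>R \<alpha> i)"
    using \<eta> \<theta>_in_P P_in_\<Phi> by blast
  obtain d :: "nat \<Rightarrow> nat" where d: "\<theta> - \<eta> = (\<Sum>i=1..6. of_nat (d i) *\<^sub>R \<alpha> i)"
    using * \<eta> by blast
  have "(\<eta> - \<theta>) \<bullet> cw j = of_nat (c j) \<and> (\<theta> - \<eta>) \<bullet> cw j = of_nat (d j)" if "j \<in> {1..6}" for j
    unfolding c d using that
    by (simp add: inner_sum_left simple_inner_cw if_distrib[of "(*) _"] cong: if_cong)
  then have "c j = 0" if "j \<in> {1..6}" for j
    using that by (fastforce simp: inner_diff_left)
  then have "\<eta> - \<theta> = 0"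
    unfolding c by simp
  then show "\<eta> = \<theta>"
    by simp
qed

end

(* The numeral 1 serves as an index of simple roots and should not be rewritten to a successor. *)
declare One_nat_def [simp del]

context e6
begin

section \<open>The Weyl group: inversions and length\<close>

abbreviation W :: "('a \<Rightarrow> 'a) set" where
  "W \<equiv> weyl_group \<Phi>"

lemma P_I_rho:
  assumes "\<beta> \<in> \<Phi>" "0 < \<beta> \<bullet> rho"
  shows "\<beta> \<in> P"
  using assms(1)
  by (rule P_cases) (use P_inner_rho(1)[of "- \<beta>"] assms in auto)

lemma P_add: "\<beta> \<in> P \<Longrightarrow> \<gamma> \<in> P \<Longrightarrow> \<beta> + \<gamma> \<in> \<Phi> \<Longrightarrow> \<beta> + \<gamma> \<in> P"
  using P_inner_rho(1)[of \<beta>] P_inner_rho(1)[of \<gamma>] by (intro P_I_rho) (auto simp: inner_add_left)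

lemma W_orthogonal: "w \<in> W \<Longrightarrow> orthogonal_transformation w"
  by (rule orthogonal_refl_group)

lemma W_inner: "w \<in> W \<Longrightarrow> w x \<bullet> w y = x \<bullet> y"
  using W_orthogonal by (auto simp: orthogonal_transformation_def)

lemma W_linear: "w \<in> W \<Longrightarrow> linear w"
  using W_orthogonal by (auto simp: orthogonal_transformation_def)

lemma W_comp: "u \<in> W \<Longrightarrow> v \<in> W \<Longrightarrow> u \<circ> v \<in> W"
  by (rule refl_group_comp)

lemma W_\<Phi>: "w \<in> W \<Longrightarrow> \<beta> \<in> \<Phi> \<Longrightarrow> w \<beta> \<in> \<Phi>"
proof -
  have "refl_word bs \<beta> \<in> \<Phi>" if "set bs \<subseteq> \<Phi>" "\<beta> \<in> \<Phi>" for bs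
    using that by (induction bs) (auto simp: refl_word_Cons \<Phi>_reflect)
  then show "w \<in> W \<Longrightarrow> \<beta> \<in> \<Phi> \<Longrightarrow> w \<beta> \<in> \<Phi>"
    by (auto simp: refl_group_def)
qed

lemma W_E:
  assumes "w \<in> W" "x \<in> E" shows "w x \<in> E"
proof -
  have "reflect b y \<in> E" if "b \<in> E" "y \<in> E" for b y
    using that subspace_diff[OF subspace_E] subspace_scale[OF subspace_E] by (simp add: reflect_def)
  then have "refl_word bs x \<in> E" if "set bs \<subseteq> \<Phi>" for bs
    using that assms(2) by (induction bs) (auto simp: refl_word_Cons \<Phi>_in_E)
  then show ?thesis
    using assms(1) by (auto simp: refl_group_def)
qed

text \<open>
  Every root is Weyl conjugate to a simple one, and the reflection in \<open>s\<^sub>i \<beta>\<close> is \<open>s\<^sub>i s\<^sub>\<beta> s\<^sub>i\<close>.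
\<close>

lemma reflect_in_simple_group: "\<beta> \<in> \<Phi> \<Longrightarrow> reflect \<beta> \<in> refl_group (\<alpha> ` {1..6})"
proof -
  have *: "reflect \<beta> \<in> refl_group (\<alpha> ` {1..6})" if "\<beta> \<in> P" for \<beta>
    using that
  proof (induction rule: P_reflect_induct)
    case (simple i)
    then show ?case
      by (intro refl_group_reflect) auto
  next
    case (reflect \<beta> i)
    have "reflect (reflect (\<alpha> i) \<beta>) = reflect (\<alpha> i) \<circ> reflect \<beta> \<circ> reflect (\<alpha> i)"
      using reflect_image[OF orthogonal_reflect, of "\<alpha> i" \<beta> "reflect (\<alpha> i) _"]
      by (simp add: fun_eq_iff)
    moreover have "reflect (\<alpha> i) \<in> refl_group (\<alpha> ` {1..6})"
      using reflect(2) by (intro refl_group_reflect imageI)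
    ultimately show ?case
      using reflect(3) refl_group_comp by metis
  qed
  moreover have "reflect (- \<beta>) = reflect \<beta>" for \<beta> :: 'a
    by (simp add: reflect_def fun_eq_iff)
  ultimately show "\<beta> \<in> \<Phi> \<Longrightarrow> reflect \<beta> \<in> refl_group (\<alpha> ` {1..6})"
    by (metis P_cases)
qed

lemma W_eq_simple_group: "W = refl_group (\<alpha> ` {1..6})"
proof (intro equalityI subsetI)
  fix w assume "w \<in> W"
  then obtain bs where bs: "set bs \<subseteq> \<Phi>" "w = refl_word bs"
    by (auto simp: refl_group_def)
  have "refl_word bs \<in> refl_group (\<alpha> ` {1..6})"
    using bs(1) by (induction bs)
      (simp_all add: refl_group_id refl_word_Cons refl_group_comp reflect_in_simple_group)
  then show "w \<in> refl_group (\<alpha> ` {1..6})"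
    by (simp add: bs)
next
  fix w assume "w \<in> refl_group (\<alpha> ` {1..6})"
  then show "w \<in> W"
    using simple_in_\<Phi> unfolding refl_group_def by blast
qed

lemma parabolic_in_W:
  assumes "J \<subseteq> {1..6}" "w \<in> refl_group (\<alpha> ` J)"
  shows "w \<in> W"
  using assms simple_in_\<Phi> unfolding refl_group_def by blast

definition inversions :: "('a \<Rightarrow> 'a) \<Rightarrow> 'a set" where
  "inversions w = {\<beta> \<in> P. - w \<beta> \<in> P}"

lemma finite_inversions: "finite (inversions w)"
  by (simp add: inversions_def finite_P)

lemma inversions_id: "inversions id = {}"
  using not_P_both by (auto simp: inversions_def)

lemma reflect_in_W: "\<beta> \<in> \<Phi> \<Longrightarrow> reflect \<beta> \<in> W"
  by (rule refl_group_reflect)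

text \<open>
  Since \<open>s\<^sub>i\<close> permutes the positive roots other than \<open>\<alpha>\<^sub>i\<close>, it maps the inversions of \<open>w\<close> onto those of
  \<open>w s\<^sub>i\<close> other than \<open>\<alpha>\<^sub>i\<close>.
\<close>

lemma card_inversions_comp_simple:
  assumes "i \<in> {1..6}" "w (\<alpha> i) \<in> P" "linear w"
  shows "card (inversions (w \<circ> reflect (\<alpha> i))) = Suc (card (inversions w))"
proof -
  let ?s = "reflect (\<alpha> i)"
  have "inversions (w \<circ> ?s) = insert (\<alpha> i) (?s ` inversions w)"
  proof (intro equalityI subsetI)
    fix \<beta> assume \<beta>: "\<beta> \<in> inversions (w \<circ> ?s)"
    show "\<beta> \<in> insert (\<alpha> i) (?s ` inversions w)"
    proof (cases "\<beta> = \<alpha> i")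
      case False
      then have "?s \<beta> \<in> inversions w"
        using \<beta> assms P_reflect by (auto simp: inversions_def)
      then have "?s (?s \<beta>) \<in> ?s ` inversions w"
        by blast
      then show ?thesis
        by simp
    qed simp
  next
    fix \<beta> assume "\<beta> \<in> insert (\<alpha> i) (?s ` inversions w)"
    then show "\<beta> \<in> inversions (w \<circ> ?s)"
    proof
      assume "\<beta> = \<alpha> i"
      then show ?thesis
        using assms simple_in_P by (simp add: inversions_def reflect_self linear_neg)
    next
      assume "\<beta> \<in> ?s ` inversions w"
      then obtain \<gamma> where \<gamma>: "\<beta> = ?s \<gamma>" "\<gamma> \<in> P" "- w \<gamma> \<in> P"
        by (auto simp: inversions_def)
      then have "\<gamma> \<noteq> \<alpha> i"
        using assms(2) not_P_both by blast
      then show ?thesis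
        using \<gamma> P_reflect assms(1) by (simp add: inversions_def)
    qed
  qed
  moreover have "\<alpha> i \<notin> ?s ` inversions w"
  proof
    assume "\<alpha> i \<in> ?s ` inversions w"
    then obtain \<gamma> where "\<alpha> i = ?s \<gamma>" "\<gamma> \<in> P"
      by (auto simp: inversions_def)
    then have "\<gamma> = - \<alpha> i"
      using reflect_self reflect_reflect by metis
    then show False
      using \<open>\<gamma> \<in> P\<close> simple_in_P[OF assms(1)] not_P_both by blast
  qed
  moreover have "inj_on ?s (inversions w)"
    by (rule inj_on_inverseI[of _ ?s]) simp
  ultimately show ?thesis
    by (simp add: card_image finite_inversions)
qed

lemma card_inversions_comp_simple':
  assumes "i \<in> {1..6}" "- w (\<alpha> i) \<in> P" "linear w"
  shows "card (inversions w) = Suc (card (inversions (w \<circ> reflect (\<alpha> i))))"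
proof -
  have "linear (w \<circ> reflect (\<alpha> i))"
    using linear_compose[OF _ assms(3)] orthogonal_reflect orthogonal_transformation_def by blast
  then have "card (inversions ((w \<circ> reflect (\<alpha> i)) \<circ> reflect (\<alpha> i)))
      = Suc (card (inversions (w \<circ> reflect (\<alpha> i))))"
    using assms by (intro card_inversions_comp_simple) (simp_all add: reflect_self linear_neg)
  then show ?thesis
    by (simp add: comp_assoc)
qed

text \<open>
  Apply the letters of \<open>bs\<close> to \<open>\<alpha>\<^sub>i\<close> one by one, the last letter first. The root becomes negative at some
  letter \<open>b\<close>, which happens only to the simple root \<open>b\<close> itself; so \<open>s\<^sub>i\<close> is conjugated to \<open>s\<^sub>b\<close> by the letters
  after \<open>b\<close>, and the two cancel.
\<close>

lemma exchange:
  assumes "set bs \<subseteq> \<alpha> ` {1..6}" "i \<in> {1..6}" "- refl_word bs (\<alpha> i) \<in> P"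
  shows "\<exists>as b cs. bs = as @ b # cs \<and> refl_word bs \<circ> reflect (\<alpha> i) = refl_word (as @ cs)"
  using assms
proof (induction bs)
  case Nil
  then show ?case
    using not_P_both simple_in_P by auto
next
  case (Cons b bs)
  let ?\<gamma> = "refl_word bs (\<alpha> i)"
  have "refl_word bs \<in> W"
    using Cons.prems(1) by (intro parabolic_in_W[of "{1..6}"]) (auto simp: refl_group_def)
  then have "?\<gamma> \<in> \<Phi>"
    using W_\<Phi> simple_in_\<Phi> Cons.prems(2) by blast
  then show ?case
  proof (cases rule: P_cases)
    case 1
    have "?\<gamma> = b"
    proof (rule ccontr)
      assume "?\<gamma> \<noteq> b"
      then have "reflect b ?\<gamma> \<in> P"
        using 1 Cons.prems(1) P_reflect by auto
      then show False
        using Cons.prems(3) not_P_both by (auto simp: refl_word_Cons)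
    qed
    then have "refl_word (b # bs) \<circ> reflect (\<alpha> i) = refl_word bs"
      using reflect_image[OF orthogonal_refl_word, of bs "\<alpha> i"]
      by (metis (no_types, lifting) comp_apply ext refl_word_Cons reflect_reflect)
    then show ?thesis
      by (intro exI[of _ "[]"] exI[of _ b] exI[of _ bs]) simp
  next
    case 2
    moreover have "set bs \<subseteq> \<alpha> ` {1..6}"
      using Cons.prems(1) by simp
    ultimately obtain as c cs where
      "bs = as @ c # cs" "refl_word bs \<circ> reflect (\<alpha> i) = refl_word (as @ cs)"
      using Cons.IH Cons.prems(2) by blast
    then have "b # bs = (b # as) @ c # cs \<and>
        refl_word (b # bs) \<circ> reflect (\<alpha> i) = refl_word ((b # as) @ cs)"
      by (simp add: refl_word_Cons comp_assoc)
    then show ?thesis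
      by blast
  qed
qed

text \<open>
  Reading a word from left to right, each letter changes the number of inversions by one, and when
  the number drops the exchange property deletes a letter. Keeping the letters inside those of the
  given word makes the result applicable to parabolic subgroups.
\<close>

lemma reduced_word:
  assumes "set bs \<subseteq> \<alpha> ` {1..6}"
  shows "\<exists>cs. set cs \<subseteq> set bs \<and> refl_word cs = refl_word bs \<and>
    length cs = card (inversions (refl_word bs)) \<and> length cs \<le> length bs"
  using assms
proof (induction bs rule: rev_induct)
  case Nil
  show ?case
    by (intro exI[of _ "[]"]) (simp only: refl_word_Nil inversions_id list.size card.empty simp_thms subset_refl order_refl)
next
  case (snoc b bs)
  then obtain cs where cs: "set cs \<subseteq> set bs" "refl_word cs = refl_word bs"
      "length cs = card (inversions (refl_word bs))" "length cs \<le> length bs"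
    by auto
  obtain i where i: "i \<in> {1..6}" "b = \<alpha> i"
    using snoc.prems by auto
  have step: "refl_word (bs @ [b]) = refl_word bs \<circ> reflect (\<alpha> i)"
    by (simp add: refl_word_append refl_word_Cons i)
  have lin: "linear (refl_word bs)"
    using orthogonal_refl_word orthogonal_transformation_def by blast
  have "refl_word bs \<in> W"
    using snoc.prems by (intro parabolic_in_W[of "{1..6}"]) (auto simp: refl_group_def)
  then have "refl_word bs (\<alpha> i) \<in> \<Phi>"
    using W_\<Phi> simple_in_\<Phi> i(1) by blast
  then show ?case
  proof (cases rule: P_cases)
    case 1
    then show ?thesis
      using cs i step card_inversions_comp_simple[OF i(1) 1 lin]
      by (intro exI[of _ "cs @ [b]"])
        (simp only: refl_word_append length_append_singleton set_append Un_mono subset_refl simp_thms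
          Suc_le_mono)
  next
    case 2
    have "set cs \<subseteq> \<alpha> ` {1..6}"
      using cs(1) snoc.prems by auto
    from exchange[OF this i(1)] 2 cs(2) obtain as c ds where
      ds: "cs = as @ c # ds" "refl_word bs \<circ> reflect (\<alpha> i) = refl_word (as @ ds)"
      by auto
    then show ?thesis
      using cs step card_inversions_comp_simple'[OF i(1) 2 lin]
      by (intro exI[of _ "as @ ds"]) auto
  qed
qed

lemma card_inversions_le_length:
  assumes "set bs \<subseteq> \<alpha> ` {1..6}"
  shows "card (inversions (refl_word bs)) \<le> length bs"
  using reduced_word[OF assms] by auto

lemma refl_length_eq_card_inversions:
  assumes "J \<subseteq> {1..6}" "w \<in> refl_group (\<alpha> ` J)"
  shows "refl_length (\<alpha> ` J) w = card (inversions w)"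
  unfolding refl_length_def
proof (rule Least_equality)
  obtain bs where bs: "set bs \<subseteq> \<alpha> ` J" "w = refl_word bs"
    using assms by (auto simp: refl_group_def)
  then show "\<exists>bs. set bs \<subseteq> \<alpha> ` J \<and> length bs = card (inversions w) \<and> refl_word bs = w"
    using reduced_word[of bs] assms(1) by blast
next
  fix n assume "\<exists>bs. set bs \<subseteq> \<alpha> ` J \<and> length bs = n \<and> refl_word bs = w"
  then show "card (inversions w) \<le> n"
    using card_inversions_le_length assms(1) by (metis image_mono order_trans)
qed

lemma no_inversions_imp_id:
  assumes "w \<in> W" "inversions w = {}"
  shows "w = id"
proof -
  obtain bs where "set bs \<subseteq> \<alpha> ` {1..6}" "w = refl_word bs"
    using assms(1) unfolding W_eq_simple_group by (auto simp: refl_group_def)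
  then show ?thesis
    using reduced_word[of bs] assms(2) by auto
qed

text \<open>
  A root that is a sum of positive roots is positive, so \<open>w\<close> has no inversions. This is the criterion by
  which elements of the Weyl group are identified in the sequel.
\<close>

lemma simple_to_positive_imp_id:
  assumes "w \<in> W" "\<And>i. i \<in> {1..6} \<Longrightarrow> w (\<alpha> i) \<in> P"
  shows "w = id"
proof (rule no_inversions_imp_id[OF assms(1)])
  have "w \<beta> \<in> P" if "\<beta> \<in> P" for \<beta>
    using that
  proof (induction rule: P_induct)
    case (sum \<beta> i)
    have "w (\<beta> + \<alpha> i) \<in> \<Phi>"
      using sum P_in_\<Phi> W_\<Phi>[OF assms(1)] by blast
    then show ?case
      using sum assms by (auto simp: linear_add[OF W_linear] intro: P_add)
  qed (rule assms(2))
  then show "inversions w = {}"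
    using not_P_both by (auto simp: inversions_def)
qed

lemma finite_W: "finite W"
proof (rule finite_subset)
  show "W \<subseteq> refl_word ` {bs. set bs \<subseteq> \<alpha> ` {1..6} \<and> length bs \<le> card P}"
  proof
    fix w assume "w \<in> W"
    then obtain bs where bs: "set bs \<subseteq> \<alpha> ` {1..6}" "w = refl_word bs"
      unfolding W_eq_simple_group by (auto simp: refl_group_def)
    obtain cs where cs: "set cs \<subseteq> set bs" "refl_word cs = refl_word bs"
        "length cs = card (inversions (refl_word bs))"
      using reduced_word[OF bs(1)] by blast
    have "length cs \<le> card P"
      unfolding cs(3) by (intro card_mono finite_P) (auto simp: inversions_def)
    then show "w \<in> refl_word ` {bs. set bs \<subseteq> \<alpha> ` {1..6} \<and> length bs \<le> card P}"
      using bs cs by (intro image_eqI[of _ _ cs]) auto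
  qed
qed (intro finite_imageI finite_lists_length_le, simp)

section \<open>Longest elements and the elements \<open>\<omega>\<^sub>j\<close>\<close>

lemma parabolic_inner_cw:
  assumes "J \<subseteq> {1..6}" "v \<in> refl_group (\<alpha> ` J)" "i \<in> {1..6} - J"
  shows "v \<beta> \<bullet> cw i = \<beta> \<bullet> cw i"
proof -
  have "refl_word bs \<beta> \<bullet> cw i = \<beta> \<bullet> cw i" if "set bs \<subseteq> \<alpha> ` J" for bs
    using that
  proof (induction bs)
    case (Cons b bs)
    then obtain j where "j \<in> J" "b = \<alpha> j"
      by auto
    then have "b \<bullet> cw i = 0"
      using assms(1,3) simple_inner_cw[of i j] by auto
    then show ?case
      using Cons by (simp add: refl_word_Cons reflect_def inner_diff_left)
  qed simp
  then show ?thesis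
    using assms(2) by (auto simp: refl_group_def)
qed

text \<open>
  Elements of a parabolic subgroup can invert only the positive roots supported on \<open>J\<close>, and \<open>u\<close> inverts
  all of those. An element \<open>v\<close> of maximal length inverts the same roots, hence \<open>u v\<close> inverts none, so
  that \<open>u v = 1\<close> and \<open>v = u\<close>.
\<close>

lemma longest_element_eqI:
  assumes J: "J \<subseteq> {1..6}" and u: "u \<in> refl_group (\<alpha> ` J)"
    and invol: "u \<circ> u = id" and neg: "\<And>j. j \<in> J \<Longrightarrow> - u (\<alpha> j) \<in> P"
  shows "longest_element (\<alpha> ` J) = u"
proof -
  define PJ where "PJ = {\<beta> \<in> P. \<forall>i\<in>{1..6} - J. \<beta> \<bullet> cw i = 0}"
  have finite_PJ: "finite PJ"
    by (simp add: PJ_def finite_P)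
  have uW: "u \<in> W"
    using parabolic_in_W[OF J u] .
  have outside: "v \<beta> \<in> P - PJ"
    if v: "v \<in> refl_group (\<alpha> ` J)" and \<beta>: "\<beta> \<in> P - PJ" for v \<beta>
  proof -
    obtain i where i: "i \<in> {1..6} - J" "\<beta> \<bullet> cw i \<noteq> 0"
      using \<beta> by (auto simp: PJ_def)
    have pos: "0 < v \<beta> \<bullet> cw i"
      using parabolic_inner_cw[OF J v i(1)] i P_inner_cw_nonneg[of \<beta> i] \<beta> by auto
    moreover have "v \<beta> \<in> \<Phi>"
      using W_\<Phi> parabolic_in_W[OF J v] \<beta> P_in_\<Phi> by blast
    ultimately have "v \<beta> \<in> P"
      using P_I i(1) by blast
    then show ?thesis
      using pos i(1) by (force simp: PJ_def)
  qed
  have inversions_subset: "inversions v \<subseteq> PJ" if "v \<in> refl_group (\<alpha> ` J)" for v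
    using outside[OF that] not_P_both by (auto simp: inversions_def)
  have inversions_u: "inversions u = PJ"
  proof (intro equalityI inversions_subset u subsetI)
    fix \<beta> assume \<beta>: "\<beta> \<in> PJ"
    have "u \<beta> \<notin> P"
    proof
      (* All simple roots in J are negative on u rho, so the root beta supported on J is not positive on it. *)
      assume "u \<beta> \<in> P"
      then have "0 < u \<beta> \<bullet> rho"
        using P_inner_rho(1)[of "u \<beta>"] by simp
      also have "u \<beta> \<bullet> rho = \<beta> \<bullet> u rho"
        using W_inner[OF uW, of "u \<beta>" rho] invol by (simp add: fun_eq_iff)
      also have "\<dots> = (\<Sum>i=1..6. (\<beta> \<bullet> cw i) * (\<alpha> i \<bullet> u rho))"
        using \<beta> by (intro inner_expand) (auto simp: PJ_def \<Phi>_in_E P_in_\<Phi>)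
      also have "\<dots> \<le> 0"
      proof (rule sum_nonpos)
        fix i :: nat assume i: "i \<in> {1..6}"
        show "(\<beta> \<bullet> cw i) * (\<alpha> i \<bullet> u rho) \<le> 0"
        proof (cases "i \<in> J")
          case True
          have "\<alpha> i \<bullet> u rho = u (\<alpha> i) \<bullet> rho"
            using W_inner[OF uW, of "u (\<alpha> i)" rho] invol by (simp add: fun_eq_iff)
          then have "\<alpha> i \<bullet> u rho \<le> 0"
            using P_inner_rho(1)[OF neg[OF True]] by simp
          then show ?thesis
            using P_inner_cw_nonneg[of \<beta> i] \<beta> i by (auto simp: PJ_def intro: mult_nonneg_nonpos)
        next
          case False
          then show ?thesis
            using \<beta> i by (simp add: PJ_def)
        qed
      qed
      finally show False
        by simp
    qed
    moreover have "u \<beta> \<in> \<Phi>"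
      using \<beta> W_\<Phi>[OF uW] P_in_\<Phi> by (auto simp: PJ_def)
    ultimately show "\<beta> \<in> inversions u"
      using \<beta> by (auto simp: inversions_def PJ_def elim: P_cases)
  qed
  show ?thesis
    unfolding longest_element_def
  proof (rule the_equality)
    show "u \<in> refl_group (\<alpha> ` J) \<and>
        (\<forall>v\<in>refl_group (\<alpha> ` J). refl_length (\<alpha> ` J) v \<le> refl_length (\<alpha> ` J) u)"
      using u inversions_subset finite_PJ
      by (simp add: refl_length_eq_card_inversions[OF J] inversions_u card_mono)
  next
    fix w assume w: "w \<in> refl_group (\<alpha> ` J) \<and>
        (\<forall>v\<in>refl_group (\<alpha> ` J). refl_length (\<alpha> ` J) v \<le> refl_length (\<alpha> ` J) w)"
    then have "card PJ \<le> card (inversions w)"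
      using u by (auto simp: refl_length_eq_card_inversions[OF J] simp flip: inversions_u)
    then have inversions_w: "inversions w = PJ"
      using inversions_subset w finite_PJ by (intro card_seteq) auto
    have "inversions (u \<circ> w) = {}"
    proof -
      have "u (w \<beta>) \<in> P" if \<beta>: "\<beta> \<in> P" for \<beta>
      proof (cases "\<beta> \<in> PJ")
        case True
        then have "- w \<beta> \<in> P"
          using inversions_w by (auto simp: inversions_def)
        moreover have "(- w \<beta>) \<bullet> cw i = 0" if "i \<in> {1..6} - J" for i
          using parabolic_inner_cw[OF J _ that, of w \<beta>] w True that by (simp add: PJ_def)
        ultimately have "- w \<beta> \<in> inversions u"
          unfolding inversions_u PJ_def by blast
        then show ?thesis
          by (simp add: inversions_def linear_neg[OF W_linear[OF uW]])
      next
        case False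
        then show ?thesis
          using outside u w \<beta> by blast
      qed
      then show ?thesis
        using not_P_both by (auto simp: inversions_def)
    qed
    moreover have "u \<circ> w \<in> W"
      using W_comp uW w parabolic_in_W[OF J] by blast
    ultimately have "u \<circ> w = id"
      by (intro no_inversions_imp_id)
    then have "(u \<circ> u) \<circ> w = u"
      by (simp add: comp_assoc)
    then show "w = u"
      by (simp add: invol)
  qed
qed

lemma refl_word_rvec:
  assumes "set ws \<subseteq> {1..6}" "length k = 6"
  shows "refl_word (map \<alpha> ws) (rvec k) = rvec (foldr refl_coord ws k)"
proof -
  have "length (foldr refl_coord ws k) = 6 \<and>
      refl_word (map \<alpha> ws) (rvec k) = rvec (foldr refl_coord ws k)"
    using assms by (induction ws) (auto simp: refl_word_Cons reflect_rvec)
  then show ?thesis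
    by simp
qed

lemma longest_element_word:
  assumes ws: "set ws \<subseteq> {1..6}"
    and invol: "\<forall>i\<in>{1..6}. foldr refl_coord (ws @ ws) (unit_coord i) = unit_coord i"
    and neg: "\<forall>i\<in>set ws. \<exists>j\<in>{1..6}. foldr refl_coord ws (unit_coord i) = map uminus (unit_coord j)"
  shows "longest_element (\<alpha> ` set ws) = refl_word (map \<alpha> ws)"
proof (rule longest_element_eqI[OF ws])
  show in_group: "refl_word (map \<alpha> ws) \<in> refl_group (\<alpha> ` set ws)"
    unfolding refl_group_def by (intro CollectI exI[of _ "map \<alpha> ws"]) simp
  have "refl_word (map \<alpha> (ws @ ws)) (\<alpha> i) = \<alpha> i" if "i \<in> {1..6}" for i
    using refl_word_rvec[of "ws @ ws" "unit_coord i"] invol ws that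
    by (simp add: rvec_unit)
  moreover have "refl_word (map \<alpha> (ws @ ws)) \<in> W"
    using ws simple_in_\<Phi> unfolding refl_group_def by (intro CollectI exI[of _ "map \<alpha> (ws @ ws)"]) auto
  ultimately have "refl_word (map \<alpha> (ws @ ws)) = id"
    using simple_in_P by (intro simple_to_positive_imp_id) auto
  then show "refl_word (map \<alpha> ws) \<circ> refl_word (map \<alpha> ws) = id"
    by (simp add: refl_word_append)
next
  fix i assume i: "i \<in> set ws"
  then obtain j where j: "j \<in> {1..6}" "foldr refl_coord ws (unit_coord i) = map uminus (unit_coord j)"
    using neg by blast
  then have "refl_word (map \<alpha> ws) (\<alpha> i) = - \<alpha> j"
    using refl_word_rvec[OF ws, of "unit_coord i"] i ws
    by (simp add: rvec_neg rvec_unit subset_iff del: atLeastAtMost_iff)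
  then show "- refl_word (map \<alpha> ws) (\<alpha> i) \<in> P"
    using simple_in_P[OF j(1)] by simp
qed

text \<open>
  The vertices of the extended Dynkin diagram, with \<open>-\<theta>\<close> at index 0.
\<close>

definition aroot :: "nat \<Rightarrow> 'a" where
  "aroot i = (if i = 0 then - \<theta> else \<alpha> i)"

end

text \<open>
  A Coxeter element whose letters are ordered along the bipartition of the diagram, raised to half the
  Coxeter number, is the longest element. For \<open>E\<^sub>6\<close> the exponent is 6, for the two subdiagrams of type
  \<open>D\<^sub>5\<close> below it is 4.
\<close>

definition word_E6 :: "nat list" where
  "word_E6 = [1, 4, 6, 2, 3, 5, 1, 4, 6, 2, 3, 5, 1, 4, 6, 2, 3, 5,
    1, 4, 6, 2, 3, 5, 1, 4, 6, 2, 3, 5, 1, 4, 6, 2, 3, 5]"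

definition word_D5_1 :: "nat list" where
  "word_D5_1 = [4, 6, 2, 3, 5, 4, 6, 2, 3, 5, 4, 6, 2, 3, 5, 4, 6, 2, 3, 5]"

definition word_D5_6 :: "nat list" where
  "word_D5_6 = [1, 4, 2, 3, 5, 1, 4, 2, 3, 5, 1, 4, 2, 3, 5, 1, 4, 2, 3, 5]"

text \<open>
  The rotation of the extended Dynkin diagram that \<open>\<omega>\<^sub>1\<close> will turn out to induce.
\<close>

definition rot :: "nat \<Rightarrow> nat" where
  "rot i = [1, 6, 3, 5, 4, 2, 0] ! i"

lemma rot_simps [simp]:
  "rot 0 = 1" "rot 1 = 6" "rot 2 = 3" "rot 3 = 5" "rot 4 = 4" "rot 5 = 2" "rot 6 = 0"
  by (simp_all add: rot_def numeral_eq_Suc One_nat_def)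

definition aroot_coord :: "nat \<Rightarrow> int list" where
  "aroot_coord i = (if i = 0 then map uminus theta_coord else unit_coord i)"

lemma length_theta_coord: "length theta_coord = 6"
  by (simp add: theta_coord_def)

lemma word_sets:
  "set word_E6 = {1..6}" "set word_D5_1 = {1..6} - {1}" "set word_D5_6 = {1..6} - {6}"
  by (auto simp: word_E6_def word_D5_1_def word_D5_6_def)

lemmas word_eval = unit_coord_explicit refl_coord_explicit theta_coord_def

lemma word_E6_checks:
  assumes "i \<in> {1..6}"
  shows "foldr refl_coord (word_E6 @ word_E6) (unit_coord i) = unit_coord i"
    "\<exists>j\<in>{1..6}. foldr refl_coord word_E6 (unit_coord i) = map uminus (unit_coord j)"
  using assms by (elim index_cases; simp add: word_E6_def word_eval index_set del: atLeastAtMost_iff)+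

lemma word_D5_1_checks:
  assumes "i \<in> {1..6}"
  shows "foldr refl_coord (word_D5_1 @ word_D5_1) (unit_coord i) = unit_coord i"
    "i \<noteq> 1 \<Longrightarrow> \<exists>j\<in>{1..6}. foldr refl_coord word_D5_1 (unit_coord i) = map uminus (unit_coord j)"
  using assms by (elim index_cases; simp add: word_D5_1_def word_eval index_set del: atLeastAtMost_iff)+

lemma word_D5_6_checks:
  assumes "i \<in> {1..6}"
  shows "foldr refl_coord (word_D5_6 @ word_D5_6) (unit_coord i) = unit_coord i"
    "i \<noteq> 6 \<Longrightarrow> \<exists>j\<in>{1..6}. foldr refl_coord word_D5_6 (unit_coord i) = map uminus (unit_coord j)"
  using assms by (elim index_cases; simp add: word_D5_6_def word_eval index_set del: atLeastAtMost_iff)+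

lemma affine_index_cases:
  assumes "i \<in> {0..6::nat}"
  obtains "i = 0" | "i = 1" | "i = 2" | "i = 3" | "i = 4" | "i = 5" | "i = 6"
  using assms by force

lemma word_rotation:
  assumes "i \<in> {0..6}"
  shows "foldr refl_coord (word_D5_1 @ word_E6) (aroot_coord i) = aroot_coord (rot i)"
    "foldr refl_coord (word_D5_6 @ word_E6) (aroot_coord (rot i)) = aroot_coord i"
  using assms by (elim affine_index_cases;
    simp add: aroot_coord_def word_D5_1_def word_D5_6_def word_E6_def word_eval)+

context e6
begin

lemma aroot_coord:
  assumes "i \<in> {0..6}" shows "length (aroot_coord i) = 6" "rvec (aroot_coord i) = aroot i"
  using assms
  by (auto simp: aroot_coord_def aroot_def rvec_unit rvec_neg \<theta>_def length_theta_coord)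

lemma rot_range: "i \<in> {0..6} \<Longrightarrow> rot i \<in> {0..6}"
  by (elim affine_index_cases) simp_all

lemma omega_word:
  "omega \<alpha> 1 = refl_word (map \<alpha> (word_D5_1 @ word_E6))"
  "omega \<alpha> 6 = refl_word (map \<alpha> (word_D5_6 @ word_E6))"
proof -
  have "longest_element (\<alpha> ` set word_E6) = refl_word (map \<alpha> word_E6)"
    by (intro longest_element_word) (auto simp only: word_sets word_E6_checks)
  moreover have "longest_element (\<alpha> ` set word_D5_1) = refl_word (map \<alpha> word_D5_1)"
    using word_D5_1_checks by (intro longest_element_word) (auto simp only: word_sets)
  moreover have "longest_element (\<alpha> ` set word_D5_6) = refl_word (map \<alpha> word_D5_6)"
    using word_D5_6_checks by (intro longest_element_word) (auto simp only: word_sets)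
  ultimately show "omega \<alpha> 1 = refl_word (map \<alpha> (word_D5_1 @ word_E6))"
      "omega \<alpha> 6 = refl_word (map \<alpha> (word_D5_6 @ word_E6))"
    by (simp_all only: omega_def word_sets refl_word_append map_append) simp_all
qed

lemma omega_aroot:
  assumes "i \<in> {0..6}"
  shows omega1_aroot: "omega \<alpha> 1 (aroot i) = aroot (rot i)"
    and omega6_aroot: "omega \<alpha> 6 (aroot (rot i)) = aroot i"
proof -
  have *: "set (word_D5_1 @ word_E6) \<subseteq> {1..6}" "set (word_D5_6 @ word_E6) \<subseteq> {1..6}"
    by (auto simp only: set_append word_sets)
  show "omega \<alpha> 1 (aroot i) = aroot (rot i)"
    using refl_word_rvec[OF *(1), of "aroot_coord i"] assms
    by (simp only: omega_word word_rotation aroot_coord rot_range)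
  show "omega \<alpha> 6 (aroot (rot i)) = aroot i"
    using refl_word_rvec[OF *(2), of "aroot_coord (rot i)"] assms
    by (simp only: omega_word word_rotation aroot_coord rot_range)
qed

lemma omega_in_W: "omega \<alpha> 1 \<in> W" "omega \<alpha> 6 \<in> W"
proof -
  have "refl_word (map \<alpha> ws) \<in> W" if "set ws \<subseteq> {1..6}" for ws
    using that simple_in_\<Phi> unfolding refl_group_def by (intro CollectI exI[of _ "map \<alpha> ws"]) auto
  then show "omega \<alpha> 1 \<in> W" "omega \<alpha> 6 \<in> W"
    unfolding omega_word by (simp_all add: word_sets del: map_append)
qed

lemma omega_inverse: "omega \<alpha> 6 \<circ> omega \<alpha> 1 = id" "omega \<alpha> 1 \<circ> omega \<alpha> 6 = id"
proof -
  show *: "omega \<alpha> 6 \<circ> omega \<alpha> 1 = id"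
  proof (rule simple_to_positive_imp_id)
    show "omega \<alpha> 6 \<circ> omega \<alpha> 1 \<in> W"
      by (intro W_comp omega_in_W)
    fix i :: nat assume i: "i \<in> {1..6}"
    then have "aroot i = \<alpha> i"
      by (simp add: aroot_def)
    then show "(omega \<alpha> 6 \<circ> omega \<alpha> 1) (\<alpha> i) \<in> P"
      using omega_aroot[of i] i simple_in_P by simp
  qed
  obtain v where "v \<circ> omega \<alpha> 6 = id" "omega \<alpha> 6 \<circ> v = id"
    using refl_group_inverse[OF omega_in_W(2)] by blast
  then have "v = omega \<alpha> 1"
    using * by (metis comp_assoc comp_id id_comp)
  then show "omega \<alpha> 1 \<circ> omega \<alpha> 6 = id"
    using \<open>v \<circ> omega \<alpha> 6 = id\<close> by simp
qed

section \<open>Lattices and cosets\<close>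

abbreviation Z :: "'a set" where
  "Z \<equiv> coweight_lattice E \<Phi>"

abbreviation L :: "nat \<Rightarrow> 'a set" where
  "L q \<equiv> scaled_lattice E \<Phi> q"

lemma Z_I:
  assumes "x \<in> E" "\<And>i. i \<in> {1..6} \<Longrightarrow> \<alpha> i \<bullet> x \<in> \<int>"
  shows "x \<in> Z"
proof -
  have "\<beta> \<bullet> x \<in> \<int>" if "\<beta> \<in> \<Phi>" for \<beta>
    unfolding inner_expand[OF \<Phi>_in_E[OF that], of x]
    using assms(2) \<Phi>_inner_cw_Ints[OF that] by (intro Ints_sum Ints_mult) auto
  then show ?thesis
    using assms(1) by (simp add: coweight_lattice_def)
qed

lemma Z_inner: "x \<in> Z \<Longrightarrow> \<beta> \<in> \<Phi> \<Longrightarrow> \<beta> \<bullet> x \<in> \<int>"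
  by (simp add: coweight_lattice_def)

lemma Z_in_E: "x \<in> Z \<Longrightarrow> x \<in> E"
  by (simp add: coweight_lattice_def)

lemma Z_diff: "x \<in> Z \<Longrightarrow> y \<in> Z \<Longrightarrow> x - y \<in> Z"
  using subspace_diff[OF subspace_E] by (auto simp: coweight_lattice_def inner_diff_right)

lemma Z_add: "x \<in> Z \<Longrightarrow> y \<in> Z \<Longrightarrow> x + y \<in> Z"
  using subspace_add[OF subspace_E] by (auto simp: coweight_lattice_def inner_add_right)

lemma Z_zero: "0 \<in> Z"
  using subspace_0[OF subspace_E] by (auto simp: coweight_lattice_def)

lemma W_Z:
  assumes "w \<in> W" "x \<in> Z" shows "w x \<in> Z"
proof -
  obtain v where v: "v \<in> W" "w \<circ> v = id"
    using refl_group_inverse[OF assms(1)] by blast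
  have "\<beta> \<bullet> w x \<in> \<int>" if "\<beta> \<in> \<Phi>" for \<beta>
  proof -
    have "\<beta> \<bullet> w x = w (v \<beta>) \<bullet> w x"
      using v(2) by (simp add: fun_eq_iff)
    also have "\<dots> = v \<beta> \<bullet> x"
      by (rule W_inner[OF assms(1)])
    finally show ?thesis
      using Z_inner[OF assms(2) W_\<Phi>[OF v(1) that]] by simp
  qed
  then show ?thesis
    using W_E[OF assms(1)] assms(2) by (simp add: coweight_lattice_def)
qed

lemma L_1: "L 1 = Z"
  by (simp add: scaled_lattice_def)

lemma L_diff:
  assumes "x \<in> L q" "y \<in> L q" shows "x - y \<in> L q"
proof -
  obtain x' y' where "x' \<in> Z" "y' \<in> Z" "x = of_nat q *\<^sub>R x'" "y = of_nat q *\<^sub>R y'"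
    using assms by (auto simp: scaled_lattice_def)
  then show ?thesis
    unfolding scaled_lattice_def
    by (intro image_eqI[of _ _ "x' - y'"]) (auto simp: Z_diff scaleR_diff_right)
qed

lemma L_zero: "0 \<in> L q"
  unfolding scaled_lattice_def using Z_zero by (intro image_eqI[of _ _ 0]) auto

lemma L_minus: "x \<in> L q \<Longrightarrow> - x \<in> L q"
  using L_diff[OF L_zero] by simp

lemma L_add: "x \<in> L q \<Longrightarrow> y \<in> L q \<Longrightarrow> x + y \<in> L q"
  using L_diff[OF _ L_minus] by fastforce

lemma L_minus_commute: "x - y \<in> L q \<Longrightarrow> y - x \<in> L q"
  using L_minus by fastforce

lemma W_L: "w \<in> W \<Longrightarrow> x \<in> L q \<Longrightarrow> w x \<in> L q"
  unfolding scaled_lattice_def using W_Z by (auto simp: linear_scale[OF W_linear])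

lemma L_subset_Z:
  assumes "x \<in> L q" shows "x \<in> Z"
proof -
  obtain y where y: "y \<in> Z" "x = of_nat q *\<^sub>R y"
    using assms by (auto simp: scaled_lattice_def)
  show ?thesis
    unfolding y(2) using Z_in_E[OF y(1)] Z_inner[OF y(1)] subspace_scale[OF subspace_E]
    by (auto simp: coweight_lattice_def)
qed

lemma L_iff:
  assumes "q > 0"
  shows "x \<in> L q \<longleftrightarrow> x \<in> E \<and> (\<forall>i\<in>{1..6}. \<exists>k::int. \<alpha> i \<bullet> x = of_int k * of_nat q)"
proof
  assume "x \<in> L q"
  then obtain y where y: "y \<in> Z" "x = of_nat q *\<^sub>R y"
    by (auto simp: scaled_lattice_def)
  have "\<exists>k::int. \<alpha> i \<bullet> x = of_int k * of_nat q" if "i \<in> {1..6}" for i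
    using Z_inner[OF y(1) simple_in_\<Phi>[OF that]] by (auto simp: y(2) elim!: Ints_cases)
  then show "x \<in> E \<and> (\<forall>i\<in>{1..6}. \<exists>k::int. \<alpha> i \<bullet> x = of_int k * of_nat q)"
    using y Z_in_E subspace_scale[OF subspace_E] by auto
next
  assume *: "x \<in> E \<and> (\<forall>i\<in>{1..6}. \<exists>k::int. \<alpha> i \<bullet> x = of_int k * of_nat q)"
  define y where "y = (1 / of_nat q) *\<^sub>R x"
  have "y \<in> Z"
  proof (rule Z_I)
    show "y \<in> E"
      using * subspace_scale[OF subspace_E] by (simp add: y_def)
    fix i :: nat assume "i \<in> {1..6}"
    then obtain k :: int where "\<alpha> i \<bullet> x = of_int k * of_nat q"
      using * by blast
    then show "\<alpha> i \<bullet> y \<in> \<int>"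
      using assms by (simp add: y_def)
  qed
  then show "x \<in> L q"
    unfolding scaled_lattice_def using assms by (intro image_eqI[of _ _ y]) (simp_all add: y_def)
qed

lemma L_inner:
  assumes "x \<in> L q" "\<beta> \<in> \<Phi>"
  obtains k :: int where "\<beta> \<bullet> x = of_int k * of_nat q"
proof -
  obtain y where y: "y \<in> Z" "x = of_nat q *\<^sub>R y"
    using assms(1) by (auto simp: scaled_lattice_def)
  obtain k where "\<beta> \<bullet> y = of_int k"
    using Z_inner[OF y(1) assms(2)] by (auto elim: Ints_cases)
  then show ?thesis
    using that[of k] by (simp add: y(2))
qed

lemma coset_eq_iff: "coset x (L q) = coset y (L q) \<longleftrightarrow> x - y \<in> L q"
proof
  assume "coset x (L q) = coset y (L q)"
  then have "x \<in> coset y (L q)"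
    using L_zero by (force simp: coset_def)
  then show "x - y \<in> L q"
    by (auto simp: coset_def)
next
  have *: "coset x (L q) \<subseteq> coset y (L q)" if "x - y \<in> L q" for x y
  proof
    fix v assume "v \<in> coset x (L q)"
    then obtain z where z: "z \<in> L q" "v = x + z"
      by (auto simp: coset_def)
    then have "(x - y) + z \<in> L q"
      using L_add that by blast
    then show "v \<in> coset y (L q)"
      unfolding coset_def using z by (intro image_eqI[of _ _ "(x - y) + z"]) auto
  qed
  assume "x - y \<in> L q"
  then show "coset x (L q) = coset y (L q)"
    using * L_minus_commute by blast
qed

lemma W_coset:
  assumes "w \<in> W" shows "w ` coset x (L q) = coset (w x) (L q)"
proof -
  obtain v where v: "v \<in> W" "w \<circ> v = id"
    using refl_group_inverse[OF assms] by blast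
  have "w ` L q = L q"
  proof (intro equalityI subsetI)
    fix z assume "z \<in> L q"
    then show "z \<in> w ` L q"
      using v W_L[OF v(1)] by (intro image_eqI[of _ _ "v z"]) (auto simp: fun_eq_iff)
  qed (use W_L[OF assms] in auto)
  then have "(+) (w x) ` w ` L q = (+) (w x) ` L q"
    by simp
  then show ?thesis
    by (simp add: coset_def image_image linear_add[OF W_linear[OF assms]])
qed


section \<open>The stabiliser of the alcove\<close>

definition alcove :: "real \<Rightarrow> 'a set" where
  "alcove r = {x \<in> E. (\<forall>i\<in>{1..6}. 0 < \<alpha> i \<bullet> x) \<and> \<theta> \<bullet> x < r}"

lemma fundamental_alcove: "fundamental_alcove E \<Phi> \<alpha> = alcove 1"
  by (simp add: fundamental_alcove_def alcove_def highest_root)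

lemma alcove_P:
  assumes "x \<in> alcove r" "\<beta> \<in> P" shows "0 < \<beta> \<bullet> x" "\<beta> \<bullet> x < r"
proof -
  show "0 < \<beta> \<bullet> x"
    using assms(1) by (intro P_inner_pos[OF assms(2)]) (simp add: alcove_def)
  have "\<beta> \<bullet> x \<le> \<theta> \<bullet> x"
    using assms(1) by (intro P_inner_le_\<theta>[OF assms(2)]) (simp add: alcove_def less_imp_le)
  then show "\<beta> \<bullet> x < r"
    using assms by (auto simp: alcove_def)
qed

text \<open>
  The integer that moves the values of \<open>\<beta>\<close> on the fundamental alcove into the open unit interval. Thus
  \<open>\<beta> + offset \<beta>\<close> is the least affine root with gradient \<open>\<beta>\<close> that is positive on the alcove.
\<close>

definition offset :: "'a \<Rightarrow> real" where
  "offset \<beta> = (if \<beta> \<in> P then 0 else 1)"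

lemma alcove_offset:
  assumes "x \<in> alcove 1" "\<beta> \<in> \<Phi>"
  shows "0 < \<beta> \<bullet> x + offset \<beta>" "\<beta> \<bullet> x + offset \<beta> < 1"
proof -
  have "0 < \<beta> \<bullet> x + offset \<beta> \<and> \<beta> \<bullet> x + offset \<beta> < 1"
    using assms(2)
  proof (cases rule: P_cases)
    case 1
    then show ?thesis
      using alcove_P[OF assms(1) 1] by (simp add: offset_def)
  next
    case 2
    then have "\<beta> \<notin> P"
      using not_P_both by blast
    then show ?thesis
      using alcove_P[OF assms(1) 2] by (simp add: offset_def)
  qed
  then show "0 < \<beta> \<bullet> x + offset \<beta>" "\<beta> \<bullet> x + offset \<beta> < 1"
    by auto
qed

text \<open>
  The two sides differ by an integer and both lie strictly between 0 and 1.
\<close>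

lemma offset_transport:
  assumes "w \<in> W" "x \<in> alcove 1" "y \<in> alcove 1" "w x - y \<in> Z" "\<beta> \<in> \<Phi>"
  shows "w \<beta> \<bullet> y + offset (w \<beta>) = \<beta> \<bullet> x + offset \<beta>"
proof -
  have w\<beta>: "w \<beta> \<in> \<Phi>"
    by (rule W_\<Phi>[OF assms(1,5)])
  have "w \<beta> \<bullet> (w x - y) = \<beta> \<bullet> x - w \<beta> \<bullet> y"
    by (simp add: inner_diff_right W_inner[OF assms(1)])
  then have "\<beta> \<bullet> x - w \<beta> \<bullet> y \<in> \<int>"
    using Z_inner[OF assms(4) w\<beta>] by simp
  moreover have "offset \<beta> - offset (w \<beta>) \<in> \<int>"
    by (simp add: offset_def)
  ultimately have "(\<beta> \<bullet> x - w \<beta> \<bullet> y) + (offset \<beta> - offset (w \<beta>)) \<in> \<int>"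
    by (rule Ints_add)
  then obtain k :: int where k: "(\<beta> \<bullet> x + offset \<beta>) - (w \<beta> \<bullet> y + offset (w \<beta>)) = of_int k"
    by (auto elim!: Ints_cases simp: algebra_simps)
  have "\<bar>of_int k :: real\<bar> < 1"
    using alcove_offset[OF assms(2,5)] alcove_offset[OF assms(3) w\<beta>] unfolding k[symmetric] by linarith
  then have "k = 0"
    by linarith
  then show ?thesis
    using k by simp
qed

text \<open>
  Decomposability of the affine root \<open>\<beta> + offset \<beta>\<close> into two others of the same kind.
\<close>

definition decomposable :: "'a \<Rightarrow> bool" where
  "decomposable \<beta> \<longleftrightarrow> (\<exists>\<gamma>\<in>\<Phi>. \<exists>\<delta>\<in>\<Phi>. \<beta> = \<gamma> + \<delta> \<and> offset \<beta> = offset \<gamma> + offset \<delta>)"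

text \<open>
  The simple roots have the least height among positive roots and \<open>-\<theta>\<close> the least height of all, which
  makes them indecomposable. Any other positive root has a simple root as a summand, and any other
  negative root is \<open>-\<gamma> = -(\<gamma> + \<alpha>\<^sub>i) + \<alpha>\<^sub>i\<close> for some \<open>i\<close>.
\<close>

lemma decomposable_iff:
  assumes "\<beta> \<in> \<Phi>"
  shows "decomposable \<beta> \<longleftrightarrow> \<beta> \<notin> aroot ` {0..6}"
proof
  assume "decomposable \<beta>"
  then obtain \<gamma> \<delta> where *: "\<gamma> \<in> \<Phi>" "\<delta> \<in> \<Phi>" "\<beta> = \<gamma> + \<delta>" "offset \<beta> = offset \<gamma> + offset \<delta>"
    by (auto simp: decomposable_def)
  have ht: "1 \<le> \<eta> \<bullet> rho \<or> offset \<eta> = 1 \<and> - 11 \<le> \<eta> \<bullet> rho \<and> \<eta> \<bullet> rho \<le> - 1" if "\<eta> \<in> \<Phi>" for \<eta>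
    using that P_inner_rho[of \<eta>] P_inner_rho[of "- \<eta>"] not_P_both
    by (cases rule: P_cases) (auto simp: offset_def)
  show "\<beta> \<notin> aroot ` {0..6}"
  proof
    assume "\<beta> \<in> aroot ` {0..6}"
    then consider "\<beta> = - \<theta>" | i where "i \<in> {1..6}" "\<beta> = \<alpha> i"
      by (auto simp: aroot_def Suc_le_eq One_nat_def split: if_splits)
    then show False
    proof cases
      case 1
      then have "\<beta> \<notin> P" "\<gamma> \<bullet> rho + \<delta> \<bullet> rho = - 11"
        using \<theta>_in_P not_P_both * by (auto simp: \<theta>_inner_rho simp flip: inner_add_left)
      moreover have "offset \<gamma> = 0 \<or> offset \<delta> = 0"
        using * \<open>\<beta> \<notin> P\<close> by (auto simp: offset_def split: if_splits)
      ultimately show False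
        using ht[OF *(1)] ht[OF *(2)] by linarith
    next
      case 2
      then have "\<beta> \<bullet> rho = 1" "offset \<beta> = 0"
        using simple_in_P by (auto simp: rho_def simple_inner_from_coords offset_def)
      then have "\<gamma> \<bullet> rho + \<delta> \<bullet> rho = 1" "offset \<gamma> = 0" "offset \<delta> = 0"
        using * by (auto simp: offset_def inner_add_left split: if_splits)
      then show False
        using ht[OF *(1)] ht[OF *(2)] by linarith
    qed
  qed
next
  assume na: "\<beta> \<notin> aroot ` {0..6}"
  have simple: "\<alpha> i \<in> aroot ` {0..6}" if "i \<in> {1..6}" for i
    using that by (intro image_eqI[of _ _ i]) (auto simp: aroot_def)
  show "decomposable \<beta>"
    using assms
  proof (cases rule: P_cases)
    case 1
    then obtain i where i: "i \<in> {1..6}" "\<beta> - \<alpha> i \<in> P"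
      using P_subtract_simple[of \<beta>] na simple by blast
    then show ?thesis
      unfolding decomposable_def using 1 simple_in_P P_in_\<Phi>
      by (intro bexI[of _ "\<beta> - \<alpha> i"] bexI[of _ "\<alpha> i"]) (auto simp: offset_def)
  next
    case 2
    have "- \<beta> \<noteq> \<theta>"
    proof
      assume "- \<beta> = \<theta>"
      from this[symmetric] have "\<beta> = aroot 0"
        by (simp add: aroot_def)
      then show False
        using na by auto
    qed
    then obtain i where i: "i \<in> {1..6}" "- \<beta> + \<alpha> i \<in> P"
      using P_add_simple[of "- \<beta>"] 2 by blast
    then have "\<beta> - \<alpha> i \<in> \<Phi>" "\<beta> - \<alpha> i \<notin> P" "\<beta> \<notin> P"
      using \<Phi>_neg[OF P_in_\<Phi>[OF i(2)]] not_P_both[of "\<beta> - \<alpha> i"] not_P_both[of \<beta>] 2 by auto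
    then show ?thesis
      unfolding decomposable_def using simple_in_P i(1) P_in_\<Phi>
      by (intro bexI[of _ "\<beta> - \<alpha> i"] bexI[of _ "\<alpha> i"]) (auto simp: offset_def)
  qed
qed

lemma decomposable_transport:
  assumes "w \<in> W" "x \<in> alcove 1" "y \<in> alcove 1" "w x - y \<in> Z" "\<beta> \<in> \<Phi>" "decomposable \<beta>"
  shows "decomposable (w \<beta>)"
proof -
  obtain \<gamma> \<delta> where *: "\<gamma> \<in> \<Phi>" "\<delta> \<in> \<Phi>" "\<beta> = \<gamma> + \<delta>" "offset \<beta> = offset \<gamma> + offset \<delta>"
    using assms(6) by (auto simp: decomposable_def)
  have eq: "w \<beta> = w \<gamma> + w \<delta>"
    unfolding *(3) by (rule linear_add[OF W_linear[OF assms(1)]])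
  have "offset (w \<beta>) = offset (w \<gamma>) + offset (w \<delta>)"
    using offset_transport[OF assms(1-4) *(1)] offset_transport[OF assms(1-4) *(2)]
      offset_transport[OF assms(1-5)] *(4) eq
    unfolding *(3) by (simp add: inner_add_left)
  then show ?thesis
    unfolding decomposable_def using eq W_\<Phi>[OF assms(1)] * by blast
qed

lemma aroot_in_\<Phi>: "i \<in> {0..6} \<Longrightarrow> aroot i \<in> \<Phi>"
  using simple_in_\<Phi> \<theta>_in_P P_in_\<Phi> \<Phi>_neg by (auto simp: aroot_def)

text \<open>
  Decompositions are transported by \<open>w\<close> and, with the roles of the two points exchanged, by its inverse.
\<close>

lemma permutes_affine_simple:
  assumes "w \<in> W" "x \<in> alcove 1" "y \<in> alcove 1" "w x - y \<in> Z" "i \<in> {0..6}"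
  shows "w (aroot i) \<in> aroot ` {0..6}"
proof (rule ccontr)
  assume "w (aroot i) \<notin> aroot ` {0..6}"
  moreover have root: "w (aroot i) \<in> \<Phi>"
    using W_\<Phi>[OF assms(1)] aroot_in_\<Phi>[OF assms(5)] .
  ultimately have dec: "decomposable (w (aroot i))"
    using decomposable_iff by blast
  obtain v where v: "v \<in> W" "v \<circ> w = id"
    using refl_group_inverse[OF assms(1)] by blast
  have "v (w x - y) \<in> Z"
    using W_Z[OF v(1) assms(4)] .
  then have "x - v y \<in> Z"
    using v by (simp add: linear_diff[OF W_linear] fun_eq_iff)
  then have "v y - x \<in> Z"
    using Z_diff[OF Z_zero] by fastforce
  from decomposable_transport[OF v(1) assms(3,2) this root dec]
  have "decomposable (aroot i)"
    using v(2) by (simp add: fun_eq_iff)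
  then show False
    using decomposable_iff[OF aroot_in_\<Phi>[OF assms(5)]] assms(5) by blast
qed

lemma simple_neq_lowest: "i \<in> {1..6} \<Longrightarrow> \<alpha> i \<noteq> - \<theta>"
  using simple_in_P \<theta>_in_P not_P_both by metis

lemma W_inj: "w \<in> W \<Longrightarrow> w x = w y \<Longrightarrow> x = y"
  using orthogonal_transformation_inj[OF W_orthogonal] by (metis injD)

lemma fixes_lowest_imp_id:
  assumes "w \<in> W" "\<And>i. i \<in> {0..6} \<Longrightarrow> w (aroot i) \<in> aroot ` {0..6}" "w (- \<theta>) = - \<theta>"
  shows "w = id"
proof (rule simple_to_positive_imp_id[OF assms(1)])
  fix i :: nat assume i: "i \<in> {1..6}"
  then have "w (\<alpha> i) \<in> aroot ` {0..6}"
    using assms(2)[of i] by (auto simp: aroot_def split: if_splits)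
  moreover have "w (\<alpha> i) \<noteq> - \<theta>"
    using W_inj[OF assms(1), of "\<alpha> i" "- \<theta>"] assms(3) simple_neq_lowest[OF i] by metis
  ultimately show "w (\<alpha> i) \<in> P"
    using simple_in_P by (auto simp: aroot_def split: if_splits)
qed

text \<open>
  Suppose \<open>w (-\<theta>) = \<alpha>\<^sub>j\<close> and apply \<open>w\<close> to \<open>\<theta> = \<Sum> n\<^sub>i \<alpha>\<^sub>i\<close>. On the right no \<open>w \<alpha>\<^sub>i\<close> equals \<open>\<alpha>\<^sub>j\<close>, so the coefficient of
  \<open>\<alpha>\<^sub>j\<close> there is a multiple of \<open>n\<^sub>j\<close>, while on the left it is \<open>-1\<close>. Hence \<open>n\<^sub>j = 1\<close>.
\<close>

lemma lowest_image:
  assumes "w \<in> W" "\<And>i. i \<in> {0..6} \<Longrightarrow> w (aroot i) \<in> aroot ` {0..6}"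
  shows "w (- \<theta>) \<in> {- \<theta>, \<alpha> 1, \<alpha> 6}"
proof -
  have "w (- \<theta>) \<in> aroot ` {0..6}"
    using assms(2)[of 0] by (simp add: aroot_def)
  then consider "w (- \<theta>) = - \<theta>" | j where "j \<in> {1..6}" "w (- \<theta>) = \<alpha> j"
    by (auto simp: aroot_def Suc_le_eq One_nat_def split: if_splits)
  then show ?thesis
  proof cases
    case 2
    (* The coefficients of the highest root. *)
    define n where "n i = theta_coord ! (i - 1)" for i
    have "\<exists>t::int. w (\<alpha> i) \<bullet> cw j = of_int (n j * t)" if i: "i \<in> {1..6}" for i
    proof -
      have "w (\<alpha> i) \<in> aroot ` {0..6}"
        using assms(2)[of i] i by (auto simp: aroot_def split: if_splits)
      moreover have "w (\<alpha> i) \<noteq> \<alpha> j"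
        using W_inj[OF assms(1), of "\<alpha> i" "- \<theta>"] 2 simple_neq_lowest[OF i] by metis
      ultimately obtain k where k: "k \<in> {0..6}" "w (\<alpha> i) = aroot k" "aroot k \<noteq> \<alpha> j"
        by auto
      show ?thesis
      proof (cases "k = 0")
        case True
        then show ?thesis
          using \<theta>_inner_cw[OF 2(1)] k(2) by (intro exI[of _ "- 1"]) (simp add: n_def aroot_def)
      next
        case False
        then have "k \<in> {1..6}" "k \<noteq> j"
          using k by (auto simp: aroot_def)
        then show ?thesis
          using simple_inner_cw[OF 2(1), of k] k(2) False by (intro exI[of _ 0]) (simp add: aroot_def)
      qed
    qed
    then obtain t :: "nat \<Rightarrow> int" where t: "\<And>i. i \<in> {1..6} \<Longrightarrow> w (\<alpha> i) \<bullet> cw j = of_int (n j * t i)"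
      by metis
    have "- (\<alpha> j \<bullet> cw j) = w \<theta> \<bullet> cw j"
      using 2(2) by (simp add: linear_neg[OF W_linear[OF assms(1)]] flip: 2(2))
    also have "\<dots> = (\<Sum>i=1..6. of_int (n i) * (w (\<alpha> i) \<bullet> cw j))"
      unfolding \<theta>_def rvec_def linear_sum[OF W_linear[OF assms(1)]] n_def
      by (simp add: linear_scale[OF W_linear[OF assms(1)]] inner_sum_left)
    also have "\<dots> = (\<Sum>i=1..6. of_int (n i * (n j * t i)))"
      by (intro sum.cong refl) (simp only: t of_int_mult)
    also have "\<dots> = of_int (n j * (\<Sum>i=1..6. n i * t i))"
      by (simp add: sum_distrib_left mult_ac)
    finally have "of_int (n j * (\<Sum>i=1..6. n i * t i)) = (of_int (- 1) :: real)"
      using simple_inner_cw[OF 2(1,1)] by simp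
    then have "n j * (\<Sum>i=1..6. n i * t i) = - 1"
      by (simp only: of_int_eq_iff)
    then have "n j dvd 1"
      by (metis dvd_minus_iff dvd_triv_left)
    then have "j = 1 \<or> j = 6"
      using 2(1) by (elim index_cases) (simp_all add: n_def theta_coord_def)
    then show ?thesis
      using 2(2) by auto
  qed simp
qed

lemma rot_surj:
  assumes "i \<in> {0..6}" obtains j where "j \<in> {0..6}" "rot j = i"
  using assms
proof (rule affine_index_cases)
qed (use that[of 0] that[of 1] that[of 2] that[of 3] that[of 4] that[of 5] that[of 6] in simp_all)

definition Omega :: "('a \<Rightarrow> 'a) set" where
  "Omega = {id, omega \<alpha> 1, omega \<alpha> 6}"

lemma Omega_in_W: "u \<in> Omega \<Longrightarrow> u \<in> W"
  using omega_in_W refl_group_id by (auto simp: Omega_def)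

lemma Omega_inverse:
  assumes "u \<in> Omega" obtains v where "v \<in> Omega" "u \<circ> v = id" "v \<circ> u = id"
  using assms omega_inverse that[of id] that[of "omega \<alpha> 1"] that[of "omega \<alpha> 6"]
  unfolding Omega_def by (elim insertE) simp_all

lemma Omega_aroot:
  assumes "u \<in> Omega" "i \<in> {0..6}"
  shows "u (aroot i) \<in> aroot ` {0..6}"
proof -
  obtain j where "j \<in> {0..6}" "rot j = i"
    using rot_surj assms(2) by blast
  then show ?thesis
    using assms omega1_aroot[of i] omega6_aroot[of j] rot_range[of i] by (auto simp: Omega_def)
qed

lemma permutation_of_affine_simple_in_Omega:
  assumes "w \<in> W" "\<And>i. i \<in> {0..6} \<Longrightarrow> w (aroot i) \<in> aroot ` {0..6}"
  shows "w \<in> Omega"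
proof -
  have aroots: "aroot 0 = - \<theta>" "aroot 1 = \<alpha> 1" "aroot 6 = \<alpha> 6"
    by (simp_all add: aroot_def)
  have "omega \<alpha> 6 (\<alpha> 1) = - \<theta>" "omega \<alpha> 1 (\<alpha> 6) = - \<theta>"
    using omega6_aroot[of 0] omega1_aroot[of 6] by (simp_all add: aroots)
  then have "\<exists>u\<in>Omega. u (w (- \<theta>)) = - \<theta>"
    using lowest_image[OF assms] unfolding Omega_def by force
  then obtain u where u: "u \<in> Omega" "u (w (- \<theta>)) = - \<theta>"
    by blast
  have "(u \<circ> w) (aroot i) \<in> aroot ` {0..6}" if i: "i \<in> {0..6}" for i
  proof -
    obtain j where "j \<in> {0..6}" "w (aroot i) = aroot j"
      using assms(2)[OF i] by blast
    then show ?thesis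
      using Omega_aroot[OF u(1)] by simp
  qed
  then have "u \<circ> w = id"
    using u Omega_in_W assms(1) by (intro fixes_lowest_imp_id W_comp) auto
  moreover obtain v where "v \<in> Omega" "v \<circ> u = id"
    using Omega_inverse u(1) by blast
  ultimately have "w = v"
    by (metis comp_assoc comp_id id_comp)
  then show ?thesis
    using \<open>v \<in> Omega\<close> by simp
qed

lemma alcove_meets_imp_Omega:
  assumes "q > 0" "w \<in> W" "x \<in> alcove (of_nat q)" "y \<in> alcove (of_nat q)" "w x - y \<in> L q"
  shows "w \<in> Omega"
proof -
  define c :: real where "c = 1 / of_nat q"
  have c: "c > 0"
    using assms(1) by (simp add: c_def)
  have scale: "c *\<^sub>R v \<in> alcove 1" if "v \<in> alcove (of_nat q)" for v
    using that assms(1) subspace_scale[OF subspace_E]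
    by (auto simp: alcove_def c_def divide_less_eq)
  obtain z where z: "z \<in> Z" "w x - y = of_nat q *\<^sub>R z"
    using assms(5) by (auto simp: scaled_lattice_def)
  have "w (c *\<^sub>R x) - c *\<^sub>R y = c *\<^sub>R (w x - y)"
    by (simp add: linear_scale[OF W_linear[OF assms(2)]] scaleR_diff_right)
  also have "\<dots> = z"
    using assms(1) by (simp add: z(2) c_def)
  finally have "w (c *\<^sub>R x) - c *\<^sub>R y \<in> Z"
    using z(1) by simp
  then show ?thesis
    using permutation_of_affine_simple_in_Omega permutes_affine_simple scale assms by blast
qed

text \<open>
  A point is determined by the values of the seven affine simple functions \<open>\<alpha>\<^sub>i\<close> and \<open>q - \<theta>\<close>, and
  it lies in the alcove if and only if they are positive. Up to a translation, \<open>\<omega>\<^sub>1\<close> rotates these values.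
\<close>

lemma omega1_alcove:
  assumes q: "q > 0" and x: "x \<in> alcove (of_nat q)"
  shows "\<exists>y\<in>alcove (of_nat q). omega \<alpha> 1 x - y \<in> L q"
proof -
  let ?w = "omega \<alpha> 1"
  define a where "a i = aroot i \<bullet> x + (if i = 0 then of_nat q else 0)" for i
  define y where "y = from_coords (\<lambda>j. a (rot (rot j)))"
  have a_pos: "0 < a i" if "i \<in> {0..6}" for i
    using that x by (auto simp: a_def aroot_def alcove_def)
  have yj: "\<alpha> j \<bullet> y = a (rot (rot j))" if "j \<in> {1..6}" for j
    using that by (simp add: y_def simple_inner_from_coords)
  have "y \<in> alcove (of_nat q)"
  proof -
    have "0 < \<alpha> j \<bullet> y" if "j \<in> {1..6}" for j
      using that a_pos rot_range by (simp add: yj)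
    moreover have "\<theta> \<bullet> y < of_nat q"
      using a_pos[of 6] unfolding \<theta>_inner[of y] by (simp add: yj a_def aroot_def \<theta>_inner[of x])
    ultimately show ?thesis
      by (simp add: alcove_def y_def from_coords_in_E)
  qed
  moreover have "?w x - y \<in> L q"
    unfolding L_iff[OF q]
  proof (intro conjI ballI)
    show "?w x - y \<in> E"
      using x W_E omega_in_W from_coords_in_E subspace_diff[OF subspace_E]
      by (auto simp: alcove_def y_def)
    fix j :: nat assume j: "j \<in> {1..6}"
    obtain i where i: "i \<in> {0..6}" "rot i = j" "rot (rot j) = i"
      using j by (elim index_cases)
        (use that[of 0] that[of 1] that[of 2] that[of 3] that[of 4] that[of 5] that[of 6] in simp_all)
    have "aroot j \<bullet> ?w x = aroot i \<bullet> x"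
      using omega1_aroot[OF i(1)] W_inner[OF omega_in_W(1), of "aroot i" x] i(2) by simp
    then have "\<alpha> j \<bullet> (?w x - y) = of_int (if i = 0 then - 1 else 0) * of_nat q"
      using j by (simp add: inner_diff_right yj i a_def) (simp add: aroot_def)
    then show "\<exists>k::int. \<alpha> j \<bullet> (?w x - y) = of_int k * of_nat q" ..
  qed
  ultimately show ?thesis
    by blast
qed

lemma omega6_eq: "omega \<alpha> 6 = omega \<alpha> 1 \<circ> omega \<alpha> 1"
proof -
  have "omega \<alpha> 1 \<circ> omega \<alpha> 1 \<circ> omega \<alpha> 1 = id"
  proof (rule simple_to_positive_imp_id)
    show "omega \<alpha> 1 \<circ> omega \<alpha> 1 \<circ> omega \<alpha> 1 \<in> W"
      by (intro W_comp omega_in_W)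
    fix i :: nat assume i: "i \<in> {1..6}"
    have "(omega \<alpha> 1 \<circ> omega \<alpha> 1 \<circ> omega \<alpha> 1) (aroot i) = aroot (rot (rot (rot i)))"
      using i rot_range omega1_aroot by simp
    also have "\<dots> = aroot i"
      using i by (elim index_cases) simp_all
    finally show "(omega \<alpha> 1 \<circ> omega \<alpha> 1 \<circ> omega \<alpha> 1) (\<alpha> i) \<in> P"
      using i simple_in_P by (simp add: aroot_def)
  qed
  then have "omega \<alpha> 6 \<circ> (omega \<alpha> 1 \<circ> omega \<alpha> 1 \<circ> omega \<alpha> 1) = omega \<alpha> 6"
    by simp
  then have "(omega \<alpha> 6 \<circ> omega \<alpha> 1) \<circ> (omega \<alpha> 1 \<circ> omega \<alpha> 1) = omega \<alpha> 6"
    by (simp only: comp_assoc)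
  then show ?thesis
    by (simp add: omega_inverse)
qed

lemma Omega_alcove:
  assumes "q > 0" "x \<in> alcove (of_nat q)" "u \<in> Omega"
  shows "\<exists>y\<in>alcove (of_nat q). u x - y \<in> L q"
proof -
  consider "u = id" | "u = omega \<alpha> 1" | "u = omega \<alpha> 1 \<circ> omega \<alpha> 1"
    using assms(3) omega6_eq by (auto simp: Omega_def)
  then show ?thesis
  proof cases
    case 1
    then show ?thesis
      using assms(2) L_zero by (intro bexI[of _ x]) auto
  next
    case 2
    then show ?thesis
      using omega1_alcove assms by blast
  next
    case 3
    obtain y where y: "y \<in> alcove (of_nat q)" "omega \<alpha> 1 x - y \<in> L q"
      using omega1_alcove assms by blast
    obtain z where z: "z \<in> alcove (of_nat q)" "omega \<alpha> 1 y - z \<in> L q"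
      using omega1_alcove assms(1) y(1) by blast
    have "omega \<alpha> 1 (omega \<alpha> 1 x) - omega \<alpha> 1 y \<in> L q"
      using W_L[OF omega_in_W(1) y(2)] by (simp add: linear_diff[OF W_linear[OF omega_in_W(1)]])
    from L_add[OF this z(2)] show ?thesis
      using z(1) by (intro bexI[of _ z]) (simp_all add: 3)
  qed
qed

lemma stabilizer_alcove: "stabilizer_alcove E \<Phi> \<alpha> = Omega"
proof -
  define A where "A = (\<lambda>x. coset x (L 1)) ` alcove 1"
  have stab: "stabilizer_alcove E \<Phi> \<alpha> = {w \<in> W. (\<lambda>t. w ` t) ` A = A}"
    by (simp add: stabilizer_alcove_def Let_def A_def fundamental_alcove L_1)
  have image_subset: "(\<lambda>t. u ` t) ` A \<subseteq> A" if u: "u \<in> Omega" for u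
  proof
    fix t assume "t \<in> (\<lambda>t. u ` t) ` A"
    then obtain x where x: "x \<in> alcove 1" "t = u ` coset x (L 1)"
      by (auto simp: A_def)
    obtain y where "y \<in> alcove 1" "u x - y \<in> L 1"
      using Omega_alcove[of 1 x u] x u by auto
    then show "t \<in> A"
      unfolding A_def x(2) W_coset[OF Omega_in_W[OF u]] by (intro image_eqI[of _ _ y]) (simp add: coset_eq_iff)
  qed
  show ?thesis
    unfolding stab
  proof (intro equalityI subsetI)
    fix w assume "w \<in> {w \<in> W. (\<lambda>t. w ` t) ` A = A}"
    then have w: "w \<in> W" "(\<lambda>t. w ` t) ` A = A"
      by auto
    have x: "from_coords (\<lambda>_. 1 / 12) \<in> alcove 1" (is "?x \<in> _")
      by (simp add: alcove_def from_coords_in_E simple_inner_from_coords \<theta>_inner)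
    then have "w ` coset ?x (L 1) \<in> A"
      using w(2) unfolding A_def by blast
    then obtain y where "y \<in> alcove 1" "coset (w ?x) (L 1) = coset y (L 1)"
      unfolding W_coset[OF w(1)] A_def by blast
    then show "w \<in> Omega"
      using alcove_meets_imp_Omega[of 1 w ?x y] w(1) x by (simp add: coset_eq_iff)
  next
    fix w assume w: "w \<in> Omega"
    obtain v where v: "v \<in> Omega" "w \<circ> v = id"
      using Omega_inverse[OF w] by blast
    have "w ` v ` t = t" for t
      unfolding image_comp v(2) by simp
    then have "A = (\<lambda>t. w ` t) ` ((\<lambda>t. v ` t) ` A)"
      by (subst image_image) simp
    also have "\<dots> \<subseteq> (\<lambda>t. w ` t) ` A"
      using image_subset[OF v(1)] by (rule image_mono)
    finally show "w \<in> {w \<in> W. (\<lambda>t. w ` t) ` A = A}"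
      using image_subset[OF w] Omega_in_W[OF w] by auto
  qed
qed

section \<open>Regular lattice points and the alcove\<close>

definition alcove_points :: "nat \<Rightarrow> 'a set" where
  "alcove_points q = Z \<inter> alcove (of_nat q)"

definition regular :: "nat \<Rightarrow> 'a \<Rightarrow> bool" where
  "regular q x \<longleftrightarrow> (\<forall>\<beta>\<in>\<Phi>. \<not> (\<exists>k::int. \<beta> \<bullet> x = of_int k * of_nat q))"

lemma arrangement_complement_eq:
  "arrangement_complement E \<Phi> q = (\<lambda>x. coset x (L q)) ` {x \<in> Z. regular q x}"
  by (auto simp: arrangement_complement_def regular_def)

lemma regular_W:
  assumes "w \<in> W" "regular q x"
  shows "regular q (w x)"
  unfolding regular_def
proof
  fix \<beta> assume "\<beta> \<in> \<Phi>"
  obtain v where v: "v \<in> W" "w \<circ> v = id"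
    using refl_group_inverse[OF assms(1)] by blast
  have "\<beta> \<bullet> w x = v \<beta> \<bullet> x"
    using W_inner[OF assms(1), of "v \<beta>" x] v(2) by (simp add: fun_eq_iff)
  then show "\<not> (\<exists>k::int. \<beta> \<bullet> w x = of_int k * of_nat q)"
    using assms(2) W_\<Phi>[OF v(1) \<open>\<beta> \<in> \<Phi>\<close>] by (simp add: regular_def)
qed

lemma regular_add_L:
  assumes "regular q x" "z \<in> L q"
  shows "regular q (x + z)"
  unfolding regular_def
proof safe
  fix \<beta> k assume \<beta>: "\<beta> \<in> \<Phi>" and k: "\<beta> \<bullet> (x + z) = of_int k * of_nat q"
  obtain l :: int where "\<beta> \<bullet> z = of_int l * of_nat q"
    using L_inner assms(2) \<beta> by blast
  then have "\<beta> \<bullet> x = of_int (k - l) * of_nat q"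
    using k by (simp add: inner_add_right algebra_simps)
  then show False
    using assms(1) \<beta> unfolding regular_def by blast
qed

lemma regular_alcove:
  assumes "x \<in> alcove (of_nat q)"
  shows "regular q x"
proof -
  have no_multiple: "\<not> (\<exists>k::int. r = of_int k * of_nat q)" if "0 < r" "r < of_nat q" for r :: real
  proof safe
    fix k :: int assume k: "r = of_int k * of_nat q"
    then have "0 < k"
      using that(1) by (simp add: zero_less_mult_iff)
    then have "of_nat q * 1 \<le> of_nat q * (of_int k :: real)"
      by (intro mult_left_mono) auto
    then show False
      using that(2) k by (simp add: mult.commute)
  qed
  show ?thesis
    unfolding regular_def
  proof
    fix \<beta> assume "\<beta> \<in> \<Phi>"
    then show "\<not> (\<exists>k::int. \<beta> \<bullet> x = of_int k * of_nat q)"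
    proof (cases rule: P_cases)
      case 1
      then show ?thesis
        using no_multiple alcove_P[OF assms 1] by blast
    next
      case 2
      show ?thesis
      proof
        assume "\<exists>k::int. \<beta> \<bullet> x = of_int k * of_nat q"
        then obtain k :: int where "- \<beta> \<bullet> x = of_int (- k) * of_nat q"
          by auto
        then show False
          using no_multiple alcove_P[OF assms 2] by blast
      qed
    qed
  qed
qed

lemma finite_Z_ball: "finite {y \<in> Z. norm (y - p) \<le> r}"
proof -
  define B where "B = (\<lambda>i. norm (\<alpha> i) * (r + norm p))"
  define f where "f = (\<lambda>y. \<lambda>i\<in>{1..6::nat}. \<lfloor>\<alpha> i \<bullet> y\<rfloor>)"
  have "f ` {y \<in> Z. norm (y - p) \<le> r} \<subseteq> (\<Pi>\<^sub>E i\<in>{1..6}. {\<lfloor>- B i\<rfloor>..\<lfloor>B i\<rfloor>})"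
  proof (rule image_subsetI)
    fix y assume "y \<in> {y \<in> Z. norm (y - p) \<le> r}"
    then have y: "y \<in> Z" "norm (y - p) \<le> r"
      by auto
    have "\<lfloor>\<alpha> i \<bullet> y\<rfloor> \<in> {\<lfloor>- B i\<rfloor>..\<lfloor>B i\<rfloor>}" for i
    proof -
      have "norm y \<le> r + norm p"
        using y(2) norm_triangle_sub[of y p] by simp
      then have "norm (\<alpha> i) * norm y \<le> B i"
        unfolding B_def by (intro mult_left_mono) auto
      then have "\<bar>\<alpha> i \<bullet> y\<bar> \<le> B i"
        using Cauchy_Schwarz_ineq2[of "\<alpha> i" y] by linarith
      then show ?thesis
        by (auto intro!: floor_mono)
    qed
    then show "f y \<in> (\<Pi>\<^sub>E i\<in>{1..6}. {\<lfloor>- B i\<rfloor>..\<lfloor>B i\<rfloor>})"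
      by (auto simp: f_def)
  qed
  then have "finite (f ` {y \<in> Z. norm (y - p) \<le> r})"
    by (rule finite_subset) (intro finite_PiE, auto)
  moreover have "inj_on f {y \<in> Z. norm (y - p) \<le> r}"
  proof (rule inj_onI)
    fix x y assume xy: "x \<in> {y \<in> Z. norm (y - p) \<le> r}" "y \<in> {y \<in> Z. norm (y - p) \<le> r}" "f x = f y"
    show "x = y"
    proof (rule E_eqI)
      fix i :: nat assume i: "i \<in> {1..6}"
      then have "\<lfloor>\<alpha> i \<bullet> x\<rfloor> = \<lfloor>\<alpha> i \<bullet> y\<rfloor>"
        using fun_cong[OF xy(3), of i] by (simp add: f_def)
      moreover have "\<alpha> i \<bullet> x \<in> \<int>" "\<alpha> i \<bullet> y \<in> \<int>"
        using Z_inner[OF _ simple_in_\<Phi>[OF i]] xy by auto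
      ultimately show "\<alpha> i \<bullet> x = \<alpha> i \<bullet> y"
        by (auto elim!: Ints_cases)
    qed (use xy Z_in_E in auto)
  qed
  ultimately show ?thesis
    by (rule finite_imageD)
qed

text \<open>
  The squared distance changes by \<open>4 ((b, y) - k) ((b, p) - k) / (b, b)\<close> when \<open>y\<close> is reflected in the
  hyperplane \<open>(b, x) = k\<close>.
\<close>

lemma affine_reflection_decreases_norm:
  fixes b y p :: 'a
  assumes "b \<noteq> 0" "(b \<bullet> y - k) * (b \<bullet> p - k) < 0"
  shows "norm (reflect b y + (2 * k / (b \<bullet> b)) *\<^sub>R b - p) < norm (y - p)"
proof -
  define c where "c = 2 * (b \<bullet> y - k) / (b \<bullet> b)"
  have bb: "b \<bullet> b > 0"
    using assms(1) by simp
  have eq: "reflect b y + (2 * k / (b \<bullet> b)) *\<^sub>R b - p = (y - p) - c *\<^sub>R b"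
    by (simp add: reflect_def c_def algebra_simps diff_divide_distrib)
  have "(norm (v - c *\<^sub>R b))\<^sup>2 = (norm v)\<^sup>2 + c * (c * (b \<bullet> b) - 2 * (b \<bullet> v))" for v
    by (simp add: power2_norm_eq_inner inner_diff_left inner_diff_right inner_commute algebra_simps)
  then have "(norm (reflect b y + (2 * k / (b \<bullet> b)) *\<^sub>R b - p))\<^sup>2
      = (norm (y - p))\<^sup>2 + c * (c * (b \<bullet> b) - 2 * (b \<bullet> (y - p)))"
    unfolding eq .
  also have "c * (b \<bullet> b) = 2 * (b \<bullet> y - k)"
    using bb by (simp add: c_def)
  also have "c * (2 * (b \<bullet> y - k) - 2 * (b \<bullet> (y - p))) = 4 * ((b \<bullet> y - k) * (b \<bullet> p - k)) / (b \<bullet> b)"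
    using bb by (simp add: c_def inner_diff_right field_simps)
  also have "\<dots> < 0"
    using assms(2) bb by (simp add: divide_less_0_iff mult.commute)
  finally have "(norm (reflect b y + (2 * k / (b \<bullet> b)) *\<^sub>R b - p))\<^sup>2 < (norm (y - p))\<^sup>2"
    by simp
  then show ?thesis
    by (rule power_less_imp_less_base) simp
qed

lemma coroot_in_Z:
  assumes "\<beta> \<in> \<Phi>"
  shows "(2 / (\<beta> \<bullet> \<beta>)) *\<^sub>R \<beta> \<in> Z"
  unfolding coweight_lattice_def
proof (intro CollectI conjI ballI)
  show "(2 / (\<beta> \<bullet> \<beta>)) *\<^sub>R \<beta> \<in> E"
    using subspace_scale[OF subspace_E \<Phi>_in_E[OF assms]] .
  fix \<gamma> assume "\<gamma> \<in> \<Phi>"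
  then have "2 * (\<beta> \<bullet> \<gamma>) / (\<beta> \<bullet> \<beta>) \<in> \<int>"
    using root_system assms unfolding root_system_def by blast
  then show "\<gamma> \<bullet> (2 / (\<beta> \<bullet> \<beta>)) *\<^sub>R \<beta> \<in> \<int>"
    by (simp add: inner_commute)
qed

lemma Z_scale_int: "x \<in> Z \<Longrightarrow> of_int k *\<^sub>R x \<in> Z"
  using subspace_scale[OF subspace_E]
  by (auto simp: coweight_lattice_def intro!: Ints_mult)

text \<open>
  Among the images of \<open>x\<close> under \<open>W\<close> and translations by \<open>q Z\<close>, take one that is nearest to an interior point
  of the dilated alcove. No reflecting hyperplane can separate the two.
\<close>

lemma exists_alcove_representative:
  assumes q: "q > 0" and x: "x \<in> Z" "regular q x"
  obtains w d where "w \<in> W" "d \<in> alcove_points q" "x - w d \<in> L q"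
proof -
  (* The height of the highest root is 11, so this point lies in the dilated alcove. *)
  define p where "p = from_coords (\<lambda>_. of_nat q / 12)"
  define R where "R = {y. \<exists>u\<in>W. y - u x \<in> L q}"
  have R_reflect: "reflect \<beta> y + z \<in> R" if y: "y \<in> R" and "\<beta> \<in> \<Phi>" "z \<in> L q" for y \<beta> z
  proof -
    obtain u where u: "u \<in> W" "y - u x \<in> L q"
      using y unfolding R_def by blast
    have "reflect \<beta> \<in> W"
      using that(2) by (rule reflect_in_W)
    then have "reflect \<beta> (y - u x) + z \<in> L q"
      using W_L u(2) L_add that(3) by blast
    then have "(reflect \<beta> y + z) - (reflect \<beta> \<circ> u) x \<in> L q"
      using linear_diff[OF W_linear[OF \<open>reflect \<beta> \<in> W\<close>], of y "u x"] by (simp add: algebra_simps)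
    then show ?thesis
      unfolding R_def using W_comp[OF \<open>reflect \<beta> \<in> W\<close> u(1)] by blast
  qed
  have R_Z: "y \<in> Z" "regular q y" if y: "y \<in> R" for y
  proof -
    obtain u where u: "u \<in> W" "y - u x \<in> L q"
      using y unfolding R_def by blast
    have "u x + (y - u x) \<in> Z" "regular q (u x + (y - u x))"
      using Z_add[OF W_Z[OF u(1) x(1)] L_subset_Z[OF u(2)]]
        regular_add_L[OF regular_W[OF u(1) x(2)] u(2)] by auto
    then show "y \<in> Z" "regular q y"
      by auto
  qed
  define S where "S = {y \<in> R. norm (y - p) \<le> norm (x - p)}"
  have "finite S"
    by (rule finite_subset[OF _ finite_Z_ball[of p "norm (x - p)"]]) (auto simp: S_def R_Z)
  moreover have "x \<in> R"
    unfolding R_def using refl_group_id L_zero by (intro CollectI bexI[of _ id]) auto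
  then have "S \<noteq> {}"
    by (auto simp: S_def)
  ultimately obtain y where y: "y \<in> S" "\<And>y'. y' \<in> S \<Longrightarrow> norm (y - p) \<le> norm (y' - p)"
    using ex_min_if_finite[of "(\<lambda>y. norm (y - p)) ` S"] by (metis (no_types, lifting) finite_imageI image_iff image_is_empty not_le)
  have yR: "y \<in> R"
    using y(1) by (simp add: S_def)
  have minimal: "norm (y - p) \<le> norm (y' - p)" if "y' \<in> R" for y'
    using y that by (cases "y' \<in> S") (auto simp: S_def)
  have no_separation: "(\<beta> \<bullet> y - of_int k * of_nat q) * (\<beta> \<bullet> p - of_int k * of_nat q) \<ge> 0"
    if \<beta>: "\<beta> \<in> \<Phi>" for \<beta> and k :: int
  proof (rule ccontr)
    let ?z = "(2 * (of_int k * of_nat q) / (\<beta> \<bullet> \<beta>)) *\<^sub>R \<beta>"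
    assume "\<not> (\<beta> \<bullet> y - of_int k * of_nat q) * (\<beta> \<bullet> p - of_int k * of_nat q) \<ge> 0"
    moreover have "\<beta> \<noteq> 0"
      using \<beta> root_system by (auto simp: root_system_def)
    ultimately have "norm (reflect \<beta> y + ?z - p) < norm (y - p)"
      by (intro affine_reflection_decreases_norm) auto
    moreover have "?z \<in> L q"
    proof -
      have "of_int k *\<^sub>R (2 / (\<beta> \<bullet> \<beta>)) *\<^sub>R \<beta> \<in> Z"
        by (intro Z_scale_int coroot_in_Z \<beta>)
      then show ?thesis
        unfolding scaled_lattice_def by (rule image_eqI[rotated]) (simp add: field_simps)
    qed
    ultimately show False
      using minimal R_reflect[OF yR \<beta>] by (meson not_le)
  qed
  have p_inner: "\<alpha> i \<bullet> p = of_nat q / 12" if "i \<in> {1..6}" for i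
    using that by (simp add: p_def simple_inner_from_coords)
  have \<theta>_p: "\<theta> \<bullet> p = 11 * of_nat q / 12"
    unfolding \<theta>_inner by (simp add: p_inner)
  have "0 < \<alpha> i \<bullet> y" if i: "i \<in> {1..6}" for i
  proof -
    have "0 \<le> (\<alpha> i \<bullet> y) * (of_nat q / 12)"
      using no_separation[OF simple_in_\<Phi>[OF i], of 0] p_inner[OF i] by simp
    then have "0 \<le> \<alpha> i \<bullet> y"
      using q by (simp add: zero_le_mult_iff)
    moreover have "\<alpha> i \<bullet> y \<noteq> of_int 0 * of_nat q"
      using R_Z(2)[OF yR] simple_in_\<Phi>[OF i] unfolding regular_def by blast
    ultimately show ?thesis
      by simp
  qed
  moreover have "\<theta> \<bullet> y < of_nat q"
  proof -
    have \<theta>: "\<theta> \<in> \<Phi>"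
      using \<theta>_in_P P_in_\<Phi> by blast
    have "0 \<le> (\<theta> \<bullet> y - of_nat q) * (11 * of_nat q / 12 - of_nat q)"
      using no_separation[OF \<theta>, of 1] by (simp add: \<theta>_p)
    then have "\<theta> \<bullet> y \<le> of_nat q"
      using q by (simp add: zero_le_mult_iff mult_le_0_iff)
    moreover have "\<theta> \<bullet> y \<noteq> of_int 1 * of_nat q"
      using R_Z(2)[OF yR] \<theta> unfolding regular_def by blast
    ultimately show ?thesis
      by simp
  qed
  ultimately have "y \<in> alcove_points q"
    using R_Z(1)[OF yR] Z_in_E by (auto simp: alcove_points_def alcove_def)
  moreover obtain u where u: "u \<in> W" "y - u x \<in> L q"
    using yR unfolding R_def by blast
  obtain v where v: "v \<in> W" "v \<circ> u = id"
    using refl_group_inverse[OF u(1)] by blast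
  have "v (y - u x) \<in> L q"
    using W_L v(1) u(2) by blast
  then have "v y - x \<in> L q"
    using v by (simp add: linear_diff[OF W_linear] fun_eq_iff)
  then have "x - v y \<in> L q"
    by (rule L_minus_commute)
  ultimately show thesis
    using that v(1) by blast
qed

lemma alcove_congruent_imp_eq:
  assumes q: "q > 0" and "x \<in> alcove (of_nat q)" "y \<in> alcove (of_nat q)" "x - y \<in> L q"
  shows "x = y"
proof (rule E_eqI)
  fix i :: nat assume i: "i \<in> {1..6}"
  obtain k :: int where k: "\<alpha> i \<bullet> (x - y) = of_int k * of_nat q"
    using L_inner[OF assms(4) simple_in_\<Phi>[OF i]] by blast
  have "\<bar>\<alpha> i \<bullet> (x - y)\<bar> < of_nat q"
    using alcove_P[OF assms(2) simple_in_P[OF i]] alcove_P[OF assms(3) simple_in_P[OF i]]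
    by (simp add: inner_diff_right)
  then have "\<bar>of_int k :: real\<bar> * of_nat q < 1 * of_nat q"
    unfolding k by (simp add: abs_mult)
  then have "\<bar>of_int k :: real\<bar> < 1"
    using q by (simp only: mult_less_cancel_right_pos of_nat_0_less_iff)
  then have "k = 0"
    by linarith
  then show "\<alpha> i \<bullet> x = \<alpha> i \<bullet> y"
    using k by (simp add: inner_diff_right)
qed (use assms in \<open>auto simp: alcove_def\<close>)

lemma card_Omega: "card Omega = 3"
proof -
  have a: "aroot 0 = - \<theta>" "aroot 1 = \<alpha> 1" "aroot 6 = \<alpha> 6"
    by (simp_all add: aroot_def)
  have "omega \<alpha> 1 (- \<theta>) = \<alpha> 1" "omega \<alpha> 6 (- \<theta>) = \<alpha> 6"
    using omega1_aroot[of 0] omega6_aroot[of 6] by (simp_all add: a)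
  moreover have "\<alpha> 1 \<noteq> \<alpha> 6"
    using simple_inj by (auto dest!: inj_onD[of _ _ 1 6])
  ultimately have "id \<noteq> omega \<alpha> 1" "id \<noteq> omega \<alpha> 6" "omega \<alpha> 1 \<noteq> omega \<alpha> 6"
    using simple_neq_lowest[of 1] simple_neq_lowest[of 6] by (metis atLeastAtMost_iff id_apply le_numeral_extra(4) one_le_numeral order_refl)+
  then show ?thesis
    by (simp add: Omega_def)
qed

text \<open>
  Two representatives \<open>(w, d)\<close> and \<open>(w\<^sub>0, d\<^sub>0)\<close> of the same coset differ by the element \<open>w\<^sub>0\<^sup>-\<^sup>1 w\<close> of the stabiliser
  of the alcove. Each of its three elements occurs, with exactly one \<open>d\<close>.
\<close>

lemma card_fibre:
  assumes q: "q > 0" and t: "t \<in> arrangement_complement E \<Phi> q"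
  shows "card {(w, d). w \<in> W \<and> d \<in> alcove_points q \<and> coset (w d) (L q) = t} = 3"
proof -
  obtain x where x: "x \<in> Z" "regular q x" "t = coset x (L q)"
    using t by (auto simp: arrangement_complement_eq)
  obtain w0 d0 where wd0: "w0 \<in> W" "d0 \<in> alcove_points q" "x - w0 d0 \<in> L q"
    using exists_alcove_representative[OF q x(1,2)] by blast
  obtain v0 where v0: "v0 \<in> W" "v0 \<circ> w0 = id" "w0 \<circ> v0 = id"
    using refl_group_inverse[OF wd0(1)] by blast
  let ?F = "{(w, d). w \<in> W \<and> d \<in> alcove_points q \<and> coset (w d) (L q) = t}"
  have F_iff: "coset (w d) (L q) = t \<longleftrightarrow> (v0 \<circ> w) d - d0 \<in> L q" for w d
  proof -
    have "t = coset (w0 d0) (L q)"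
      using wd0(3) by (simp add: x(3) coset_eq_iff)
    then have "coset (w d) (L q) = t \<longleftrightarrow> w d - w0 d0 \<in> L q"
      by (simp add: coset_eq_iff)
    also have "\<dots> \<longleftrightarrow> v0 (w d - w0 d0) \<in> L q"
      using W_L[OF v0(1), of "w d - w0 d0"] W_L[OF wd0(1), of "v0 (w d - w0 d0)"] v0(3)
      by (auto simp: fun_eq_iff)
    also have "v0 (w d - w0 d0) = (v0 \<circ> w) d - d0"
      using v0(2) by (simp add: linear_diff[OF W_linear[OF v0(1)]] fun_eq_iff)
    finally show ?thesis .
  qed
  have "bij_betw (\<lambda>(w, d). v0 \<circ> w) ?F Omega"
  proof (rule bij_betw_imageI)
    show "inj_on (\<lambda>(w, d). v0 \<circ> w) ?F"
    proof (rule inj_onI)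
      fix p p'
      assume F: "p \<in> ?F" "p' \<in> ?F" and eq: "(\<lambda>(w, d). v0 \<circ> w) p = (\<lambda>(w, d). v0 \<circ> w) p'"
      obtain w d w' d' where p: "p = (w, d)" "p' = (w', d')"
        by (cases p, cases p')
      have *: "d \<in> alcove_points q" "coset (w d) (L q) = t"
        "d' \<in> alcove_points q" "coset (w' d') (L q) = t" "v0 \<circ> w = v0 \<circ> w'"
        "w \<in> W" "w' \<in> W"
        using F eq unfolding p by (simp_all only: mem_Collect_eq case_prod_conv)
      have "w0 \<circ> (v0 \<circ> w) = w0 \<circ> (v0 \<circ> w')"
        by (simp only: *(5))
      then have ww': "w = w'"
        by (simp only: v0(3) id_comp flip: comp_assoc)
      have "(v0 \<circ> w) d - d0 \<in> L q" "(v0 \<circ> w) d' - d0 \<in> L q"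
        using * ww' by (auto simp only: F_iff)
      then have "(v0 \<circ> w) d - (v0 \<circ> w) d' \<in> L q"
        using L_diff by fastforce
      then have "w d - w d' \<in> L q"
        using W_L[OF wd0(1), of "v0 (w d) - v0 (w d')"] v0(3)
        by (simp add: linear_diff[OF W_linear[OF wd0(1)]] fun_eq_iff)
      moreover obtain v where v: "v \<in> W" "v \<circ> w = id"
        using refl_group_inverse[OF *(6)] by blast
      ultimately have "d - d' \<in> L q"
        using W_L[OF v(1), of "w d - w d'"] by (simp add: linear_diff[OF W_linear[OF v(1)]] fun_eq_iff)
      then have "d = d'"
        using * alcove_congruent_imp_eq[OF q] by (simp add: alcove_points_def)
      then show "p = p'"
        by (simp only: p ww')
    qed
    show "(\<lambda>(w, d). v0 \<circ> w) ` ?F = Omega"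
    proof (intro equalityI subsetI)
      fix u assume "u \<in> (\<lambda>(w, d). v0 \<circ> w) ` ?F"
      then obtain w d where *: "u = v0 \<circ> w" "w \<in> W" "d \<in> alcove_points q" "(v0 \<circ> w) d - d0 \<in> L q"
        by (auto simp only: F_iff)
      then show "u \<in> Omega"
        using alcove_meets_imp_Omega[OF q, of u d d0] W_comp[OF v0(1)] wd0(2) by (simp add: alcove_points_def)
    next
      fix u assume u: "u \<in> Omega"
      obtain v where v: "v \<in> Omega" "u \<circ> v = id"
        using Omega_inverse[OF u] by blast
      obtain d where d: "d \<in> alcove (of_nat q)" "v d0 - d \<in> L q"
        using Omega_alcove[OF q _ v(1), of d0] wd0(2) by (auto simp: alcove_points_def)
      have "u (d - v d0) \<in> L q"
        using W_L[OF Omega_in_W[OF u]] L_minus_commute[OF d(2)] .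
      then have "u d - d0 \<in> L q"
        using v(2) by (simp add: linear_diff[OF W_linear[OF Omega_in_W[OF u]]] fun_eq_iff)
      moreover have v0w0u: "v0 \<circ> (w0 \<circ> u) = u"
        by (simp only: v0(2) id_comp flip: comp_assoc)
      moreover have "d \<in> Z"
        using Z_diff[OF W_Z[OF Omega_in_W[OF v(1)], of d0] L_subset_Z[OF d(2)]] wd0(2)
        by (simp add: alcove_points_def)
      ultimately have "w0 \<circ> u \<in> W \<and> d \<in> alcove_points q \<and> coset ((w0 \<circ> u) d) (L q) = t"
        using W_comp[OF wd0(1) Omega_in_W[OF u]] d(1)
        by (simp only: F_iff alcove_points_def Int_iff simp_thms)
      then have "(w0 \<circ> u, d) \<in> ?F"
        by blast
      then show "u \<in> (\<lambda>(w, d). v0 \<circ> w) ` ?F"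
        by (rule image_eqI[rotated]) (subst case_prod_conv, rule v0w0u[symmetric])
    qed
  qed
  from bij_betw_same_card[OF this] show ?thesis
    by (simp only: card_Omega)
qed

lemma card_complement_eq_card_W_alcove:
  assumes q: "q > 0" and fin: "finite (alcove_points q)"
  shows "card W * card (alcove_points q) = 3 * card (arrangement_complement E \<Phi> q)"
proof -
  let ?M = "arrangement_complement E \<Phi> q"
  let ?f = "\<lambda>(w, d). coset (w d) (L q)"
  have image: "?f ` (W \<times> alcove_points q) = ?M"
  proof (intro equalityI subsetI)
    fix t assume "t \<in> ?f ` (W \<times> alcove_points q)"
    then obtain w d where "w \<in> W" "d \<in> alcove_points q" "t = coset (w d) (L q)"
      by auto
    then show "t \<in> ?M"
      using W_Z regular_W regular_alcove by (auto simp: arrangement_complement_eq alcove_points_def)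
  next
    fix t assume "t \<in> ?M"
    then obtain x where x: "x \<in> Z" "regular q x" "t = coset x (L q)"
      by (auto simp: arrangement_complement_eq)
    then obtain w d where "w \<in> W" "d \<in> alcove_points q" "x - w d \<in> L q"
      using exists_alcove_representative[OF q] by metis
    then show "t \<in> ?f ` (W \<times> alcove_points q)"
      by (intro image_eqI[of _ _ "(w, d)"]) (auto simp: x(3) coset_eq_iff)
  qed
  have finM: "finite ?M"
    unfolding image[symmetric] using fin finite_W by blast
  have "card (W \<times> alcove_points q) = (\<Sum>p\<in>W \<times> alcove_points q. 1 :: nat)"
    by simp
  also have "\<dots> = (\<Sum>t\<in>?M. \<Sum>p\<in>{p \<in> W \<times> alcove_points q. ?f p = t}. 1 :: nat)"
    using fin finite_W finM image by (intro sum.group[symmetric]) auto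
  also have "\<dots> = (\<Sum>t\<in>?M. 3)"
  proof (rule sum.cong[OF refl])
    fix t assume t: "t \<in> ?M"
    have "{p \<in> W \<times> alcove_points q. ?f p = t}
      = {(w, d). w \<in> W \<and> d \<in> alcove_points q \<and> coset (w d) (L q) = t}"
      by auto
    then show "(\<Sum>p\<in>{p \<in> W \<times> alcove_points q. ?f p = t}. 1 :: nat) = 3"
      using card_fibre[OF q t] by simp
  qed
  finally show ?thesis
    by (simp add: card_cartesian_product)
qed

end

section \<open>Counting positive solutions of a linear equation\<close>

definition sols :: "nat list \<Rightarrow> nat \<Rightarrow> nat list set" where
  "sols ns q = {c. length c = length ns \<and> 0 \<notin> set c \<and> sum_list (map2 (*) ns c) = q}"

lemma sols_Nil: "sols [] q = (if q = 0 then {[]} else {})"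
  by (auto simp: sols_def)

lemma Cons_in_sols:
  "c \<in> sols (n # ns) q \<longleftrightarrow> (\<exists>x xs. c = x # xs \<and> 0 < x \<and> n * x \<le> q \<and> xs \<in> sols ns (q - n * x))"
  by (cases c) (auto simp: sols_def)

lemma sols_Cons_small: "q < n \<Longrightarrow> sols (n # ns) q = {}"
  by (auto simp: Cons_in_sols) (metis leD less_le_trans mult_le_mono2 mult.right_neutral Suc_leI One_nat_def)

lemma sols_zero: "n > 0 \<Longrightarrow> sols (n # ns) 0 = {}"
  by (rule sols_Cons_small)

text \<open>
  The first entry of a solution is either 1 or can be lowered by 1.
\<close>

lemma sols_Cons_add:
  assumes "n > 0"
  shows "sols (n # ns) (q + n) = (#) 1 ` sols ns q \<union> (\<lambda>c. Suc (hd c) # tl c) ` sols (n # ns) q"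
    (is "?A = ?B \<union> ?C")
proof (intro equalityI subsetI)
  fix c assume "c \<in> ?A"
  then obtain x xs where c: "c = x # xs" "0 < x" "n * x \<le> q + n" "xs \<in> sols ns (q + n - n * x)"
    by (auto simp: Cons_in_sols)
  show "c \<in> ?B \<union> ?C"
  proof (cases "x = 1")
    case True
    then show ?thesis
      using c by simp
  next
    case False
    then obtain y where y: "x = Suc y" "0 < y"
      using c(2) by (cases x) (auto simp: One_nat_def)
    then have "y # xs \<in> sols (n # ns) q"
      using c by (auto simp: Cons_in_sols)
    then show ?thesis
      using c(1) y by (intro UnI2 image_eqI[of _ _ "y # xs"]) auto
  qed
next
  fix c assume "c \<in> ?B \<union> ?C"
  then show "c \<in> ?A"
    by (auto simp: Cons_in_sols)
qed

lemma finite_sols: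
  assumes "0 \<notin> set ns"
  shows "finite (sols ns q)"
  using assms
proof (induction ns arbitrary: q)
  case Nil
  then show ?case
    by (simp add: sols_Nil)
next
  case (Cons n ns)
  show ?case
  proof (induction q rule: less_induct)
    case (less q)
    show ?case
    proof (cases "q < n")
      case False
      then have "sols (n # ns) (q - n + n)
          = (#) 1 ` sols ns (q - n) \<union> (\<lambda>c. Suc (hd c) # tl c) ` sols (n # ns) (q - n)"
        using Cons.prems by (intro sols_Cons_add) auto
      moreover have "finite (sols (n # ns) (q - n))"
        using False Cons.prems by (intro less) auto
      ultimately show ?thesis
        using Cons False by simp
    qed (simp add: sols_Cons_small)
  qed
qed

lemma card_sols_Cons_add:
  assumes "0 \<notin> set (n # ns)"
  shows "card (sols (n # ns) (q + n)) = card (sols ns q) + card (sols (n # ns) q)"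
proof -
  have "inj_on (\<lambda>c. Suc (hd c) # tl c) (sols (n # ns) q)"
    by (rule inj_onI) (auto simp: Cons_in_sols)
  moreover have "(#) 1 ` sols ns q \<inter> (\<lambda>c. Suc (hd c) # tl c) ` sols (n # ns) q = {}"
    by (auto simp: Cons_in_sols)
  ultimately show ?thesis
    using assms finite_sols[OF assms, of q] finite_sols[of ns q]
    by (simp add: sols_Cons_add card_Un_disjoint card_image)
qed

text \<open>
  The recursion of \<open>card_sols_Cons_add\<close> has step \<open>n\<close>, and there is no solution when \<open>0 < q \<le> n\<close>. A function
  with these two properties is the counting function, up to the common denominator.
\<close>

lemma card_sols_closed_form_step:
  fixes g h :: "nat \<Rightarrow> int"
  assumes "0 \<notin> set (n # m # ns)"
    and g: "\<And>q. 0 < q \<Longrightarrow> d * int (card (sols (m # ns) q)) = g q"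
    and h0: "\<And>q. 0 < q \<Longrightarrow> q \<le> n \<Longrightarrow> h q = 0"
    and h: "\<And>q. 0 < q \<Longrightarrow> h (q + n) = h q + e * g q"
    and D: "D = d * e" and "0 < q"
  shows "D * int (card (sols (n # m # ns) q)) = h q"
  using \<open>0 < q\<close>
  unfolding D
proof (induction q rule: less_induct)
  case (less q)
  have rec: "card (sols (n # m # ns) (k + n)) = card (sols (m # ns) k) + card (sols (n # m # ns) k)" for k
    using assms(1) by (rule card_sols_Cons_add)
  consider "q < n" | "q = n" | k where "0 < k" "q = k + n"
    by (metis add.commute gr_zeroI le_add_diff_inverse less_diff_conv linorder_cases nat_less_le add_0)
  then show ?case
  proof cases
    case 1
    then show ?thesis
      using less.prems h0 by (simp add: sols_Cons_small)
  next
    case 2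
    then show ?thesis
      using rec[of 0] assms(1) h0[of q] less.prems by (simp add: sols_zero)
  next
    case 3
    have "d * e * int (card (sols (n # m # ns) k)) = h k"
      using less.IH[of k] 3 assms(1) by auto
    then show ?thesis
      using g[OF 3(1)] h[OF 3(1)] rec[of k] by (simp add: 3(2) algebra_simps)
  qed
qed

lemma card_sols_1:
  assumes "0 < q" shows "1 * int (card (sols [1] q)) = 1"
proof -
  have "sols [1] q = {[q]}"
    using assms by (auto simp: Cons_in_sols sols_Nil split: if_splits)
  then show ?thesis
    by simp
qed

lemma small_index_cases:
  assumes "0 < q" "q \<le> (3::nat)"
  obtains "q = 1" | "q = 2" | "q = 3"
  using assms by force

lemma power_expand:
  fixes x :: int
  shows "x ^ 2 = x * x" "x ^ 3 = x * x * x" "x ^ 4 = x * x * x * x" "x ^ 5 = x * x * x * x * x"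
    "x ^ 6 = x * x * x * x * x * x"
  by (simp_all add: numeral_eq_Suc mult.assoc)

text \<open>
  The functions \<open>sols4\<close> to \<open>sols7\<close> are the counting quasi-polynomials for the weights 2, 1, 1, 1
  and so on up to 3, 2, 2, 2, 1, 1, 1, multiplied by the denominators 24, 96, 1920 and 17280.
\<close>

definition sols4 :: "nat \<Rightarrow> int" where
  "sols4 q = 2 * int q ^ 3 - 15 * int q ^ 2 + 34 * int q - (if even q then 24 else 21)"

definition sols5 :: "nat \<Rightarrow> int" where
  "sols5 q = int q ^ 4 - 14 * int q ^ 3 + 68 * int q ^ 2
     - (if even q then 136 else 130) * int q + (if even q then 96 else 75)"

definition sols6 :: "nat \<Rightarrow> int" where
  "sols6 q = 2 * int q ^ 5 - 45 * int q ^ 4 + 380 * int q ^ 3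
     - (if even q then 1500 else 1470) * int q ^ 2 + (if even q then 2768 else 2498) * int q
     - (if even q then 1920 else 1365)"

definition sols7 :: "nat \<Rightarrow> int" where
  "sols7 q = int q ^ 6 - 36 * int q ^ 5 + 510 * int q ^ 4 - 3600 * int q ^ 3
     + (if even q then 13224 else 13089) * int q ^ 2 - (if even q then 23904 else 22284) * int q
     + (if even q then 16640 else 12320) + (if 3 dvd q then 640 else 0)"

lemma card_sols_2: "0 < q \<Longrightarrow> 1 * int (card (sols [1, 1] q)) = int q - 1"
  by (rule card_sols_closed_form_step[where d = 1 and e = 1 and g = "\<lambda>_. 1"])
    (rule card_sols_1 | simp)+

lemma card_sols_3: "0 < q \<Longrightarrow> 2 * int (card (sols [1, 1, 1] q)) = (int q - 1) * (int q - 2)"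
proof -
  have zero: "(int q - 1) * (int q - 2) = 0" if "0 < q" "q \<le> 1" for q
    using that by (elim small_index_cases[of q]) simp_all
  have rec: "(int (q + 1) - 1) * (int (q + 1) - 2) = (int q - 1) * (int q - 2) + 2 * (int q - 1)" for q
    by (simp add: algebra_simps)
  show "0 < q \<Longrightarrow> 2 * int (card (sols [1, 1, 1] q)) = (int q - 1) * (int q - 2)"
    by (rule card_sols_closed_form_step[where d = 1 and e = 2 and g = "\<lambda>q. int q - 1"])
      (rule card_sols_2 zero rec | assumption | simp)+
qed

lemma card_sols_4: "0 < q \<Longrightarrow> 24 * int (card (sols [2, 1, 1, 1] q)) = sols4 q"
proof -
  have zero: "sols4 q = 0" if "0 < q" "q \<le> 2" for q
    using that by (elim small_index_cases[of q]) (simp_all add: sols4_def)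
  have rec: "sols4 (q + 2) = sols4 q + 12 * ((int q - 1) * (int q - 2))" for q
    by (cases "even q") (simp_all add: sols4_def power_expand algebra_simps)
  show "0 < q \<Longrightarrow> 24 * int (card (sols [2, 1, 1, 1] q)) = sols4 q"
    by (rule card_sols_closed_form_step[where d = 2 and e = 12 and g = "\<lambda>q. (int q - 1) * (int q - 2)"])
      (rule card_sols_3 zero rec | assumption | simp)+
qed

lemma card_sols_5: "0 < q \<Longrightarrow> 96 * int (card (sols [2, 2, 1, 1, 1] q)) = sols5 q"
proof -
  have zero: "sols5 q = 0" if "0 < q" "q \<le> 2" for q
    using that by (elim small_index_cases[of q]) (simp_all add: sols5_def)
  have rec: "sols5 (q + 2) = sols5 q + 4 * sols4 q" for q
    by (cases "even q") (simp_all add: sols4_def sols5_def power_expand algebra_simps)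
  show "0 < q \<Longrightarrow> 96 * int (card (sols [2, 2, 1, 1, 1] q)) = sols5 q"
    by (rule card_sols_closed_form_step[where d = 24 and e = 4 and g = sols4])
      (rule card_sols_4 zero rec | assumption | simp)+
qed

lemma card_sols_6: "0 < q \<Longrightarrow> 1920 * int (card (sols [2, 2, 2, 1, 1, 1] q)) = sols6 q"
proof -
  have zero: "sols6 q = 0" if "0 < q" "q \<le> 2" for q
    using that by (elim small_index_cases[of q]) (simp_all add: sols6_def)
  have rec: "sols6 (q + 2) = sols6 q + 20 * sols5 q" for q
    by (cases "even q") (simp_all add: sols5_def sols6_def power_expand algebra_simps)
  show "0 < q \<Longrightarrow> 1920 * int (card (sols [2, 2, 2, 1, 1, 1] q)) = sols6 q"
    by (rule card_sols_closed_form_step[where d = 96 and e = 20 and g = sols5])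
      (rule card_sols_5 zero rec | assumption | simp)+
qed

lemma card_sols_7: "0 < q \<Longrightarrow> 17280 * int (card (sols [3, 2, 2, 2, 1, 1, 1] q)) = sols7 q"
proof -
  have zero: "sols7 q = 0" if "0 < q" "q \<le> 3" for q
    using that by (elim small_index_cases[of q]) (simp_all add: sols7_def)
  have rec: "sols7 (q + 3) = sols7 q + 9 * sols6 q" for q
    by (cases "even q") (simp_all add: sols6_def sols7_def power_expand algebra_simps)
  show "0 < q \<Longrightarrow> 17280 * int (card (sols [3, 2, 2, 2, 1, 1, 1] q)) = sols7 q"
    by (rule card_sols_closed_form_step[where d = 1920 and e = 9 and g = sols6])
      (rule card_sols_6 zero rec | assumption | simp)+
qed


section \<open>Residue vectors off the root hyperplanes\<close>

definition residue_vectors :: "nat \<Rightarrow> (nat \<Rightarrow> int) set" where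
  "residue_vectors q = (\<Pi>\<^sub>E i\<in>{1..6}. {0..<int q})"

definition pair :: "int list \<Rightarrow> (nat \<Rightarrow> int) \<Rightarrow> int" where
  "pair k c = (\<Sum>i=1..6. k ! (i - 1) * c i)"

definition regular_residues :: "nat \<Rightarrow> (nat \<Rightarrow> int) set" where
  "regular_residues q = {c \<in> residue_vectors q. \<forall>k\<in>set pos_coords. \<not> int q dvd pair k c}"

lemma finite_residue_vectors: "finite (residue_vectors q)"
  by (simp add: residue_vectors_def finite_PiE)

lemma card_residue_vectors: "card (residue_vectors q) = q ^ 6"
  by (simp add: residue_vectors_def card_PiE)

lemma residues_cong_imp_eq:
  fixes x y :: int
  assumes "x \<in> {0..<n}" "y \<in> {0..<n}" "n dvd x - y"
  shows "x = y"
  using assms by (auto simp: mod_eq_dvd_iff[symmetric])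

text \<open>
  Some coefficient of the root is 1, and that coordinate is determined by the other five.
\<close>

lemma card_root_hyperplane:
  assumes "k \<in> set pos_coords"
  shows "card {c \<in> residue_vectors q. int q dvd pair k c} \<le> q ^ 5"
proof -
  obtain j where j: "j \<in> {1..6}" "k ! (j - 1) = 1"
    using pos_coords_basic(6)[OF assms] by blast
  let ?I = "{1..6} - {j}"
  let ?H = "{c \<in> residue_vectors q. int q dvd pair k c}"
  have "inj_on (\<lambda>c. restrict c ?I) ?H"
  proof (rule inj_onI)
    fix c c' assume c: "c \<in> ?H" "c' \<in> ?H" "restrict c ?I = restrict c' ?I"
    have off_j: "c i = c' i" if "i \<in> ?I" for i
      using fun_cong[OF c(3), of i] that by simp
    have "int q dvd pair k c - pair k c'"
      using c by (intro dvd_diff) auto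
    also have "pair k c - pair k c' = (\<Sum>i=1..6. k ! (i - 1) * (c i - c' i))"
      by (simp add: pair_def right_diff_distrib sum_subtractf)
    also have "\<dots> = (\<Sum>i=1..6. if i = j then c j - c' j else 0)"
      using off_j j by (intro sum.cong) auto
    finally have "int q dvd c j - c' j"
      using j by simp
    then have "c j = c' j"
      using c j by (intro residues_cong_imp_eq[of _ "int q"]) (auto simp: residue_vectors_def)
    show "c = c'"
    proof
      fix i
      show "c i = c' i"
      proof (cases "i \<in> {1..6}")
        case True
        then show ?thesis
          using off_j \<open>c j = c' j\<close> by (cases "i = j") auto
      next
        case False
        have "c \<in> (\<Pi>\<^sub>E i\<in>{1..6}. {0..<int q})" "c' \<in> (\<Pi>\<^sub>E i\<in>{1..6}. {0..<int q})"
          using c by (simp_all add: residue_vectors_def)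
        then show ?thesis
          using PiE_arb[OF _ False] by metis
      qed
    qed
  qed
  moreover have "(\<lambda>c. restrict c ?I) ` ?H \<subseteq> (\<Pi>\<^sub>E i\<in>?I. {0..<int q})"
  proof (rule image_subsetI)
    fix c assume "c \<in> ?H"
    then have "c \<in> (\<Pi>\<^sub>E i\<in>{1..6}. {0..<int q})"
      by (simp add: residue_vectors_def)
    then have "c i \<in> {0..<int q}" if "i \<in> ?I" for i
      using PiE_mem[of c "{1..6}" _ i] that by blast
    then show "restrict c ?I \<in> (\<Pi>\<^sub>E i\<in>?I. {0..<int q})"
      by (subst restrict_PiE_iff) blast
  qed
  ultimately have "card ?H \<le> card (\<Pi>\<^sub>E i\<in>?I. {0..<int q})"
    by (intro card_inj_on_le) (auto intro: finite_PiE)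
  also have "\<dots> = q ^ 5"
    using j(1) by (simp add: card_PiE)
  finally show ?thesis .
qed

lemma card_regular_residues_bounds:
  "card (regular_residues q) \<le> q ^ 6" "q ^ 6 \<le> card (regular_residues q) + 36 * q ^ 5"
proof -
  let ?H = "\<lambda>k. {c \<in> residue_vectors q. int q dvd pair k c}"
  have "card (regular_residues q) \<le> card (residue_vectors q)"
    by (intro card_mono finite_residue_vectors) (auto simp: regular_residues_def)
  then show "card (regular_residues q) \<le> q ^ 6"
    by (simp add: card_residue_vectors)
  have "q ^ 6 = card (regular_residues q \<union> (\<Union>k\<in>set pos_coords. ?H k))"
    unfolding card_residue_vectors[symmetric] regular_residues_def
    by (intro arg_cong[of _ _ card]) blast
  also have "\<dots> \<le> card (regular_residues q) + card (\<Union>k\<in>set pos_coords. ?H k)"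
    by (rule card_Un_le)
  also have "card (\<Union>k\<in>set pos_coords. ?H k) \<le> (\<Sum>k\<in>set pos_coords. card (?H k))"
    by (intro card_UN_le) simp
  also have "\<dots> \<le> (\<Sum>k\<in>set pos_coords. q ^ 5)"
    by (intro sum_mono card_root_hyperplane)
  also have "\<dots> = card (set pos_coords) * q ^ 5"
    by simp
  also have "\<dots> \<le> 36 * q ^ 5"
    using card_length[of pos_coords] by (intro mult_le_mono1) (simp add: pos_coords_def)
  finally show "q ^ 6 \<le> card (regular_residues q) + 36 * q ^ 5"
    by simp
qed

section \<open>Residue vectors fixed by the rotation of the extended diagram\<close>

text \<open>
  The triple \<open>(a, b, c)\<close> represents the point at which \<open>\<alpha>\<^sub>1, \<alpha>\<^sub>6\<close> take the value \<open>a\<close>, the roots \<open>\<alpha>\<^sub>2, \<alpha>\<^sub>3, \<alpha>\<^sub>5\<close> the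
  value \<open>b\<close>, and \<open>\<alpha>\<^sub>4\<close> the value \<open>c\<close>. The divisibility condition says that \<open>-\<theta>\<close> takes the value \<open>a\<close> modulo \<open>q\<close>.
\<close>

definition fixed_triples :: "nat \<Rightarrow> (int \<times> int \<times> int) set" where
  "fixed_triples q = {(a, b, c). a \<in> {0..<int q} \<and> b \<in> {0..<int q} \<and> c \<in> {0..<int q} \<and>
     int q dvd 3 * (a + 2 * b + c) \<and>
     (\<forall>k\<in>set pos_coords. \<not> int q dvd (k ! 0 + k ! 5) * a + (k ! 1 + k ! 2 + k ! 4) * b + k ! 3 * c)}"

definition fold_coord :: "int list \<Rightarrow> int \<times> int \<times> int" where
  "fold_coord k = (k ! 0 + k ! 5, k ! 1 + k ! 2 + k ! 4, k ! 3)"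

lemma fold_pos_coords:
  "set (map fold_coord pos_coords) = set [(0, 0, 1), (0, 1, 0), (0, 1, 1), (0, 2, 1), (0, 3, 1), (0, 3, 2),
     (1, 0, 0), (1, 1, 0), (1, 1, 1), (1, 2, 1), (1, 3, 1), (1, 3, 2), (1, 4, 2), (2, 2, 1), (2, 3, 1),
     (2, 3, 2), (2, 4, 2), (2, 5, 2), (2, 5, 3), (2, 6, 3)]"
  by code_simp

lemma regular_triple_explicit:
  fixes a b c q :: int
  shows "(\<forall>k\<in>set pos_coords. \<not> q dvd (k ! 0 + k ! 5) * a + (k ! 1 + k ! 2 + k ! 4) * b + k ! 3 * c) \<longleftrightarrow>
    (\<forall>f\<in>{c, b, b + c, 2*b + c, 3*b + c, 3*b + 2*c, a, a + b, a + b + c, a + 2*b + c, a + 3*b + c,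
       a + 3*b + 2*c, a + 4*b + 2*c, 2*a + 2*b + c, 2*a + 3*b + c, 2*a + 3*b + 2*c, 2*a + 4*b + 2*c,
       2*a + 5*b + 2*c, 2*a + 5*b + 3*c, 2*a + 6*b + 3*c}. \<not> q dvd f)"
proof -
  have "(\<forall>k\<in>set pos_coords. \<not> q dvd (k ! 0 + k ! 5) * a + (k ! 1 + k ! 2 + k ! 4) * b + k ! 3 * c) \<longleftrightarrow>
    (\<forall>(x, y, z)\<in>set (map fold_coord pos_coords). \<not> q dvd x * a + y * b + z * c)"
    by (simp add: fold_coord_def)
  then show ?thesis
    unfolding fold_pos_coords by simp
qed

text \<open>
  As \<open>s\<close> is divisible by \<open>m\<close> but not by \<open>3 m\<close>, one of \<open>x\<close>, \<open>s - x\<close> and \<open>s + x\<close> is divisible by \<open>3 m\<close> as soon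
  as \<open>x\<close> is divisible by \<open>m\<close>. For \<open>x\<close> among \<open>b\<close>, \<open>b + c\<close> and
  \<open>2 b + c\<close> all three are values of roots, so the condition on these \<open>x\<close> is one modulo \<open>m\<close>. The
  remaining values of roots are some \<open>2 s - x\<close> and \<open>2 s + x\<close> with the same \<open>x\<close>, which that condition keeps
  nonzero as well, \<open>s\<close>, \<open>2 s\<close>, and the three forms \<open>c\<close>, \<open>3 b + c\<close> and \<open>3 b + 2 c\<close>.
\<close>

lemma regular_triple_iff_G2:
  fixes a b c m :: int
  assumes m: "m > 0" and s: "s = a + 2 * b + c" "m dvd s" "\<not> 3 * m dvd s"
  shows "(\<forall>k\<in>set pos_coords. \<not> 3 * m dvd (k ! 0 + k ! 5) * a + (k ! 1 + k ! 2 + k ! 4) * b + k ! 3 * c) \<longleftrightarrow>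
    \<not> m dvd b \<and> \<not> m dvd b + c \<and> \<not> m dvd 2 * b + c \<and>
    \<not> 3 * m dvd c \<and> \<not> 3 * m dvd 3 * b + c \<and> \<not> 3 * m dvd 3 * b + 2 * c"
    (is "?L \<longleftrightarrow> ?R")
proof
  have short: "\<not> m dvd x" if "\<not> 3 * m dvd x" "\<not> 3 * m dvd s - x" "\<not> 3 * m dvd s + x" for x
  proof
    assume "m dvd x"
    then obtain u t where ut: "x = m * u" "s = m * t"
      using s(2) by (auto elim!: dvdE)
    have scale: "3 * m dvd m * n \<longleftrightarrow> 3 dvd n" for n
      using m by (simp add: mult.commute[of 3])
    have "\<not> 3 dvd u" "\<not> 3 dvd t - u" "\<not> 3 dvd t + u" "\<not> 3 dvd t"
      using that s(3) unfolding ut by (simp_all only: scale simp_thms flip: right_diff_distrib distrib_left)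
    then show False
      by presburger
  qed
  assume ?L
  note L = this[unfolded regular_triple_explicit]
  have "\<not> m dvd b"
    using L by (intro short) (simp_all add: s(1) algebra_simps)
  moreover have "\<not> m dvd b + c"
    using L by (intro short) (simp_all add: s(1) algebra_simps)
  moreover have "\<not> m dvd 2 * b + c"
    using L by (intro short) (simp_all add: s(1) algebra_simps)
  ultimately show ?R
    using L by simp
next
  assume R: ?R
  have reduce: "\<not> 3 * m dvd f" if "\<not> m dvd x" "f = i * s + x \<or> f = i * s - x" for f x i
  proof
    assume "3 * m dvd f"
    then have "m dvd f"
      by (rule dvd_mult_right)
    moreover have "m dvd i * s"
      using s(2) by simp
    ultimately have "m dvd f - i * s" "m dvd i * s - f"
      by (auto intro: dvd_diff)
    then show False
      using that by auto
  qed
  have twice_s: "\<not> 3 * m dvd 2 * s"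
  proof -
    obtain t where t: "s = m * t"
      using s(2) by blast
    have "\<not> 3 dvd t"
      using s(3) m by (simp add: t mult.commute[of 3])
    then have "\<not> 3 dvd 2 * t"
      by presburger
    then show ?thesis
      using m unfolding t by (simp add: mult.commute[of 3] mult.left_commute[of 2])
  qed
  define multiples where "multiples x = {x, s - x, s + x, 2 * s - x, 2 * s + x}" for x
  have short: "\<not> 3 * m dvd f" if "\<not> m dvd x" "f \<in> multiples x" for f x
    using that reduce[of x f 0] reduce[of x f 1] reduce[of x f 2] by (auto simp: multiples_def)
  have "{c, b, b + c, 2*b + c, 3*b + c, 3*b + 2*c, a, a + b, a + b + c, a + 2*b + c, a + 3*b + c,
       a + 3*b + 2*c, a + 4*b + 2*c, 2*a + 2*b + c, 2*a + 3*b + c, 2*a + 3*b + 2*c, 2*a + 4*b + 2*c,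
       2*a + 5*b + 2*c, 2*a + 5*b + 3*c, 2*a + 6*b + 3*c}
     \<subseteq> {s, 2 * s, c, 3 * b + c, 3 * b + 2 * c} \<union> (multiples b \<union> multiples (b + c) \<union> multiples (2 * b + c))"
      (is "?F \<subseteq> ?A \<union> ?B")
    by (simp add: multiples_def s(1))
  moreover have "\<forall>f\<in>?A. \<not> 3 * m dvd f"
    using R s(3) twice_s by simp
  moreover have "\<forall>f\<in>?B. \<not> 3 * m dvd f"
    using R short by (metis UnE)
  ultimately have "\<forall>f\<in>?F. \<not> 3 * m dvd f"
    by (meson UnE subsetD)
  then show ?L
    unfolding regular_triple_explicit .
qed


lemma card_residue_class:
  fixes m b :: int
  assumes "m > 0"
  shows "card {y \<in> {0..<int k * m}. m dvd y + b} = k"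
proof -
  define r where "r = (- b) mod m"
  have r: "0 \<le> r" "r < m" "m dvd r + b"
    using assms by (auto simp: r_def mod_eq_dvd_iff[symmetric] dvd_eq_mod_eq_0 mod_simps)
  have "bij_betw (\<lambda>j. r + m * int j) {..<k} {y \<in> {0..<int k * m}. m dvd y + b}"
  proof (rule bij_betw_imageI)
    show "inj_on (\<lambda>j. r + m * int j) {..<k}"
      using assms by (auto simp: inj_on_def)
    show "(\<lambda>j. r + m * int j) ` {..<k} = {y \<in> {0..<int k * m}. m dvd y + b}"
    proof (intro equalityI subsetI)
      fix y assume "y \<in> (\<lambda>j. r + m * int j) ` {..<k}"
      then obtain j where j: "j < k" "y = r + m * int j"
        by blast
      have "m * int j + m \<le> int k * m"
        using j(1) assms mult_left_mono[of "int j + 1" "int k" m] by (simp add: algebra_simps)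
      moreover have "m dvd (r + b) + m * int j"
        using r(3) by simp
      ultimately show "y \<in> {y \<in> {0..<int k * m}. m dvd y + b}"
        using r assms j(2) by (auto simp: algebra_simps)
    next
      fix y assume y: "y \<in> {y \<in> {0..<int k * m}. m dvd y + b}"
      have "m dvd (y + b) - (r + b)"
        using y r(3) by (intro dvd_diff) auto
      then obtain t where t: "y - r = m * t"
        by (auto elim: dvdE)
      have "0 \<le> y" "y < m * int k"
        using y by (auto simp: algebra_simps)
      then have "m * (- 1) < m * t" "m * t < m * int k"
        using r t by linarith+
      then have "- 1 < t" "t < int k"
        using mult_less_cancel_left_pos[OF assms] by blast+
      then show "y \<in> (\<lambda>j. r + m * int j) ` {..<k}"
        using t by (intro image_eqI[of _ _ "nat t"]) (auto simp: algebra_simps)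
    qed
  qed
  then show ?thesis
    using bij_betw_same_card by fastforce
qed

lemma card_filter_not:
  assumes "finite A"
  shows "int (card {x \<in> A. \<not> Q x}) = int (card A) - int (card {x \<in> A. Q x})"
proof -
  have "{x \<in> A. Q x} \<union> {x \<in> A. \<not> Q x} = A"
    by blast
  then have "card A = card {x \<in> A. Q x} + card {x \<in> A. \<not> Q x}"
    using assms card_Un_disjoint[of "{x \<in> A. Q x}" "{x \<in> A. \<not> Q x}"] by auto
  then show ?thesis
    by simp
qed

lemma dvd_combination:
  fixes d x y z :: int
  assumes "d dvd x" "d dvd y" "z = i * x + j * y"
  shows "d dvd z"
  using assms by simp

text \<open>
  The linear forms are the positive roots of type \<open>G\<^sub>2\<close> with short simple root \<open>b\<close> and long simple root \<open>c\<close>.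
  Short roots are considered modulo \<open>m\<close> and long ones modulo \<open>3 m\<close>.
\<close>

definition G2_regular :: "int \<Rightarrow> (int \<times> int) set" where
  "G2_regular m = {(b, c). b \<in> {0..<3 * m} \<and> c \<in> {0..<3 * m} \<and>
     \<not> m dvd b \<and> \<not> m dvd b + c \<and> \<not> m dvd 2 * b + c \<and>
     \<not> 3 * m dvd c \<and> \<not> 3 * m dvd 3 * b + c \<and> \<not> 3 * m dvd 3 * b + 2 * c}"

text \<open>
  Modulo \<open>3 m\<close>, the forms \<open>b + c\<close> and \<open>2 b + c\<close> exclude three values of \<open>c\<close> each, and \<open>c\<close> and \<open>3 b + c\<close> exclude
  one each. These eight values are distinct unless \<open>m\<close> divides \<open>2 b\<close>; then the last two are among
  the first six.
\<close>

lemma card_G2_fibre: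
  fixes m b :: int
  assumes m: "m > 0" and b: "\<not> m dvd b"
  shows "int (card {c \<in> {0..<3 * m}. \<not> m dvd b + c \<and> \<not> m dvd 2 * b + c \<and>
      \<not> 3 * m dvd c \<and> \<not> 3 * m dvd 3 * b + c}) = (if m dvd 2 * b then 3 * m - 6 else 3 * m - 8)"
proof -
  let ?R = "{0..<3 * m}"
  define A1 where "A1 = {c \<in> ?R. m dvd c + b}"
  define A2 where "A2 = {c \<in> ?R. m dvd c + 2 * b}"
  define A3 where "A3 = {c \<in> ?R. 3 * m dvd c + 0}"
  define A4 where "A4 = {c \<in> ?R. 3 * m dvd c + 3 * b}"
  note defs = A1_def A2_def A3_def A4_def
  have cards: "card A1 = 3" "card A2 = 3" "card A3 = 1" "card A4 = 1"
    using card_residue_class[OF m, of 3 b] card_residue_class[OF m, of 3 "2 * b"]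
      card_residue_class[of "3 * m" 1 0] card_residue_class[of "3 * m" 1 "3 * b"] m
    by (simp_all add: defs)
  have fin: "finite A1" "finite A2" "finite A3" "finite A4"
    unfolding defs by (rule finite_subset[of _ ?R], blast, simp)+
  have weaken: "m dvd x" if "3 * m dvd x" for x
    using that by (rule dvd_mult_right)
  have disj: "A1 \<inter> A2 = {}"
    using b dvd_combination[of m "_ + b" "_ + 2 * b" b "- 1" 1] by (auto simp: defs)
  have disj': "A3 \<inter> A4 = {}"
  proof -
    have "\<not> 3 * m dvd 3 * b"
      using b by simp
    then show ?thesis
      using dvd_combination[of "3 * m" _ "_ + 3 * b" "3 * b" "- 1" 1] by (auto simp: defs)
  qed
  have union: "{c \<in> ?R. \<not> m dvd b + c \<and> \<not> m dvd 2 * b + c \<and> \<not> 3 * m dvd c \<and> \<not> 3 * m dvd 3 * b + c}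
      = ?R - (A1 \<union> A2 \<union> (A3 \<union> A4))"
    by (auto simp: defs add.commute)
  have sub: "A1 \<union> A2 \<union> (A3 \<union> A4) \<subseteq> ?R"
    by (auto simp: defs)
  have "card (A1 \<union> A2 \<union> (A3 \<union> A4)) = (if m dvd 2 * b then 6 else 8)"
  proof (cases "m dvd 2 * b")
    case True
    have "A3 \<subseteq> A2"
      using True weaken by (auto simp: defs)
    moreover have "A4 \<subseteq> A1"
    proof
      fix c assume "c \<in> A4"
      then have "c \<in> ?R" "m dvd c + 3 * b"
        using weaken by (auto simp: defs)
      then show "c \<in> A1"
        using dvd_combination[OF _ True, of "c + 3 * b" "c + b" 1 "- 1"] by (simp add: defs)
    qed
    ultimately have "A1 \<union> A2 \<union> (A3 \<union> A4) = A1 \<union> A2"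
      by blast
    then show ?thesis
      using True cards fin disj by (simp add: card_Un_disjoint)
  next
    case False
    have "c \<notin> A3" "c \<notin> A4" if "c \<in> A1" for c
    proof -
      have c: "m dvd c + b"
        using that by (simp add: defs)
      show "c \<notin> A3"
        using c b weaken[of c] dvd_combination[of m c "c + b" b "- 1" 1] by (auto simp: defs)
      show "c \<notin> A4"
        using c False weaken[of "c + 3 * b"] dvd_combination[of m "c + 3 * b" "c + b" "2 * b" 1 "- 1"]
        by (auto simp: defs)
    qed
    moreover have "c \<notin> A3" "c \<notin> A4" if "c \<in> A2" for c
    proof -
      have c: "m dvd c + 2 * b"
        using that by (simp add: defs)
      show "c \<notin> A3"
        using c False weaken[of c] dvd_combination[of m c "c + 2 * b" "2 * b" "- 1" 1] by (auto simp: defs)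
      show "c \<notin> A4"
        using c b weaken[of "c + 3 * b"] dvd_combination[of m "c + 3 * b" "c + 2 * b" b 1 "- 1"]
        by (auto simp: defs)
    qed
    ultimately have "(A1 \<union> A2) \<inter> (A3 \<union> A4) = {}"
      by blast
    then show ?thesis
      using False cards fin disj disj' by (simp add: card_Un_disjoint)
  qed
  moreover have "card (A1 \<union> A2 \<union> (A3 \<union> A4)) \<le> card ?R"
    using sub by (intro card_mono) auto
  ultimately show ?thesis
    unfolding union using sub m by (subst card_Diff_subset) (auto simp: fin)
qed

lemma card_double_multiples:
  fixes m :: int
  assumes m: "m > 0"
  shows "card {z \<in> {0..<3 * m}. m dvd 2 * z} = (if even m then 6 else 3)"
proof (cases "even m")
  case True
  then obtain l where l: "m = 2 * l"
    by blast
  have "{z \<in> {0..<3 * m}. m dvd 2 * z} = {z \<in> {0..<int 6 * l}. l dvd z + 0}"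
    by (auto simp: l)
  then show ?thesis
    using card_residue_class[of l 6 0] True m l by simp
next
  case False
  then have "coprime m 2"
    by simp
  then have "{z \<in> {0..<3 * m}. m dvd 2 * z} = {z \<in> {0..<int 3 * m}. m dvd z + 0}"
    by (auto simp: coprime_dvd_mult_right_iff)
  then show ?thesis
    using card_residue_class[of m 3 0] False m by simp
qed

text \<open>
  On this hyperplane \<open>y = b + c\<close> is a parameter, with \<open>b = -2 y\<close> and \<open>c = 3 y\<close>.
\<close>

lemma card_G2_hyperplane:
  fixes m :: int
  assumes m: "m > 0"
  shows "card {(b, c). b \<in> {0..<3 * m} \<and> c \<in> {0..<3 * m} \<and> \<not> m dvd b \<and> 3 * m dvd 3 * b + 2 * c}
    = card {y \<in> {0..<3 * m}. \<not> m dvd 2 * y}"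
proof -
  let ?q = "3 * m"
  let ?S = "{(b, c). b \<in> {0..<3 * m} \<and> c \<in> {0..<3 * m} \<and> \<not> m dvd b \<and> 3 * m dvd 3 * b + 2 * c}"
  let ?T = "{y \<in> {0..<3 * m}. \<not> m dvd 2 * y}"
  let ?f = "\<lambda>y. ((- 2 * y) mod ?q, (3 * y) mod ?q)"
  let ?g = "\<lambda>(b, c). (b + c) mod ?q"
  have mod_range: "x mod ?q \<in> {0..<3 * m}" for x
    using m by simp
  have mod_dvd: "m dvd x mod ?q \<longleftrightarrow> m dvd x" for x
    by (simp add: dvd_mod_iff)
  have "bij_betw ?f ?T ?S"
  proof (rule bij_betw_byWitness[where f' = ?g])
    show "\<forall>y\<in>?T. ?g (?f y) = y"
    proof
      fix y assume y: "y \<in> ?T"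
      have "((- 2 * y) mod ?q + (3 * y) mod ?q) mod ?q = (- 2 * y + 3 * y) mod ?q"
        by (rule mod_add_eq)
      also have "\<dots> = y"
        using y by simp
      finally show "?g (?f y) = y"
        by simp
    qed
    show "\<forall>p\<in>?S. ?f (?g p) = p"
    proof
      fix p assume "p \<in> ?S"
      then obtain b c where p: "p = (b, c)" "b \<in> {0..<3 * m}" "c \<in> {0..<3 * m}" "?q dvd 3 * b + 2 * c"
        by auto
      have "(- 2 * ((b + c) mod ?q)) mod ?q = (- 2 * (b + c)) mod ?q"
        by (simp only: mod_mult_right_eq)
      also have "\<dots> = b mod ?q"
        unfolding mod_eq_dvd_iff by (rule dvd_combination[OF p(4) p(4), of _ "- 1" 0]) simp
      also have "\<dots> = b"
        using p(2) by simp
      moreover have "(3 * ((b + c) mod ?q)) mod ?q = (3 * (b + c)) mod ?q"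
        by (simp only: mod_mult_right_eq)
      moreover have "\<dots> = c mod ?q"
        unfolding mod_eq_dvd_iff by (rule dvd_combination[OF p(4) p(4), of _ 1 0]) simp
      moreover have "\<dots> = c"
        using p(3) by simp
      ultimately show "?f (?g p) = p"
        unfolding p(1) by simp
    qed
    show "?f ` ?T \<subseteq> ?S"
    proof (rule image_subsetI)
      fix y assume y: "y \<in> ?T"
      have "?q dvd 3 * ((- 2 * y) mod ?q) + 2 * ((3 * y) mod ?q)"
      proof -
        have "(3 * ((- 2 * y) mod ?q) + 2 * ((3 * y) mod ?q)) mod ?q = (3 * (- 2 * y) + 2 * (3 * y)) mod ?q"
          by (intro mod_add_cong mod_mult_cong refl mod_mod_trivial)
        then show ?thesis
          by (simp only: dvd_eq_mod_eq_0) simp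
      qed
      then show "?f y \<in> ?S"
        using y mod_range mod_dvd[of "- 2 * y"] by simp
    qed
    show "?g ` ?S \<subseteq> ?T"
    proof (rule image_subsetI)
      fix p assume "p \<in> ?S"
      then obtain b c where p: "p = (b, c)" "\<not> m dvd b" "?q dvd 3 * b + 2 * c"
        by auto
      have "m dvd 3 * b + 2 * c"
        using p(3) by (rule dvd_mult_right)
      then have "\<not> m dvd 2 * (b + c)"
        using dvd_combination[of m "3 * b + 2 * c" "2 * (b + c)" b 1 "- 1"] p(2) by auto
      moreover have "m dvd 2 * ((b + c) mod ?q) \<longleftrightarrow> m dvd 2 * (b + c)"
      proof -
        have "m dvd (2 * ((b + c) mod ?q)) mod ?q \<longleftrightarrow> m dvd (2 * (b + c)) mod ?q"
          by (simp only: mod_mult_right_eq)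
        then show ?thesis
          by (simp only: mod_dvd)
      qed
      ultimately show "?g p \<in> ?T"
        using mod_range by (simp add: p(1))
    qed
  qed
  then show ?thesis
    by (rule bij_betw_same_card[symmetric])
qed

text \<open>
  Leaving out the form \<open>3 b + 2 c\<close> one counts the \<open>c\<close> for each \<open>b\<close>. The points with \<open>b\<close> not
  divisible by \<open>m\<close> on the hyperplane of that form lie on no other hyperplane, so their number is
  simply subtracted. Only the number \<open>e\<close> of solutions of \<open>2 z = 0\<close> modulo \<open>m\<close> depends on the parity.
\<close>

lemma card_G2_regular:
  fixes m :: int
  assumes m: "m > 0"
  shows "int (card (G2_regular m)) = (if even m then (3 * m - 6)\<^sup>2 else (3 * m - 3) * (3 * m - 9))"
proof -
  let ?R = "{0..<3 * m}"
  let ?B = "{b \<in> ?R. \<not> m dvd b}"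
  let ?C = "\<lambda>b. {c \<in> ?R. \<not> m dvd b + c \<and> \<not> m dvd 2 * b + c \<and> \<not> 3 * m dvd c \<and> \<not> 3 * m dvd 3 * b + c}"
  let ?H = "{(b, c). b \<in> ?R \<and> c \<in> ?R \<and> \<not> m dvd b \<and> 3 * m dvd 3 * b + 2 * c}"
  define e where "e = card {z \<in> ?R. m dvd 2 * z}"
  have e: "e = (if even m then 6 else 3)"
    unfolding e_def by (rule card_double_multiples[OF m])
  have card_R: "int (card ?R) = 3 * m"
    using m by simp
  have weaken: "m dvd x" if "3 * m dvd x" for x
    using that by (rule dvd_mult_right)
  have "int (card ?B) = 3 * m - 3"
    using card_filter_not[of ?R "\<lambda>b. m dvd b"] card_residue_class[OF m, of 3 0] card_R by simp
  have special: "int (card {b \<in> ?B. m dvd 2 * b}) = int e - 3"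
  proof -
    let ?A = "{b \<in> ?R. m dvd 2 * b}"
    have "{b \<in> ?B. m dvd 2 * b} = {b \<in> ?A. \<not> m dvd b}"
      by auto
    moreover have "{b \<in> ?A. m dvd b} = {b \<in> {0..<int 3 * m}. m dvd b + 0}"
      by auto
    moreover have "finite ?A"
      by (rule finite_subset[of _ ?R]) auto
    ultimately show ?thesis
      using card_filter_not[of ?A "\<lambda>b. m dvd b"] card_residue_class[OF m, of 3 0] unfolding e_def by simp
  qed
  have hyper: "int (card ?H) = 3 * m - int e"
    unfolding card_G2_hyperplane[OF m] using card_filter_not[of ?R "\<lambda>y. m dvd 2 * y"] card_R
    by (simp add: e_def)
  have H_sub: "?H \<subseteq> Sigma ?B ?C"
  proof
    fix p assume "p \<in> ?H"
    then obtain b c where p: "p = (b, c)" "b \<in> ?R" "c \<in> ?R" "\<not> m dvd b" "3 * m dvd 3 * b + 2 * c"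
      by auto
    have b3: "\<not> 3 * m dvd 3 * b"
      using p(4) by simp
    have "\<not> m dvd b + c"
      using dvd_combination[OF weaken[OF p(5)], of "b + c" b 1 "- 2"] p(4) by auto
    moreover have "\<not> m dvd 2 * b + c"
      using dvd_combination[OF weaken[OF p(5)], of "2 * b + c" b "- 1" 2] p(4) by auto
    moreover have "\<not> 3 * m dvd c"
      using dvd_combination[OF p(5), of c "3 * b" 1 "- 2"] b3 by auto
    moreover have "\<not> 3 * m dvd 3 * b + c"
      using dvd_combination[OF p(5), of "3 * b + c" "3 * b" "- 1" 2] b3 by auto
    ultimately show "p \<in> Sigma ?B ?C"
      using p by simp
  qed
  have "G2_regular m = Sigma ?B ?C - ?H"
    by (auto simp: G2_regular_def)
  moreover have "finite {x \<in> ?R. Q x}" for Q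
    by (rule finite_subset[of _ ?R]) auto
  then have fin: "finite (Sigma ?B ?C)"
    by (intro finite_SigmaI)
  ultimately have "int (card (G2_regular m)) = int (card (Sigma ?B ?C)) - int (card ?H)"
    using H_sub card_mono[OF fin H_sub] finite_subset[OF H_sub fin] by (simp add: card_Diff_subset)
  also have "int (card (Sigma ?B ?C)) = (\<Sum>b\<in>?B. int (card (?C b)))"
    by (subst card_SigmaI) (auto intro: finite_subset[of _ ?R])
  also have "\<dots> = (\<Sum>b\<in>?B. (3 * m - 8) + (if m dvd 2 * b then 2 else 0))"
  proof (intro sum.cong refl)
    fix b assume "b \<in> ?B"
    then show "int (card (?C b)) = (3 * m - 8) + (if m dvd 2 * b then 2 else 0)"
      using card_G2_fibre[OF m, of b] by (auto split: if_splits)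
  qed
  also have "\<dots> = (3 * m - 3) * (3 * m - 8) + 2 * (int e - 3)"
    using special \<open>int (card ?B) = 3 * m - 3\<close>
    by (simp add: sum.distrib sum.If_cases Int_def conj_commute)
  also have "\<dots> - int (card ?H) = (if even m then (3 * m - 6)\<^sup>2 else (3 * m - 3) * (3 * m - 9))"
    unfolding hyper e by (simp add: power2_eq_square algebra_simps)
  finally show ?thesis .
qed

text \<open>
  The root \<open>\<alpha>\<^sub>1 + \<alpha>\<^sub>2 + \<alpha>\<^sub>3 + \<alpha>\<^sub>4\<close> takes the value \<open>a + 2 b + c\<close>, which is zero modulo \<open>q\<close> if 3 is invertible.
\<close>

lemma fixed_triples_empty:
  assumes "\<not> 3 dvd q"
  shows "fixed_triples q = {}"
proof -
  have "[1, 1, 1, 1, 0, 0] \<in> set pos_coords"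
    by (simp add: pos_coords_def)
  then have "\<not> int q dvd a + 2 * b + c" if "(a, b, c) \<in> fixed_triples q" for a b c
    using that by (fastforce simp: fixed_triples_def algebra_simps)
  moreover have "int q dvd a + 2 * b + c" if "(a, b, c) \<in> fixed_triples q" for a b c
  proof -
    have "prime (3 :: nat)"
      by simp
    then have "coprime q 3"
      using prime_imp_coprime[OF _ assms] by (simp add: coprime_commute)
    then have "coprime (int q) 3"
      by (metis coprime_int_iff of_nat_numeral)
    moreover have "int q dvd 3 * (a + 2 * b + c)"
      using that by (simp only: fixed_triples_def mem_Collect_eq case_prod_conv)
    ultimately show ?thesis
      by (simp only: coprime_dvd_mult_right_iff)
  qed
  ultimately show ?thesis
    by auto
qed

text \<open>
  Modulo \<open>3 m\<close> the sum \<open>a + 2 b + c\<close> is \<open>m\<close> or \<open>2 m\<close>, and \<open>a\<close> is determined by this choice, \<open>b\<close> and \<open>c\<close>.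
\<close>

lemma card_fixed_triples:
  assumes q: "q = 3 * m" and "m > 0"
  shows "card (fixed_triples q) = 2 * card (G2_regular (int m))"
proof -
  define M where "M = int m"
  have M: "M > 0" and Q: "int q = 3 * M"
    using assms by (simp_all add: M_def)
  let ?Q = "3 * M"
  let ?f = "\<lambda>(j, b, c). ((j * M - 2 * b - c) mod ?Q, b, c)"
  let ?g = "\<lambda>(a, b, c). (((a + 2 * b + c) mod ?Q) div M, b, c)"
  have multiple: "x mod ?Q \<in> {M, 2 * M}" if x: "M dvd x" "\<not> ?Q dvd x" for x
  proof -
    obtain t where t: "x = M * t"
      using x(1) by (rule dvdE)
    have "x mod ?Q = M * (t mod 3)"
      by (simp add: t mult.commute[of 3])
    moreover have "t mod 3 \<noteq> 0"
      using x(2) M by (simp add: t mult.commute[of 3] dvd_eq_mod_eq_0)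
    then have "t mod 3 = 1 \<or> t mod 3 = 2"
      by presburger
    ultimately show ?thesis
      by auto
  qed
  have in_iff: "(a, b, c) \<in> fixed_triples q \<longleftrightarrow> a \<in> {0..<?Q} \<and> (b, c) \<in> G2_regular M \<and>
      M dvd a + 2 * b + c \<and> \<not> ?Q dvd a + 2 * b + c" for a b c
  proof -
    have "[1, 1, 1, 1, 0, 0] \<in> set pos_coords"
      by (simp add: pos_coords_def)
    then have *: "\<not> ?Q dvd a + 2 * b + c" if "(a, b, c) \<in> fixed_triples q"
      using that by (fastforce simp: fixed_triples_def Q algebra_simps)
    have **: "?Q dvd 3 * (a + 2 * b + c) \<longleftrightarrow> M dvd a + 2 * b + c"
      by (rule dvd_times_left_cancel_iff) simp
    show ?thesis
    proof (cases "M dvd a + 2 * b + c \<and> \<not> ?Q dvd a + 2 * b + c")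
      case True
      then show ?thesis
        using regular_triple_iff_G2[OF M refl, of a b c] **
        unfolding fixed_triples_def G2_regular_def Q by auto
    next
      case False
      then show ?thesis
        using * ** unfolding fixed_triples_def Q by auto
    qed
  qed
  have "bij_betw ?f ({1, 2} \<times> G2_regular M) (fixed_triples q)"
  proof (rule bij_betw_byWitness[where f' = ?g])
    have shift: "((j * M - 2 * b - c) mod ?Q + 2 * b + c) mod ?Q = j * M" if "j \<in> {1, 2}" for j b c
    proof -
      have "((j * M - 2 * b - c) mod ?Q + 2 * b + c) mod ?Q = (j * M) mod ?Q"
        by (simp add: mod_simps add.assoc)
      also have "\<dots> = j * M"
        using that M by auto
      finally show ?thesis .
    qed
    show "\<forall>p\<in>{1, 2} \<times> G2_regular M. ?g (?f p) = p"
    proof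
      fix p :: "int \<times> int \<times> int"
      assume "p \<in> {1, 2} \<times> G2_regular M"
      then obtain j b c where p: "p = (j, b, c)" "j \<in> {1, 2}"
        by auto
      have "?g (?f p) = ((j * M) div M, b, c)"
        by (simp only: p(1) case_prod_conv shift[OF p(2)])
      then show "?g (?f p) = p"
        using M by (simp add: p(1))
    qed
    show "\<forall>p\<in>fixed_triples q. ?f (?g p) = p"
    proof
      fix p assume p: "p \<in> fixed_triples q"
      obtain a b c where abc: "p = (a, b, c)"
        by (cases p)
      have *: "a \<in> {0..<?Q}" "M dvd a + 2 * b + c" "\<not> ?Q dvd a + 2 * b + c"
        using p in_iff unfolding abc by auto
      have "((a + 2 * b + c) mod ?Q) div M * M = (a + 2 * b + c) mod ?Q"
        using multiple[OF *(2,3)] M by auto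
      then have "(((a + 2 * b + c) mod ?Q) div M * M - 2 * b - c) mod ?Q = (a + 2 * b + c - (2 * b + c)) mod ?Q"
        by (simp only: diff_diff_eq mod_diff_left_eq)
      also have "\<dots> = a mod ?Q"
        by simp
      finally have "(((a + 2 * b + c) mod ?Q) div M * M - 2 * b - c) mod ?Q = a mod ?Q" .
      then show "?f (?g p) = p"
        using *(1) by (simp add: abc)
    qed
    show "?f ` ({1, 2} \<times> G2_regular M) \<subseteq> fixed_triples q"
    proof (rule image_subsetI)
      fix p :: "int \<times> int \<times> int"
      assume "p \<in> {1, 2} \<times> G2_regular M"
      then obtain j b c where p: "p = (j, b, c)" "j \<in> {1, 2}" "(b, c) \<in> G2_regular M"
        by auto
      let ?s = "(j * M - 2 * b - c) mod ?Q + 2 * b + c"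
      have "M dvd ?s mod ?Q" "\<not> ?Q dvd ?s mod ?Q"
        using p(2) M unfolding shift[OF p(2)] by (auto dest: zdvd_imp_le)
      then have "M dvd ?s" "\<not> ?Q dvd ?s"
        by (simp_all add: dvd_mod_iff)
      then show "?f p \<in> fixed_triples q"
        using p M by (simp add: in_iff)
    qed
    show "?g ` fixed_triples q \<subseteq> {1, 2} \<times> G2_regular M"
    proof (rule image_subsetI)
      fix p assume p: "p \<in> fixed_triples q"
      obtain a b c where abc: "p = (a, b, c)"
        by (cases p)
      have *: "(b, c) \<in> G2_regular M" "M dvd a + 2 * b + c" "\<not> ?Q dvd a + 2 * b + c"
        using p in_iff unfolding abc by auto
      then show "?g p \<in> {1, 2} \<times> G2_regular M"
        using multiple[OF *(2,3)] M by (auto simp: abc)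
    qed
  qed
  then have "card (fixed_triples q) = card ({1, 2 :: int} \<times> G2_regular M)"
    by (rule bij_betw_same_card[symmetric])
  then show ?thesis
    by (simp add: card_cartesian_product M_def)
qed

context e6
begin

section \<open>Coordinates on the arrangement complement\<close>

definition lattice_point :: "(nat \<Rightarrow> int) \<Rightarrow> 'a" where
  "lattice_point c = from_coords (\<lambda>i. of_int (c i))"

lemma simple_inner_lattice_point: "i \<in> {1..6} \<Longrightarrow> \<alpha> i \<bullet> lattice_point c = of_int (c i)"
  by (simp add: lattice_point_def simple_inner_from_coords)

lemma lattice_point_in_Z: "lattice_point c \<in> Z"
proof (rule Z_I)
  show "lattice_point c \<in> E"
    unfolding lattice_point_def by (rule from_coords_in_E)
qed (simp add: simple_inner_lattice_point)

lemma rvec_inner_lattice_point: "rvec k \<bullet> lattice_point c = of_int (pair k c)"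
  by (simp add: rvec_inner pair_def simple_inner_lattice_point)

lemma regular_lattice_point:
  assumes "q > 0"
  shows "regular q (lattice_point c) \<longleftrightarrow> (\<forall>k\<in>set pos_coords. \<not> int q dvd pair k c)"
proof -
  have multiple: "(\<exists>l::int. rvec k \<bullet> lattice_point c = of_int l * of_nat q) \<longleftrightarrow> int q dvd pair k c" for k
  proof -
    have "(rvec k \<bullet> lattice_point c = of_int l * of_nat q) \<longleftrightarrow> pair k c = int q * l" for l
    proof -
      have "rvec k \<bullet> lattice_point c = of_int l * of_nat q \<longleftrightarrow> (of_int (pair k c) :: real) = of_int (int q * l)"
        by (simp add: rvec_inner_lattice_point mult.commute)
      then show ?thesis
        by (simp only: of_int_eq_iff)
    qed
    then show ?thesis
      by (simp add: dvd_def)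
  qed
  have neg: "(\<exists>l::int. - \<beta> \<bullet> x = of_int l * of_nat q) \<longleftrightarrow> (\<exists>l::int. \<beta> \<bullet> x = of_int l * of_nat q)" for \<beta> x :: 'a
    by (metis inner_minus_left minus_minus mult_minus_left of_int_minus)
  have "regular q (lattice_point c) \<longleftrightarrow> (\<forall>\<beta>\<in>P. \<not> (\<exists>l::int. \<beta> \<bullet> lattice_point c = of_int l * of_nat q))"
  proof
    assume *: "\<forall>\<beta>\<in>P. \<not> (\<exists>l::int. \<beta> \<bullet> lattice_point c = of_int l * of_nat q)"
    show "regular q (lattice_point c)"
      unfolding regular_def
    proof
      fix \<beta> assume "\<beta> \<in> \<Phi>"
      then show "\<not> (\<exists>l::int. \<beta> \<bullet> lattice_point c = of_int l * of_nat q)"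
      proof (cases rule: P_cases)
        case 2
        then show ?thesis
          using * neg[of \<beta>] by blast
      qed (use * in blast)
    qed
  qed (use P_in_\<Phi> in \<open>auto simp: regular_def\<close>)
  also have "\<dots> \<longleftrightarrow> (\<forall>k\<in>set pos_coords. \<not> int q dvd pair k c)"
    unfolding P_def ball_simps multiple ..
  finally show ?thesis .
qed

lemma lattice_points_congruent:
  assumes "q > 0" "\<And>i. i \<in> {1..6} \<Longrightarrow> int q dvd c i - d i"
  shows "lattice_point c - lattice_point d \<in> L q"
  unfolding L_iff[OF assms(1)]
proof (intro conjI ballI)
  show "lattice_point c - lattice_point d \<in> E"
    using lattice_point_in_Z Z_diff Z_in_E by blast
  fix i :: nat assume i: "i \<in> {1..6}"
  obtain k where "c i - d i = int q * k"
    using assms(2)[OF i] by (rule dvdE)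
  then have "\<alpha> i \<bullet> (lattice_point c - lattice_point d) = of_int (int q * k)"
    by (simp only: inner_diff_right simple_inner_lattice_point[OF i] flip: of_int_diff)
  then show "\<exists>k::int. \<alpha> i \<bullet> (lattice_point c - lattice_point d) = of_int k * of_nat q"
    by (intro exI[of _ k]) (simp add: mult.commute)
qed

lemma lattice_points_congruentD:
  assumes "lattice_point c - lattice_point d \<in> L q" "i \<in> {1..6}"
  shows "int q dvd c i - d i"
proof -
  obtain k :: int where "\<alpha> i \<bullet> (lattice_point c - lattice_point d) = of_int k * of_nat q"
    using L_inner[OF assms(1) simple_in_\<Phi>[OF assms(2)]] by blast
  then have "of_int (c i - d i) = (of_int (k * int q) :: real)"
    by (simp add: inner_diff_right simple_inner_lattice_point[OF assms(2)])
  then have "c i - d i = k * int q"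
    by (simp only: of_int_eq_iff)
  then show ?thesis
    by simp
qed

lemma Z_lattice_point:
  assumes "x \<in> Z" obtains c where "x = lattice_point c"
proof
  show "x = lattice_point (\<lambda>i. \<lfloor>\<alpha> i \<bullet> x\<rfloor>)"
  proof (rule E_eqI)
    fix i :: nat assume i: "i \<in> {1..6}"
    have "\<alpha> i \<bullet> x \<in> \<int>"
      using Z_inner[OF assms simple_in_\<Phi>[OF i]] .
    then show "\<alpha> i \<bullet> x = \<alpha> i \<bullet> lattice_point (\<lambda>i. \<lfloor>\<alpha> i \<bullet> x\<rfloor>)"
      using i by (auto simp: simple_inner_lattice_point elim!: Ints_cases)
  qed (use Z_in_E assms lattice_point_in_Z in auto)
qed

lemma regular_congruent:
  assumes "regular q x" "x - y \<in> L q"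
  shows "regular q y"
  using regular_add_L[OF assms(1) L_minus_commute[OF assms(2)]] by simp

lemma card_arrangement_complement:
  assumes q: "q > 0"
  shows "card (arrangement_complement E \<Phi> q) = card (regular_residues q)"
proof -
  let ?h = "\<lambda>c. coset (lattice_point c) (L q)"
  have "bij_betw ?h (regular_residues q) (arrangement_complement E \<Phi> q)"
  proof (rule bij_betw_imageI)
    show "inj_on ?h (regular_residues q)"
    proof (rule inj_onI)
      fix c d assume *: "c \<in> regular_residues q" "d \<in> regular_residues q" "?h c = ?h d"
      then have PiE: "c \<in> (\<Pi>\<^sub>E i\<in>{1..6}. {0..<int q})" "d \<in> (\<Pi>\<^sub>E i\<in>{1..6}. {0..<int q})"
        by (simp_all add: regular_residues_def residue_vectors_def)
      show "c = d"
      proof (rule PiE_ext[OF PiE])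
        fix i :: nat assume i: "i \<in> {1..6}"
        have "int q dvd c i - d i"
          using *(3) i by (intro lattice_points_congruentD) (simp_all only: coset_eq_iff)
        then show "c i = d i"
          using PiE_mem[OF PiE(1) i] PiE_mem[OF PiE(2) i] by (intro residues_cong_imp_eq[of _ "int q"])
      qed
    qed
    show "?h ` regular_residues q = arrangement_complement E \<Phi> q"
    proof (intro equalityI subsetI)
      fix t assume "t \<in> ?h ` regular_residues q"
      then show "t \<in> arrangement_complement E \<Phi> q"
        using lattice_point_in_Z regular_lattice_point[OF q]
        by (auto simp: arrangement_complement_eq regular_residues_def)
    next
      fix t assume "t \<in> arrangement_complement E \<Phi> q"
      then obtain x where x: "x \<in> Z" "regular q x" "t = coset x (L q)"
        by (auto simp: arrangement_complement_eq)
      obtain c where c: "x = lattice_point c"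
        using Z_lattice_point[OF x(1)] .
      define d where "d = (\<lambda>i\<in>{1..6}. c i mod int q)"
      have "x - lattice_point d \<in> L q"
        unfolding c
      proof (rule lattice_points_congruent[OF q])
        fix i :: nat assume "i \<in> {1..6}"
        then have "d i = c i mod int q"
          by (simp add: d_def)
        then show "int q dvd c i - d i"
          by (simp add: minus_mod_eq_mult_div)
      qed
      moreover have "d \<in> residue_vectors q"
        unfolding residue_vectors_def d_def using q by (subst restrict_PiE_iff) simp
      ultimately have "d \<in> regular_residues q" "t = ?h d"
        using regular_congruent[OF x(2)] regular_lattice_point[OF q, of d]
        by (auto simp: regular_residues_def x(3) coset_eq_iff)
      then show "t \<in> ?h ` regular_residues q"
        by blast
    qed
  qed
  then show ?thesis
    by (rule bij_betw_same_card[symmetric])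
qed

lemma length_7_cases:
  assumes "length c = 7"
  obtains c0 c1 c2 c3 c4 c5 c6 where "c = [c0, c1, c2, c3, c4, c5, c6]"
  using assms by (auto simp: numeral_eq_Suc length_Suc_conv)

text \<open>
  The entries of a solution are the values of \<open>\<alpha>\<^sub>4, \<alpha>\<^sub>2, \<alpha>\<^sub>3, \<alpha>\<^sub>5, q - \<theta>, \<alpha>\<^sub>1, \<alpha>\<^sub>6\<close> in this order, that is, by
  decreasing weight. The selector list gives the position of the value of \<open>\<alpha>\<^sub>i\<close>; its entry at index 0 is
  a dummy.
\<close>

lemma alcove_points_bij:
  assumes q: "q > 0"
  shows "bij_betw (\<lambda>c. from_coords (\<lambda>i. of_nat (c ! ([0, 5, 1, 2, 0, 3, 6] ! i))))
    (sols [3, 2, 2, 2, 1, 1, 1] q) (alcove_points q)"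
    (is "bij_betw ?f ?S _")
proof (rule bij_betw_imageI)
  have inner: "\<alpha> i \<bullet> ?f c = of_nat (c ! ([0, 5, 1, 2, 0, 3, 6] ! i))" if "i \<in> {1..6}" for c i
    using that by (rule simple_inner_from_coords)
  have S: "c \<in> ?S \<longleftrightarrow> (\<exists>c0 c1 c2 c3 c4 c5 c6. c = [c4, c2, c3, c5, c0, c1, c6] \<and>
      0 < c0 \<and> 0 < c1 \<and> 0 < c2 \<and> 0 < c3 \<and> 0 < c4 \<and> 0 < c5 \<and> 0 < c6 \<and>
      c0 + c1 + 2 * c2 + 2 * c3 + 3 * c4 + 2 * c5 + c6 = q)" for c
  proof
    assume "c \<in> ?S"
    then have c: "length c = 7" "0 \<notin> set c" "sum_list (map2 (*) [3, 2, 2, 2, 1, 1, 1] c) = q"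
      by (simp_all add: sols_def)
    from c(1) obtain c4 c2 c3 c5 c0 c1 c6 where "c = [c4, c2, c3, c5, c0, c1, c6]"
      by (rule length_7_cases)
    then show "\<exists>c0 c1 c2 c3 c4 c5 c6. c = [c4, c2, c3, c5, c0, c1, c6] \<and>
      0 < c0 \<and> 0 < c1 \<and> 0 < c2 \<and> 0 < c3 \<and> 0 < c4 \<and> 0 < c5 \<and> 0 < c6 \<and>
      c0 + c1 + 2 * c2 + 2 * c3 + 3 * c4 + 2 * c5 + c6 = q"
      using c(2,3) by auto
  next
    assume "\<exists>c0 c1 c2 c3 c4 c5 c6. c = [c4, c2, c3, c5, c0, c1, c6] \<and>
      0 < c0 \<and> 0 < c1 \<and> 0 < c2 \<and> 0 < c3 \<and> 0 < c4 \<and> 0 < c5 \<and> 0 < c6 \<and>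
      c0 + c1 + 2 * c2 + 2 * c3 + 3 * c4 + 2 * c5 + c6 = q"
    then show "c \<in> ?S"
      by (auto simp: sols_def)
  qed
  show "inj_on ?f ?S"
  proof (rule inj_onI)
    fix c d assume *: "c \<in> ?S" "d \<in> ?S" "?f c = ?f d"
    have eq: "c ! ([0, 5, 1, 2, 0, 3, 6] ! i) = d ! ([0, 5, 1, 2, 0, 3, 6] ! i)" if "i \<in> {1..6}" for i
      using inner[OF that, of c] inner[OF that, of d] *(3) by simp
    show "c = d"
      using *(1,2) eq[of 1] eq[of 2] eq[of 3] eq[of 4] eq[of 5] eq[of 6] unfolding S by auto
  qed
  show "?f ` ?S = alcove_points q"
  proof (intro equalityI subsetI)
    fix x assume "x \<in> ?f ` ?S"
    then obtain c where c: "c \<in> ?S" and x: "x = ?f c"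
      by blast
    from c obtain c0 c1 c2 c3 c4 c5 c6 where cs: "c = [c4, c2, c3, c5, c0, c1, c6]"
        "0 < c0" "0 < c1" "0 < c2" "0 < c3" "0 < c4" "0 < c5" "0 < c6"
        "c0 + c1 + 2 * c2 + 2 * c3 + 3 * c4 + 2 * c5 + c6 = q"
      unfolding S by blast
    have inners: "\<alpha> 1 \<bullet> x = of_nat c1" "\<alpha> 2 \<bullet> x = of_nat c2" "\<alpha> 3 \<bullet> x = of_nat c3"
        "\<alpha> 4 \<bullet> x = of_nat c4" "\<alpha> 5 \<bullet> x = of_nat c5" "\<alpha> 6 \<bullet> x = of_nat c6"
      unfolding x using inner[of _ c] by (simp_all add: cs(1))
    have xE: "x \<in> E"
      unfolding x by (rule from_coords_in_E)
    moreover have "0 < \<alpha> i \<bullet> x" "\<alpha> i \<bullet> x \<in> \<int>" if "i \<in> {1..6}" for i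
      using that cs by (auto elim!: index_cases simp: inners simp del: atLeastAtMost_iff)
    moreover have "\<theta> \<bullet> x < of_nat q"
      unfolding \<theta>_inner inners cs(9)[symmetric] using cs(2) by simp
    ultimately show "x \<in> alcove_points q"
      using Z_I[OF xE] by (simp add: alcove_points_def alcove_def)
  next
    fix x assume "x \<in> alcove_points q"
    then have x: "x \<in> Z" "x \<in> alcove (of_nat q)"
      by (auto simp: alcove_points_def)
    have "\<exists>n. \<alpha> i \<bullet> x = of_nat n \<and> 0 < n" if i: "i \<in> {1..6}" for i
    proof -
      obtain k :: int where k: "\<alpha> i \<bullet> x = of_int k"
        using Z_inner[OF x(1) simple_in_\<Phi>[OF i]] by (auto elim: Ints_cases)
      moreover have "0 < \<alpha> i \<bullet> x"
        using alcove_P[OF x(2) simple_in_P[OF i]] by simp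
      ultimately show ?thesis
        by (intro exI[of _ "nat k"]) simp
    qed
    then obtain n where n: "\<And>i. i \<in> {1..6} \<Longrightarrow> \<alpha> i \<bullet> x = of_nat (n i) \<and> 0 < n i"
      by metis
    have "\<theta> \<bullet> x < of_nat q"
      using x(2) by (simp add: alcove_def)
    then have "real (n 1 + 2 * n 2 + 2 * n 3 + 3 * n 4 + 2 * n 5 + n 6) < real q"
      unfolding \<theta>_inner using n by simp
    then have less: "n 1 + 2 * n 2 + 2 * n 3 + 3 * n 4 + 2 * n 5 + n 6 < q"
      by (simp only: of_nat_less_iff)
    define c where "c = [n 4, n 2, n 3, n 5, q - (n 1 + 2 * n 2 + 2 * n 3 + 3 * n 4 + 2 * n 5 + n 6), n 1, n 6]"
    have "c \<in> ?S"
      unfolding S c_def using n less by (intro exI conjI) (rule refl | simp)+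
    moreover have "x = ?f c"
    proof (rule E_eqI)
      fix i :: nat assume i: "i \<in> {1..6}"
      have "c ! ([0, 5, 1, 2, 0, 3, 6] ! i) = n i"
        using i by (elim index_cases) (simp_all add: c_def)
      then show "\<alpha> i \<bullet> x = \<alpha> i \<bullet> ?f c"
        using n i inner[OF i, of c] by simp
    qed (use x Z_in_E from_coords_in_E in auto)
    ultimately show "x \<in> ?f ` ?S"
      by blast
  qed
qed

section \<open>The order of the Weyl group and the characteristic quasi-polynomial\<close>

lemma finite_alcove_points: "q > 0 \<Longrightarrow> finite (alcove_points q)"
  using bij_betw_finite[OF alcove_points_bij] finite_sols[of "[3, 2, 2, 2, 1, 1, 1]" q] by simp

lemma card_W_times_sols7:
  assumes q: "q > 0"
  shows "int (card W) * sols7 q = 51840 * int (card (arrangement_complement E \<Phi> q))"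
proof -
  have "card (alcove_points q) = card (sols [3, 2, 2, 2, 1, 1, 1] q)"
    using bij_betw_same_card[OF alcove_points_bij[OF q]] by simp
  then have sols: "sols7 q = 17280 * int (card (alcove_points q))"
    using card_sols_7[OF q] by simp
  have "int (card W) * int (card (alcove_points q)) = 3 * int (card (arrangement_complement E \<Phi> q))"
    using card_complement_eq_card_W_alcove[OF q finite_alcove_points[OF q]]
    by (metis of_nat_mult of_nat_numeral)
  then show ?thesis
    by (simp add: sols mult.left_commute)
qed

text \<open>
  By \<open>card_W_times_sols7\<close> the order of \<open>W\<close> is \<open>51840\<close> times a quotient that tends to 1, with relative error
  of order \<open>36 / q\<close>. For the value of \<open>q\<close> below, the error in the order is less than 1.
\<close>

lemma card_W: "card W = 51840"
proof -
  let ?q = "6000000 :: nat"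
  let ?N = "int (card (arrangement_complement E \<Phi> ?q))"
  have "card (arrangement_complement E \<Phi> ?q) \<le> ?q ^ 6"
      "?q ^ 6 \<le> card (arrangement_complement E \<Phi> ?q) + 36 * ?q ^ 5"
    using card_regular_residues_bounds[of ?q] by (simp_all only: card_arrangement_complement)
  then have "?N \<le> 6000000 ^ 6" "6000000 ^ 6 \<le> ?N + 36 * 6000000 ^ 5"
    by simp_all
  moreover have "int (card W) * sols7 ?q = 51840 * ?N"
    by (rule card_W_times_sols7) simp
  ultimately have "int (card W) = 51840"
    by (simp add: sols7_def)
  then show ?thesis
    by simp
qed

lemma chi_id:
  assumes q: "q > 0"
  shows "int (chi E \<Phi> q id) = sols7 q"
  using card_W_times_sols7[OF q] by (simp add: chi_def card_W)

section \<open>Cosets fixed by \<open>\<omega>\<^sub>1\<close> and \<open>\<omega>\<^sub>6\<close>\<close>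

text \<open>
  The two elements are inverse to each other, so they fix the same cosets and only \<open>\<omega>\<^sub>1\<close> needs to be
  considered.
\<close>

lemma omega_fixed_iff:
  assumes q: "q > 0" and x: "x \<in> Z" and u: "u \<in> {omega \<alpha> 1, omega \<alpha> 6}"
  shows "u ` coset x (L q) = coset x (L q) \<longleftrightarrow>
    (\<forall>i\<in>{0..6}. \<exists>k::int. aroot i \<bullet> x - aroot (rot i) \<bullet> x = of_int k * of_nat q)"
proof -
  have uW: "u \<in> W"
    using u omega_in_W by auto
  have "u x - x \<in> L q \<longleftrightarrow> omega \<alpha> 1 x - x \<in> L q"
  proof (cases "u = omega \<alpha> 1")
    case False
    then have u6: "u = omega \<alpha> 6"
      using u by simp
    have inv: "omega \<alpha> 1 (omega \<alpha> 6 y) = y" "omega \<alpha> 6 (omega \<alpha> 1 y) = y" for y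
      using omega_inverse by (simp_all add: fun_eq_iff)
    show ?thesis
    proof
      assume "u x - x \<in> L q"
      then have "omega \<alpha> 1 (u x - x) \<in> L q"
        by (rule W_L[OF omega_in_W(1)])
      then have "x - omega \<alpha> 1 x \<in> L q"
        by (simp add: u6 linear_diff[OF W_linear[OF omega_in_W(1)]] inv)
      then show "omega \<alpha> 1 x - x \<in> L q"
        by (rule L_minus_commute)
    next
      assume "omega \<alpha> 1 x - x \<in> L q"
      then have "omega \<alpha> 6 (omega \<alpha> 1 x - x) \<in> L q"
        by (rule W_L[OF omega_in_W(2)])
      then have "x - u x \<in> L q"
        by (simp add: u6 linear_diff[OF W_linear[OF omega_in_W(2)]] inv)
      then show "u x - x \<in> L q"
        by (rule L_minus_commute)
    qed
  qed simp
  moreover have inner: "aroot (rot i) \<bullet> (omega \<alpha> 1 x - x) = aroot i \<bullet> x - aroot (rot i) \<bullet> x"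
    if "i \<in> {0..6}" for i
    using W_inner[OF omega_in_W(1), of "aroot i" x] omega1_aroot[OF that] by (simp add: inner_diff_right)
  moreover have "omega \<alpha> 1 x - x \<in> L q \<longleftrightarrow>
    (\<forall>i\<in>{0..6}. \<exists>k::int. aroot i \<bullet> x - aroot (rot i) \<bullet> x = of_int k * of_nat q)"
  proof
    assume *: "omega \<alpha> 1 x - x \<in> L q"
    show "\<forall>i\<in>{0..6}. \<exists>k::int. aroot i \<bullet> x - aroot (rot i) \<bullet> x = of_int k * of_nat q"
    proof
      fix i :: nat assume i: "i \<in> {0..6}"
      show "\<exists>k::int. aroot i \<bullet> x - aroot (rot i) \<bullet> x = of_int k * of_nat q"
        using L_inner[OF * aroot_in_\<Phi>[OF rot_range[OF i]]] unfolding inner[OF i] by blast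
    qed
  next
    assume *: "\<forall>i\<in>{0..6}. \<exists>k::int. aroot i \<bullet> x - aroot (rot i) \<bullet> x = of_int k * of_nat q"
    show "omega \<alpha> 1 x - x \<in> L q"
      unfolding L_iff[OF q]
    proof (intro conjI ballI)
      show "omega \<alpha> 1 x - x \<in> E"
        using W_Z[OF omega_in_W(1) x] x Z_diff Z_in_E by blast
      fix j :: nat assume j: "j \<in> {1..6}"
      then obtain i where i: "i \<in> {0..6}" "rot i = j"
        using rot_surj[of j] by auto
      have "aroot j = \<alpha> j"
        using j by (simp add: aroot_def)
      then show "\<exists>k::int. \<alpha> j \<bullet> (omega \<alpha> 1 x - x) = of_int k * of_nat q"
        using * inner[OF i(1)] i by metis
    qed
  qed
  ultimately show ?thesis
    by (simp add: W_coset[OF uW] coset_eq_iff)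
qed

definition fixed_coords :: "int \<Rightarrow> int \<Rightarrow> int \<Rightarrow> nat \<Rightarrow> int" where
  "fixed_coords a b c i = [0, a, b, b, c, b, a] ! i"

lemma fixed_coords_simps [simp]:
  "fixed_coords a b c 1 = a" "fixed_coords a b c 2 = b" "fixed_coords a b c 3 = b"
  "fixed_coords a b c 4 = c" "fixed_coords a b c 5 = b" "fixed_coords a b c 6 = a"
  by (simp_all add: fixed_coords_def numeral_eq_Suc One_nat_def)

lemma pair_fixed_coords:
  "pair k (fixed_coords a b c) = (k ! 0 + k ! 5) * a + (k ! 1 + k ! 2 + k ! 4) * b + k ! 3 * c"
  unfolding pair_def sum_index by (simp add: algebra_simps) (simp add: One_nat_def)

lemma aroot_inner_lattice_point:
  "aroot 0 \<bullet> lattice_point c = of_int (- (c 1 + 2 * c 2 + 2 * c 3 + 3 * c 4 + 2 * c 5 + c 6))"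
  "i \<in> {1..6} \<Longrightarrow> aroot i \<bullet> lattice_point c = of_int (c i)"
  by (simp_all add: aroot_def \<theta>_inner simple_inner_lattice_point)

lemma omega_fixed_lattice_point:
  assumes q: "q > 0" and u: "u \<in> {omega \<alpha> 1, omega \<alpha> 6}"
  shows "u ` coset (lattice_point c) (L q) = coset (lattice_point c) (L q) \<longleftrightarrow>
    int q dvd 2 * c 1 + 2 * c 2 + 2 * c 3 + 3 * c 4 + 2 * c 5 + c 6 \<and>
    int q dvd c 1 - c 6 \<and> int q dvd c 2 - c 3 \<and> int q dvd c 3 - c 5"
proof -
  have multiple: "(\<exists>k::int. of_int m - of_int n = of_int k * (of_nat q :: real)) \<longleftrightarrow> int q dvd m - n" for m n
  proof -
    have "(of_int m - of_int n = of_int k * (of_nat q :: real)) \<longleftrightarrow> m - n = int q * k" for k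
    proof -
      have "(of_int m - of_int n = of_int k * (of_nat q :: real)) \<longleftrightarrow> of_int (m - n) = (of_int (int q * k) :: real)"
        by (simp add: mult.commute)
      then show ?thesis
        by (simp only: of_int_eq_iff)
    qed
    then show ?thesis
      by (simp add: dvd_def)
  qed
  have indices: "{0..6} = {0, 1, 2, 3, 4, 5, 6 :: nat}"
    by auto
  have "u ` coset (lattice_point c) (L q) = coset (lattice_point c) (L q) \<longleftrightarrow>
    int q dvd - (c 1 + 2 * c 2 + 2 * c 3 + 3 * c 4 + 2 * c 5 + c 6) - c 1 \<and>
    int q dvd c 1 - c 6 \<and> int q dvd c 2 - c 3 \<and> int q dvd c 3 - c 5 \<and> int q dvd c 4 - c 4 \<and>
    int q dvd c 5 - c 2 \<and> int q dvd c 6 - - (c 1 + 2 * c 2 + 2 * c 3 + 3 * c 4 + 2 * c 5 + c 6)"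
  proof -
    define d where "d i = (if i = 0 then - (c 1 + 2 * c 2 + 2 * c 3 + 3 * c 4 + 2 * c 5 + c 6) else c i)" for i
    have d: "aroot i \<bullet> lattice_point c = of_int (d i)" if "i \<in> {0..6}" for i
      using that aroot_inner_lattice_point[where c = c] by (cases "i = 0") (auto simp: d_def)
    have "u ` coset (lattice_point c) (L q) = coset (lattice_point c) (L q) \<longleftrightarrow>
        (\<forall>i\<in>{0..6}. int q dvd d i - d (rot i))"
      unfolding omega_fixed_iff[OF q lattice_point_in_Z u]
      by (intro ball_cong refl) (simp only: d rot_range multiple)
    then show ?thesis
      unfolding indices by (simp add: d_def)
  qed
  also have "\<dots> \<longleftrightarrow> int q dvd 2 * c 1 + 2 * c 2 + 2 * c 3 + 3 * c 4 + 2 * c 5 + c 6 \<and>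
    int q dvd c 1 - c 6 \<and> int q dvd c 2 - c 3 \<and> int q dvd c 3 - c 5" (is "?L \<longleftrightarrow> ?R")
  proof
    assume ?L
    then have "int q dvd - (- (c 1 + 2 * c 2 + 2 * c 3 + 3 * c 4 + 2 * c 5 + c 6) - c 1)"
      by (simp only: dvd_minus_iff)
    then show ?R
      using \<open>?L\<close> by (simp add: algebra_simps)
  next
    assume R: ?R
    let ?s = "2 * c 1 + 2 * c 2 + 2 * c 3 + 3 * c 4 + 2 * c 5 + c 6"
    have "int q dvd - (c 1 + 2 * c 2 + 2 * c 3 + 3 * c 4 + 2 * c 5 + c 6) - c 1"
      by (rule dvd_combination[of _ ?s ?s _ "- 1" 0]) (use R in simp_all)
    moreover have "int q dvd c 5 - c 2"
      by (rule dvd_combination[of _ "c 2 - c 3" "c 3 - c 5" _ "- 1" "- 1"]) (use R in simp_all)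
    moreover have "int q dvd c 6 - - (c 1 + 2 * c 2 + 2 * c 3 + 3 * c 4 + 2 * c 5 + c 6)"
      by (rule dvd_combination[of _ ?s "c 1 - c 6" _ 1 "- 1"]) (use R in simp_all)
    ultimately show ?L
      using R by simp
  qed
  finally show ?thesis .
qed

lemma card_omega_fixed:
  assumes q: "q > 0" and u: "u \<in> {omega \<alpha> 1, omega \<alpha> 6}"
  shows "chi E \<Phi> q u = card (fixed_triples q)"
proof -
  let ?h = "\<lambda>(a, b, c). coset (lattice_point (fixed_coords a b c)) (L q)"
  let ?T = "{t \<in> arrangement_complement E \<Phi> q. u ` t = t}"
  have "bij_betw ?h (fixed_triples q) ?T"
  proof (rule bij_betw_imageI)
    show "inj_on ?h (fixed_triples q)"
    proof (rule inj_onI)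
      fix p p' assume p: "p \<in> fixed_triples q" "p' \<in> fixed_triples q" "?h p = ?h p'"
      obtain a b c a' b' c' where abc: "p = (a, b, c)" "p' = (a', b', c')"
        by (cases p, cases p')
      have cong: "int q dvd fixed_coords a b c i - fixed_coords a' b' c' i" if "i \<in> {1..6}" for i
        using p(3) that unfolding abc by (intro lattice_points_congruentD) (simp_all only: coset_eq_iff case_prod_conv)
      have "int q dvd a - a'" "int q dvd b - b'" "int q dvd c - c'"
        using cong[of 1] cong[of 2] cong[of 4] by simp_all
      then show "p = p'"
        using p(1,2) residues_cong_imp_eq[of _ "int q"] unfolding abc fixed_triples_def by blast
    qed
    show "?h ` fixed_triples q = ?T"
    proof (intro equalityI subsetI)
      fix t assume "t \<in> ?h ` fixed_triples q"
      then obtain a b c where abc: "(a, b, c) \<in> fixed_triples q" "t = ?h (a, b, c)"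
        by auto
      have "int q dvd 2 * a + 2 * b + 2 * b + 3 * c + 2 * b + a"
        using abc(1) by (simp add: fixed_triples_def algebra_simps)
      then have "u ` t = t"
        unfolding abc(2) case_prod_conv omega_fixed_lattice_point[OF q u] by simp
      moreover have "regular q (lattice_point (fixed_coords a b c))"
        using abc(1) unfolding regular_lattice_point[OF q] pair_fixed_coords fixed_triples_def by blast
      ultimately show "t \<in> ?T"
        using abc(2) lattice_point_in_Z by (auto simp: arrangement_complement_eq)
    next
      fix t assume t: "t \<in> ?T"
      then obtain x where x: "x \<in> Z" "regular q x" "t = coset x (L q)"
        by (auto simp: arrangement_complement_eq)
      obtain c where c: "x = lattice_point c"
        using Z_lattice_point[OF x(1)] .
      have "u ` coset (lattice_point c) (L q) = coset (lattice_point c) (L q)"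
        using t x(3) c by simp
      then have fixed: "int q dvd c 1 - c 6" "int q dvd c 2 - c 3" "int q dvd c 3 - c 5"
        unfolding omega_fixed_lattice_point[OF q u] by simp_all
      define a b d where "a = c 1 mod int q" and "b = c 2 mod int q" and "d = c 4 mod int q"
      note abd = a_def b_def d_def
      have mods: "int q dvd c 1 - a" "int q dvd c 2 - b" "int q dvd c 4 - d"
        by (simp_all add: abd minus_mod_eq_mult_div)
      have "x - lattice_point (fixed_coords a b d) \<in> L q"
        unfolding c
      proof (rule lattice_points_congruent[OF q])
        fix i :: nat assume "i \<in> {1..6}"
        then show "int q dvd c i - fixed_coords a b d i"
        proof (rule index_cases)
          assume "i = 3"
          then show ?thesis
            using dvd_combination[OF mods(2) fixed(2), of "c 3 - b" 1 "- 1"] by simp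
        next
          assume "i = 5"
          have "int q dvd c 3 - b"
            using dvd_combination[OF mods(2) fixed(2), of "c 3 - b" 1 "- 1"] by simp
          from dvd_combination[OF this fixed(3), of "c 5 - b" 1 "- 1"] show ?thesis
            by (simp add: \<open>i = 5\<close>)
        next
          assume "i = 6"
          then show ?thesis
            using dvd_combination[OF mods(1) fixed(1), of "c 6 - a" 1 "- 1"] by simp
        qed (use mods in simp_all)
      qed
      then have teq: "t = coset (lattice_point (fixed_coords a b d)) (L q)"
          and reg: "regular q (lattice_point (fixed_coords a b d))"
        using x(2) regular_congruent by (auto simp: x(3) coset_eq_iff)
      have "u ` t = t"
        using t by simp
      then have "int q dvd 3 * (a + 2 * b + d)"
        unfolding teq omega_fixed_lattice_point[OF q u] by (simp add: algebra_simps)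
      moreover have "a \<in> {0..<int q}" "b \<in> {0..<int q}" "d \<in> {0..<int q}"
        using q by (simp_all add: abd)
      ultimately have "(a, b, d) \<in> fixed_triples q"
        using reg unfolding regular_lattice_point[OF q] pair_fixed_coords fixed_triples_def by blast
      then show "t \<in> ?h ` fixed_triples q"
        using teq by force
    qed
  qed
  then show ?thesis
    unfolding chi_def by (rule bij_betw_same_card[symmetric])
qed

lemma chi_omega:
  assumes q: "q > 0" and u: "u \<in> {omega \<alpha> 1, omega \<alpha> 6}"
  shows "\<not> 3 dvd q \<Longrightarrow> chi E \<Phi> q u = 0"
    and "3 dvd q \<Longrightarrow> int (chi E \<Phi> q u) =
      (if even q then 2 * (int q - 6)\<^sup>2 else 2 * (int q - 3) * (int q - 9))"
proof -
  show "chi E \<Phi> q u = 0" if "\<not> 3 dvd q"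
    using card_omega_fixed[OF q u] fixed_triples_empty[OF that] by simp
  assume "3 dvd q"
  then obtain m where m: "q = 3 * m"
    by (rule dvdE)
  then have "int (card (fixed_triples q)) = 2 * int (card (G2_regular (int m)))"
    using card_fixed_triples[OF m] q by simp
  then show "int (chi E \<Phi> q u) = (if even q then 2 * (int q - 6)\<^sup>2 else 2 * (int q - 3) * (int q - 9))"
    using card_omega_fixed[OF q u] card_G2_regular[of "int m"] q by (simp add: m)
qed

end

lemma gcd_6_cases:
  fixes q :: nat
  shows "gcd 6 q = 1 \<Longrightarrow> odd q \<and> \<not> 3 dvd q" "gcd 6 q = 2 \<Longrightarrow> even q \<and> \<not> 3 dvd q"
    "gcd 6 q = 3 \<Longrightarrow> odd q \<and> 3 dvd q" "gcd 6 q = 6 \<Longrightarrow> even q \<and> 3 dvd q"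
proof -
  have "2 dvd gcd 6 q \<longleftrightarrow> even q" "3 dvd gcd 6 q \<longleftrightarrow> 3 dvd q"
    by simp_all
  then show "gcd 6 q = 1 \<Longrightarrow> odd q \<and> \<not> 3 dvd q" "gcd 6 q = 2 \<Longrightarrow> even q \<and> \<not> 3 dvd q"
    "gcd 6 q = 3 \<Longrightarrow> odd q \<and> 3 dvd q" "gcd 6 q = 6 \<Longrightarrow> even q \<and> 3 dvd q"
    by (simp_all del: gcd_greatest_iff)
qed

lemma sols7_factorised:
  fixes q :: nat
  defines "Q \<equiv> int q"
  shows "gcd 6 q = 1 \<Longrightarrow> sols7 q = (Q - 1) * (Q - 4) * (Q - 5) * (Q - 7) * (Q - 8) * (Q - 11)"
    "gcd 6 q = 2 \<Longrightarrow> sols7 q = (Q - 2) * (Q - 4) * (Q - 8) * (Q - 10) * (Q^2 - 12 * Q + 26)"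
    "gcd 6 q = 3 \<Longrightarrow> sols7 q = (Q - 3) * (Q - 9) * (Q^4 - 24 * Q^3 + 195 * Q^2 - 612 * Q + 480)"
    "gcd 6 q = 6 \<Longrightarrow> sols7 q = (Q - 6)^2 * (Q^4 - 24 * Q^3 + 186 * Q^2 - 504 * Q + 480)"
  by (drule gcd_6_cases, simp add: sols7_def Q_def power_expand algebra_simps)+

theorem theorem5p8:
  fixes E \<Phi> :: "'a::euclidean_space set" and \<alpha> :: "nat \<Rightarrow> 'a"
  assumes "E6_root_system E \<Phi> \<alpha>"
  shows "stabilizer_alcove E \<Phi> \<alpha> = {id, omega \<alpha> 1, omega \<alpha> 6} \<and>
    (\<forall>\<omega> \<in> stabilizer_alcove E \<Phi> \<alpha>. \<forall>q::nat. q > 0 \<longrightarrow>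
      (let N = int (chi E \<Phi> q \<omega>); Q = int q in
        (\<omega> = id \<and> gcd 6 q = 1 \<longrightarrow>
           N = (Q - 1) * (Q - 4) * (Q - 5) * (Q - 7) * (Q - 8) * (Q - 11)) \<and>
        (\<omega> = id \<and> gcd 6 q = 2 \<longrightarrow>
           N = (Q - 2) * (Q - 4) * (Q - 8) * (Q - 10) * (Q^2 - 12 * Q + 26)) \<and>
        (\<omega> = id \<and> gcd 6 q = 3 \<longrightarrow>
           N = (Q - 3) * (Q - 9) * (Q^4 - 24 * Q^3 + 195 * Q^2 - 612 * Q + 480)) \<and>
        (\<omega> = id \<and> gcd 6 q = 6 \<longrightarrow>
           N = (Q - 6)^2 * (Q^4 - 24 * Q^3 + 186 * Q^2 - 504 * Q + 480)) \<and>
        (\<omega> \<in> {omega \<alpha> 1, omega \<alpha> 6} \<and> gcd 6 q \<in> {1, 2} \<longrightarrow> N = 0) \<and>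
        (\<omega> \<in> {omega \<alpha> 1, omega \<alpha> 6} \<and> gcd 6 q = 3 \<longrightarrow> N = 2 * (Q - 3) * (Q - 9)) \<and>
        (\<omega> \<in> {omega \<alpha> 1, omega \<alpha> 6} \<and> gcd 6 q = 6 \<longrightarrow> N = 2 * (Q - 6)^2)))"
proof -
  interpret e6 E \<Phi> \<alpha>
    by (rule e6.intro) (rule assms)
  show ?thesis
    unfolding Let_def
  proof (intro conjI ballI allI impI)
    show "stabilizer_alcove E \<Phi> \<alpha> = {id, omega \<alpha> 1, omega \<alpha> 6}"
      by (simp only: stabilizer_alcove Omega_def)
  next
    fix \<omega> and q :: nat assume q: "q > 0"
    note om = chi_omega[OF q, of \<omega>]
    show "int (chi E \<Phi> q \<omega>) = (int q - 1) * (int q - 4) * (int q - 5) * (int q - 7) * (int q - 8) * (int q - 11)"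
      if "\<omega> = id \<and> gcd 6 q = 1"
      using that chi_id[OF q] sols7_factorised(1)[of q] by simp
    show "int (chi E \<Phi> q \<omega>) = (int q - 2) * (int q - 4) * (int q - 8) * (int q - 10) * ((int q)^2 - 12 * int q + 26)"
      if "\<omega> = id \<and> gcd 6 q = 2"
      using that chi_id[OF q] sols7_factorised(2)[of q] by simp
    show "int (chi E \<Phi> q \<omega>) = (int q - 3) * (int q - 9) * ((int q)^4 - 24 * (int q)^3 + 195 * (int q)^2 - 612 * int q + 480)"
      if "\<omega> = id \<and> gcd 6 q = 3"
      using that chi_id[OF q] sols7_factorised(3)[of q] by simp
    show "int (chi E \<Phi> q \<omega>) = (int q - 6)^2 * ((int q)^4 - 24 * (int q)^3 + 186 * (int q)^2 - 504 * int q + 480)"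
      if "\<omega> = id \<and> gcd 6 q = 6"
      using that chi_id[OF q] sols7_factorised(4)[of q] by simp
    show "int (chi E \<Phi> q \<omega>) = 0"
      if "\<omega> \<in> {omega \<alpha> 1, omega \<alpha> 6} \<and> gcd 6 q \<in> {1, 2}"
      using that om(1) gcd_6_cases(1,2)[of q] by auto
    show "int (chi E \<Phi> q \<omega>) = 2 * (int q - 3) * (int q - 9)"
      if "\<omega> \<in> {omega \<alpha> 1, omega \<alpha> 6} \<and> gcd 6 q = 3"
      using that om(2) gcd_6_cases(3)[of q] by simp
    show "int (chi E \<Phi> q \<omega>) = 2 * (int q - 6)^2"
      if "\<omega> \<in> {omega \<alpha> 1, omega \<alpha> 6} \<and> gcd 6 q = 6"
      using that om(2) gcd_6_cases(4)[of q] by simp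
  qed
qed

end
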